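(* Let $K$ be a knot in $\mathbb{S}^3$ given by an $n$-crossing diagram $D_K$. Then Ng's conjecture holds for $K$, i.e. the map $h^*: X(\Sigma_2K)\to F_2(K)$ is an isomorphism of algebraic sets (a biregular map), if and only if $K$ admits no ghost characters.
   Context: Wirtinger data: $D_K$ has $n\ge 1$ crossings, hence arcs $1,\dots,n$, with Wirtinger presentation $G(K)=\langle m_1,\dots,m_n\mid r_1,\dots,r_{n-1}\rangle$ of the knot group $G(K)=\pi_1(E_K)$ ($E_K$ the knot exterior), where $m_i$ is the meridian of arc $i$. At each crossing with overarc $i$ and underarcs $j,k$ (labelled so that $j<k$), $(i,j,k)$ is called a Wirtinger triple. Character varieties: for a finitely generated group $G$, $X(G)$ is the set of characters $\chi_\rho=\mathrm{tr}\circ\rho$ of representations $\rho:G\to \mathrm{SL}_2(\mathbb{C})$, realized as a closed algebraic set by the traces of generators and of products of two and three of them (well defined up to biregular equivalence). For $g \in G$, $t_g(\chi_\rho)=\mathrm{tr}\,\rho(g)$. Fundamental variety: $F_2(K)\subset\mathbb{C}^{\binom n2}$ is the set of points $(x_{ij})_{1\le i<j\le n}$ such that $x_{ak}=x_{ij}x_{ai}-x_{aj}$ for every Wirtinger triple $(i,j,k)$ and every $1\le a\le n$, with the convention $x_{ii}=2$, $x_{ji}=x_{ij}$. Trace-free slice: $\rho:G(K)\to\mathrm{SL}_2(\mathbb{C})$ is trace-free if $\mathrm{tr}\,\rho(\text{meridian})=0$. $S_0(K)\subset\mathbb{C}^{\binom n2+\binom n3}$ is the closed algebraic set of points $(x_{ij};x_{ijk})$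 with $x_{ij}=-\mathrm{tr}\,\rho(m_im_j)$ $(i<j)$ and $x_{ijk}=-\mathrm{tr}\,\rho(m_im_jm_k)$ $(i<j<k)$, $\rho$ ranging over trace-free representations. Let $q:S_0(K)\to F_2(K)$, $(x_{ij};x_{ijk})\mapsto(x_{ij})$ (its image does lie in $F_2(K)$). Ghost characters: a ghost character of $K$ is a point of $F_2(K)$ that does not lift to $S_0(K)$, i.e. is not in the image of $q$. Branched cover: $\Sigma_2K$ is the $2$-fold cover of $\mathbb{S}^3$ branched along $K$, and $X(\Sigma_2K)=X(\pi_1(\Sigma_2K))$. With $p:C_2K\to E_K$ the $2$-fold cyclic cover, $\pi_1(\Sigma_2K)\cong \mathrm{Im}(p_* )/\langle\langle m_1^2\rangle\rangle$, where $\mathrm{Im}(p_* )\subset G(K)$ is the index-$2$ subgroup of elements with even image in $H_1(E_K)\cong\mathbb{Z}$. In particular each $m_im_j$ defines an element of $\pi_1(\Sigma_2K)$. The map $h^*:X(\Sigma_2K)\to F_2(K)$ is the polynomial map $\chi\mapsto (t_{m_im_j}(\chi))_{1\le i<j\le n}$ (its image does lie in $F_2(K)$). Equivalently it is dual to the ring homomorphism $h:\mathbb{C}[F_2(K)]\to\mathbb{C}[X(\Sigma_2K)]$, $x_{ij}\mapsto t_{m_im_j}$. *)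

theory Defs
  imports "HOL-Analysis.Determinants" "HOL-Algebra.Generated_Groups"
begin

section \<open>Affine algebraic sets\<close>

text \<open>
  A point of the affine space \<open>\<complex>\<^sup>I\<close>, for a finite index set \<open>I\<close>, is a function
  in \<open>extensional I\<close>.
\<close>

inductive_set polynomial_functions :: "'i set \<Rightarrow> (('i \<Rightarrow> complex) \<Rightarrow> complex) set"
  for I :: "'i set" where
  const: "(\<lambda>x. c) \<in> polynomial_functions I"
| coord: "i \<in> I \<Longrightarrow> (\<lambda>x. x i) \<in> polynomial_functions I"
| add: "p \<in> polynomial_functions I \<Longrightarrow> q \<in> polynomial_functions I \<Longrightarrow>
    (\<lambda>x. p x + q x) \<in> polynomial_functions I"
| mult: "p \<in> polynomial_functions I \<Longrightarrow> q \<in> polynomial_functions I \<Longrightarrow>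
    (\<lambda>x. p x * q x) \<in> polynomial_functions I"

definition polynomial_map ::
  "'i set \<Rightarrow> ('i \<Rightarrow> complex) set \<Rightarrow> 'j set \<Rightarrow> (('i \<Rightarrow> complex) \<Rightarrow> ('j \<Rightarrow> complex)) \<Rightarrow> bool" where
  "polynomial_map I V J f \<longleftrightarrow> (\<forall>j\<in>J. \<exists>p\<in>polynomial_functions I. \<forall>x\<in>V. f x j = p x)"

definition algebraic_isomorphism ::
  "'i set \<Rightarrow> ('i \<Rightarrow> complex) set \<Rightarrow> 'j set \<Rightarrow> ('j \<Rightarrow> complex) set \<Rightarrow>
    (('i \<Rightarrow> complex) \<Rightarrow> ('j \<Rightarrow> complex)) \<Rightarrow> bool" where
  "algebraic_isomorphism I V J W f \<longleftrightarrow>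
     bij_betw f V W \<and> polynomial_map I V J f \<and> polynomial_map J W I (inv_into V f)"


section \<open>Character varieties\<close>

definition SL2C :: "(complex^2^2) monoid" where
  "SL2C = \<lparr>carrier = {A. det A = 1}, mult = (**), one = mat 1\<rparr>"

definition characters :: "('a, 'b) monoid_scheme \<Rightarrow> ('a \<Rightarrow> complex) set" where
  "characters G = {restrict (\<lambda>g. trace (\<rho> g)) (carrier G) | \<rho>. \<rho> \<in> hom G SL2C}"

definition trace_indices :: "nat \<Rightarrow> nat list set" where
  "trace_indices r = {is. sorted_wrt (<) is \<and> set is \<subseteq> {..<r} \<and> length is \<in> {1, 2, 3}}"

text \<open>
  For a list \<open>gs\<close> of generators, \<open>trace_coordinates G gs chi\<close> consists of the values
  of \<open>chi\<close> at the generators and at the products of two and three of them (with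
  increasing indices); \<open>character_variety G gs\<close> is the resulting subset of affine space.
\<close>

definition trace_coordinates ::
  "('a, 'b) monoid_scheme \<Rightarrow> 'a list \<Rightarrow> ('a \<Rightarrow> complex) \<Rightarrow> (nat list \<Rightarrow> complex)" where
  "trace_coordinates G gs chi =
     (\<lambda>is \<in> trace_indices (length gs). chi (foldr (mult G) (map ((!) gs) is) \<one>\<^bsub>G\<^esub>))"

definition character_variety ::
  "('a, 'b) monoid_scheme \<Rightarrow> 'a list \<Rightarrow> (nat list \<Rightarrow> complex) set" where
  "character_variety G gs = trace_coordinates G gs ` characters G"


section \<open>Group presentations\<close>

text \<open>The letter \<open>(x, False)\<close> stands for the generator \<open>x\<close>, and \<open>(x, True)\<close> for its inverse.\<close>

type_synonym 'g word = "('g \<times> bool) list"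

definition words :: "'g set \<Rightarrow> 'g word set" where
  "words X = lists (X \<times> UNIV)"

inductive_set word_eq :: "'g set \<Rightarrow> 'g word set \<Rightarrow> ('g word \<times> 'g word) set"
  for X :: "'g set" and R :: "'g word set" where
  refl: "w \<in> words X \<Longrightarrow> (w, w) \<in> word_eq X R"
| sym: "(v, w) \<in> word_eq X R \<Longrightarrow> (w, v) \<in> word_eq X R"
| trans: "(u, v) \<in> word_eq X R \<Longrightarrow> (v, w) \<in> word_eq X R \<Longrightarrow> (u, w) \<in> word_eq X R"
| cancel: "u \<in> words X \<Longrightarrow> v \<in> words X \<Longrightarrow> x \<in> X \<Longrightarrow>
    (u @ [(x, b), (x, \<not> b)] @ v, u @ v) \<in> word_eq X R"
| relator: "u \<in> words X \<Longrightarrow> v \<in> words X \<Longrightarrow> r \<in> R \<Longrightarrow> r \<in> words X \<Longrightarrow>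
    (u @ r @ v, u @ v) \<in> word_eq X R"

definition presented_group :: "'g set \<Rightarrow> 'g word set \<Rightarrow> 'g word set monoid" where
  "presented_group X R =
     \<lparr>carrier = words X // word_eq X R,
      mult = (\<lambda>A B. \<Union>a\<in>A. \<Union>b\<in>B. word_eq X R `` {a @ b}),
      one = word_eq X R `` {[]}\<rparr>"

definition exponent_sum :: "'g word \<Rightarrow> int" where
  "exponent_sum w = (\<Sum>(x, b)\<leftarrow>w. if b then - 1 else 1)"


section \<open>Knot diagrams\<close>

text \<open>
  An oriented diagram with \<open>n\<close> crossings \<open>0, \<dots>, n - 1\<close> is encoded by its signed Gauss
  code.  Travelling once along the knot, one passes through a crossing at the times
  \<open>0, \<dots>, 2 * n - 1\<close>; the crossing \<open>c\<close> is met at time \<open>over D c\<close> on the upper strand and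
  at time \<open>under D c\<close> on the lower strand, and \<open>positive D c\<close> gives its sign.
  Edge \<open>p\<close> is the part of the curve travelled between the times \<open>p\<close> and \<open>p + 1\<close>
  (modulo \<open>2 * n\<close>), and \<open>arc D p\<close> is the label of the arc containing it.
\<close>

record knot_diagram =
  crossings :: nat
  over :: "nat \<Rightarrow> nat"
  under :: "nat \<Rightarrow> nat"
  positive :: "nat \<Rightarrow> bool"
  arc :: "nat \<Rightarrow> nat"

definition edge_in :: "knot_diagram \<Rightarrow> nat \<Rightarrow> nat" where
  "edge_in D p = (p + 2 * crossings D - 1) mod (2 * crossings D)"

text \<open>
  A half-edge is an edge together with one of its ends: \<open>(e, True)\<close> is the beginning and
  \<open>(e, False)\<close> the end of \<open>e\<close>.  The list \<open>half_edges_at D c\<close> gives the four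
  half-edges at \<open>c\<close> in counterclockwise order, beginning with the outgoing upper one.
\<close>

definition half_edges :: "knot_diagram \<Rightarrow> (nat \<times> bool) set" where
  "half_edges D = {..<2 * crossings D} \<times> UNIV"

definition half_edges_at :: "knot_diagram \<Rightarrow> nat \<Rightarrow> (nat \<times> bool) list" where
  "half_edges_at D c =
    (let over_out = (over D c, True); over_in = (edge_in D (over D c), False);
         under_out = (under D c, True); under_in = (edge_in D (under D c), False)
     in if positive D c then [over_out, under_out, over_in, under_in]
        else [over_out, under_in, over_in, under_out])"

text \<open>
  Walking around a face of the diagram: from a half-edge go to the other end of the edge,
  and there to the next half-edge in counterclockwise order.  This is a permutation of the
  half-edges, and its orbits are the faces of the closed surface carrying the diagram.
\<close>

definition face_step :: "knot_diagram \<Rightarrow> ((nat \<times> bool) \<times> (nat \<times> bool)) set" where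
  "face_step D =
    {((e, b), half_edges_at D c ! (Suc k mod 4)) | e b c k.
       c < crossings D \<and> k < 4 \<and> half_edges_at D c ! k = (e, \<not> b)}"

definition faces :: "knot_diagram \<Rightarrow> (nat \<times> bool) set set" where
  "faces D = half_edges D // ((face_step D)\<^sup>* \<inter> half_edges D \<times> half_edges D)"

text \<open>
  There are \<open>n\<close> under-passes, hence \<open>n\<close> arcs; as edges joined by an over-pass carry
  the same label, surjectivity of the labelling onto \<open>{1..n}\<close> means that the arcs are
  numbered bijectively.  The final condition says that the surface carrying the (connected)
  diagram has Euler characteristic 2, i.e. is the sphere.
\<close>

definition is_knot_diagram :: "knot_diagram \<Rightarrow> bool" where
  "is_knot_diagram D \<longleftrightarrow>
     crossings D \<ge> 1 \<and>
     bij_betw (\<lambda>(c, b). if b then over D c else under D c)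
       ({..<crossings D} \<times> UNIV) {..<2 * crossings D} \<and>
     (\<forall>c<crossings D. arc D (edge_in D (over D c)) = arc D (over D c)) \<and>
     arc D ` {..<2 * crossings D} = {1..crossings D} \<and>
     int (crossings D) - int (2 * crossings D) + int (card (faces D)) = 2"

definition over_arc :: "knot_diagram \<Rightarrow> nat \<Rightarrow> nat" where
  "over_arc D c = arc D (over D c)"

definition under_arc_in :: "knot_diagram \<Rightarrow> nat \<Rightarrow> nat" where
  "under_arc_in D c = arc D (edge_in D (under D c))"

definition under_arc_out :: "knot_diagram \<Rightarrow> nat \<Rightarrow> nat" where
  "under_arc_out D c = arc D (under D c)"

text \<open>
  The two under-arcs at a crossing are different unless the diagram has one crossing only;
  in that case the triple is \<open>(1, 1, 1)\<close>.
\<close>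

definition wirtinger_triples :: "knot_diagram \<Rightarrow> (nat \<times> nat \<times> nat) set" where
  "wirtinger_triples D =
     {(over_arc D c, min (under_arc_in D c) (under_arc_out D c),
       max (under_arc_in D c) (under_arc_out D c)) | c. c < crossings D}"


section \<open>The knot group and the double branched cover\<close>

text \<open>
  The relator at \<open>c\<close> is read off counterclockwise from the four strands at \<open>c\<close>, as in
  \<open>half_edges_at\<close>: with over-arc \<open>i\<close>, incoming under-arc \<open>j\<close> and outgoing under-arc \<open>k\<close>
  it is \<open>m\<^sub>i m\<^sub>k m\<^sub>i\<inverse> m\<^sub>j\<inverse>\<close> at a positive and \<open>m\<^sub>i m\<^sub>j\<inverse> m\<^sub>i\<inverse> m\<^sub>k\<close> at a negative crossing.
\<close>

definition wirtinger_relator :: "knot_diagram \<Rightarrow> nat \<Rightarrow> nat word" where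
  "wirtinger_relator D c =
    (let i = over_arc D c; j = under_arc_in D c; k = under_arc_out D c
     in if positive D c then [(i, False), (k, False), (i, True), (j, True)]
        else [(i, False), (j, True), (i, True), (k, False)])"

text \<open>As usual, the relator at the last crossing is left out.\<close>

definition knot_group :: "knot_diagram \<Rightarrow> nat word set monoid" where
  "knot_group D =
     presented_group {1..crossings D} (wirtinger_relator D ` {..<crossings D - 1})"

definition meridian :: "knot_diagram \<Rightarrow> nat \<Rightarrow> nat word set" where
  "meridian D i =
     word_eq {1..crossings D} (wirtinger_relator D ` {..<crossings D - 1}) `` {[(i, False)]}"

text \<open>
  The isomorphism from \<open>H\<^sub>1\<close> of the knot exterior to \<open>\<int>\<close> sends each meridian to 1, so
  that a word in the meridians is mapped to its exponent sum.
\<close>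

definition even_subgroup :: "knot_diagram \<Rightarrow> nat word set set" where
  "even_subgroup D = {g \<in> carrier (knot_group D). \<exists>w\<in>g. even (exponent_sum w)}"

definition normal_closure :: "('a, 'b) monoid_scheme \<Rightarrow> 'a set \<Rightarrow> 'a set" where
  "normal_closure G S =
     generate G {g \<otimes>\<^bsub>G\<^esub> s \<otimes>\<^bsub>G\<^esub> inv\<^bsub>G\<^esub> g | g s. g \<in> carrier G \<and> s \<in> S}"

definition double_cover_group :: "knot_diagram \<Rightarrow> nat word set monoid" where
  "double_cover_group D = (knot_group D)\<lparr>carrier := even_subgroup D\<rparr>"

definition branch_kernel :: "knot_diagram \<Rightarrow> nat word set set" where
  "branch_kernel D =
     normal_closure (double_cover_group D) {meridian D 1 \<otimes>\<^bsub>knot_group D\<^esub> meridian D 1}"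

text \<open>The fundamental group of the double branched cover.\<close>

definition branched_cover_group :: "knot_diagram \<Rightarrow> nat word set set monoid" where
  "branched_cover_group D = double_cover_group D Mod branch_kernel D"

definition meridian_product :: "knot_diagram \<Rightarrow> nat \<Rightarrow> nat \<Rightarrow> nat word set set" where
  "meridian_product D i j =
     branch_kernel D #>\<^bsub>double_cover_group D\<^esub> (meridian D i \<otimes>\<^bsub>knot_group D\<^esub> meridian D j)"


section \<open>The fundamental variety, ghost characters, and the map \<open>h\<^sup>*\<close>\<close>

definition arc_pairs :: "knot_diagram \<Rightarrow> (nat \<times> nat) set" where
  "arc_pairs D = {(i, j). 1 \<le> i \<and> i < j \<and> j \<le> crossings D}"

definition arc_triples :: "knot_diagram \<Rightarrow> (nat \<times> nat \<times> nat) set" where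
  "arc_triples D = {(i, j, k). 1 \<le> i \<and> i < j \<and> j < k \<and> k \<le> crossings D}"

definition pair_coord :: "(nat \<times> nat \<Rightarrow> complex) \<Rightarrow> nat \<Rightarrow> nat \<Rightarrow> complex" where
  "pair_coord x i j = (if i = j then 2 else if i < j then x (i, j) else x (j, i))"

definition fundamental_variety :: "knot_diagram \<Rightarrow> (nat \<times> nat \<Rightarrow> complex) set" where
  "fundamental_variety D =
     {x \<in> extensional (arc_pairs D).
        \<forall>(i, j, k) \<in> wirtinger_triples D. \<forall>a \<in> {1..crossings D}.
          pair_coord x a k = pair_coord x i j * pair_coord x a i - pair_coord x a j}"

definition trace_free_reps :: "knot_diagram \<Rightarrow> (nat word set \<Rightarrow> complex^2^2) set" where
  "trace_free_reps D =
     {\<rho> \<in> hom (knot_group D) SL2C. \<forall>i \<in> {1..crossings D}. trace (\<rho> (meridian D i)) = 0}"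

definition trace_free_slice ::
  "knot_diagram \<Rightarrow> ((nat \<times> nat \<Rightarrow> complex) \<times> (nat \<times> nat \<times> nat \<Rightarrow> complex)) set" where
  "trace_free_slice D =
     {(\<lambda>(i, j) \<in> arc_pairs D.
         - trace (\<rho> (meridian D i \<otimes>\<^bsub>knot_group D\<^esub> meridian D j)),
       \<lambda>(i, j, k) \<in> arc_triples D.
         - trace (\<rho> (meridian D i \<otimes>\<^bsub>knot_group D\<^esub> meridian D j \<otimes>\<^bsub>knot_group D\<^esub> meridian D k)))
      | \<rho>. \<rho> \<in> trace_free_reps D}"

text \<open>The projection from the slice to the fundamental variety is \<open>fst\<close>.\<close>

definition ghost_characters :: "knot_diagram \<Rightarrow> (nat \<times> nat \<Rightarrow> complex) set" where
  "ghost_characters D = fundamental_variety D - fst ` trace_free_slice D"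

definition h_star ::
  "knot_diagram \<Rightarrow> (nat word set set \<Rightarrow> complex) \<Rightarrow> (nat \<times> nat \<Rightarrow> complex)" where
  "h_star D chi = (\<lambda>(i, j) \<in> arc_pairs D. chi (meridian_product D i j))"

text \<open>
  \<open>h_star\<close> as a map on the character variety; a character is determined by its trace
  coordinates with respect to a generating list.
\<close>

definition h_star_coords ::
  "knot_diagram \<Rightarrow> nat word set set list \<Rightarrow> (nat list \<Rightarrow> complex) \<Rightarrow> (nat \<times> nat \<Rightarrow> complex)" where
  "h_star_coords D gs =
     h_star D \<circ> inv_into (characters (branched_cover_group D))
       (trace_coordinates (branched_cover_group D) gs)"

definition ng_conjecture :: "knot_diagram \<Rightarrow> nat word set set list \<Rightarrow> bool" where
  "ng_conjecture D gs \<longleftrightarrow>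
     algebraic_isomorphism
       (trace_indices (length gs)) (character_variety (branched_cover_group D) gs)
       (arc_pairs D) (fundamental_variety D)
       (h_star_coords D gs)"

end

(*
  Write pi for the fundamental group of the double branched cover and a_i for the value of a
  representation of pi in SL2(C) at m_1 m_i, so that h* sends its character to the Gram matrix
  tr(a_i^-1 a_j).  Conjugation by m_1 induces an involution tau of pi with a_i -> a_i^-1, which
  does not change the Gram matrix.

  The elements of pi are alternating words a_i^-1 a_j a_k^-1 ..., and tau exchanges the two kinds of
  alternation.  As in a Clifford algebra, tr(w) + tr(tau w) is a polynomial in the Gram matrix, and
  hence so is (tr(w) - tr(tau w))^2.  A point of F_2(K) coming from a trace-free representation
  comes from a tau-invariant character; so if there are no ghost characters, then all characters of
  pi are tau-invariant and are polynomials in the Gram matrix, which inverts h*.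

  Conversely, if h* is injective, then all characters of pi are tau-invariant.  Then the
  trace-free parts of the a_i span a proper subspace of sl2(C), and a trace-free matrix B that is
  orthogonal to all a_i gives a trace-free lift m_i -> B a_i (if B is nilpotent, the a_i have a common
  eigenvector, and their eigenvalues give the lift).

  Two general facts enter.  By Fricke and Vogt the traces of words are polynomials in the
  traces of products of at most three generators.  Moreover, h* has values in F_2(K) only because
  the relator omitted from the Wirtinger presentation is a consequence of the others, which rests on
  Euler's formula for the diagram.
*)
theory Submission
  imports Defs
begin

section \<open>Presented groups\<close>

text \<open>What ties the two directions together is the number trace (a_i a_j a_k) - trace (a_k a_j
  a_i). Up to a constant factor it is the determinant of the trace-free parts of the three matrices,
  so tau-invariance forces these parts into a plane and yields the orthogonal vector B. The Gram
  matrix fixes such a difference trace (w) - trace (tau w) only up to sign. Invariance is therefore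
  not read off from a polynomial formula; it is inherited from a second representation with the same
  Gram matrix, on which tau acts by conjugation, so that its differences vanish. Trace-free matrices
  of determinant 1 have square -1, while meridians become involutions modulo the branch kernel. The
  factor i that mediates between them gives odd words determinant -1; hence the detour through
  \<open>GL2C\<close>, with only the even words landing in \<open>SL2C\<close>. The generating list
  \<open>gs\<close> is arbitrary, so all maps must be polynomial in coordinates about which nothing
  is known. This is where Fricke and Vogt are needed, as well as for the fact that a character is
  determined by its coordinates, which gives \<open>h_star_coords\<close> its meaning.\<close>

lemma words_simps [simp]:
  "[] \<in> words X" "(p # w) \<in> words X \<longleftrightarrow> fst p \<in> X \<and> w \<in> words X"
  "(v @ w) \<in> words X \<longleftrightarrow> v \<in> words X \<and> w \<in> words X"
  by (auto simp: words_def mem_Times_iff)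

lemma word_eq_words: "(v, w) \<in> word_eq X R \<Longrightarrow> v \<in> words X \<and> w \<in> words X"
  by (induction rule: word_eq.induct) auto

lemma equiv_word_eq: "equiv (words X) (word_eq X R)"
proof (rule equivI)
  show "refl_on (words X) (word_eq X R)"
    by (auto simp: refl_on_def intro: word_eq.refl)
  show "sym (word_eq X R)" by (auto simp: sym_def intro: word_eq.sym)
  show "trans (word_eq X R)" by (auto simp: trans_def intro: word_eq.trans)
  show "word_eq X R \<subseteq> words X \<times> words X" using word_eq_words by auto
qed

lemma word_eq_context:
  assumes "(v, w) \<in> word_eq X R" "a \<in> words X" "b \<in> words X"
  shows "(a @ v @ b, a @ w @ b) \<in> word_eq X R"
  using assms
proof (induction rule: word_eq.induct)
  case (cancel u v x c)
  then show ?case using word_eq.cancel[of "a @ u" X "v @ b" x c R] by simp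
next
  case (relator u v r)
  then show ?case using word_eq.relator[of "a @ u" X "v @ b" r R] by simp
qed (auto intro: word_eq.intros)

lemma word_eq_append:
  assumes "(v, v') \<in> word_eq X R" "(w, w') \<in> word_eq X R"
  shows "(v @ w, v' @ w') \<in> word_eq X R"
proof -
  have "(v @ w, v' @ w) \<in> word_eq X R"
    using word_eq_context[OF assms(1), of "[]" w] word_eq_words[OF assms(2)] by simp
  moreover have "(v' @ w, v' @ w') \<in> word_eq X R"
    using word_eq_context[OF assms(2), of v' "[]"] word_eq_words[OF assms(1)] by simp
  ultimately show ?thesis by (rule word_eq.trans)
qed

abbreviation word_class :: "'g set \<Rightarrow> 'g word set \<Rightarrow> 'g word \<Rightarrow> 'g word set" where
  "word_class X R w \<equiv> word_eq X R `` {w}"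

lemma word_class_eqI: "(v, w) \<in> word_eq X R \<Longrightarrow> word_class X R v = word_class X R w"
  using equiv_class_eq[OF equiv_word_eq] .

lemma carrier_presented_group: "carrier (presented_group X R) = word_class X R ` words X"
  by (auto simp: presented_group_def quotient_def)

lemma one_presented_group: "\<one>\<^bsub>presented_group X R\<^esub> = word_class X R []"
  by (simp add: presented_group_def)

lemma mult_presented_group:
  assumes "v \<in> words X" "w \<in> words X"
  shows "word_class X R v \<otimes>\<^bsub>presented_group X R\<^esub> word_class X R w = word_class X R (v @ w)"
proof -
  have "word_class X R (a @ b) = word_class X R (v @ w)"
    if "a \<in> word_class X R v" "b \<in> word_class X R w" for a b
    using that by (auto intro!: word_class_eqI intro: word_eq_append word_eq.sym)
  then have "(\<Union>a\<in>word_class X R v. \<Union>b\<in>word_class X R w. word_class X R (a @ b))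
      = (\<Union>a\<in>word_class X R v. \<Union>b\<in>word_class X R w. word_class X R (v @ w))"
    by simp
  moreover have "word_class X R v \<noteq> {}" "word_class X R w \<noteq> {}"
    using assms word_eq.refl by blast+
  ultimately show ?thesis by (simp add: presented_group_def)
qed

definition inverse_word :: "'g word \<Rightarrow> 'g word" where
  "inverse_word w = rev (map (\<lambda>(x, b). (x, \<not> b)) w)"

lemma inverse_word_words [simp]: "w \<in> words X \<Longrightarrow> inverse_word w \<in> words X"
  by (auto simp: inverse_word_def words_def)

lemma inverse_word_cancel:
  assumes "w \<in> words X"
  shows "(inverse_word w @ w, []) \<in> word_eq X R"
  using assms
proof (induction w)
  case Nil then show ?case by (simp add: inverse_word_def word_eq.refl)
next
  case (Cons p w)
  obtain x b where p: "p = (x, b)" by (cases p)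
  have "(inverse_word w @ [(x, \<not> b), (x, \<not> \<not> b)] @ w, inverse_word w @ w) \<in> word_eq X R"
    using Cons.prems p by (intro word_eq.cancel) auto
  then have "(inverse_word (p # w) @ p # w, inverse_word w @ w) \<in> word_eq X R"
    by (simp add: inverse_word_def p)
  with Cons show ?case by (auto intro: word_eq.trans)
qed

lemma group_presented_group: "group (presented_group X R)" (is "group ?G")
proof (rule groupI)
  fix x y z assume "x \<in> carrier ?G" "y \<in> carrier ?G" "z \<in> carrier ?G"
  then show "x \<otimes>\<^bsub>?G\<^esub> y \<otimes>\<^bsub>?G\<^esub> z = x \<otimes>\<^bsub>?G\<^esub> (y \<otimes>\<^bsub>?G\<^esub> z)"
    by (auto simp: carrier_presented_group mult_presented_group)
next
  fix x assume "x \<in> carrier ?G"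
  then obtain w where w: "x = word_class X R w" "w \<in> words X" by (auto simp: carrier_presented_group)
  show "\<exists>y\<in>carrier ?G. y \<otimes>\<^bsub>?G\<^esub> x = \<one>\<^bsub>?G\<^esub>"
  proof (rule bexI)
    show "word_class X R (inverse_word w) \<otimes>\<^bsub>?G\<^esub> x = \<one>\<^bsub>?G\<^esub>"
      using w inverse_word_cancel[OF w(2)]
      by (simp add: one_presented_group mult_presented_group word_class_eqI)
  qed (use w in \<open>simp add: carrier_presented_group\<close>)
qed (auto simp: carrier_presented_group mult_presented_group one_presented_group)

lemma inv_presented_group:
  assumes "w \<in> words X"
  shows "inv\<^bsub>presented_group X R\<^esub> word_class X R w = word_class X R (inverse_word w)"
proof -
  interpret group "presented_group X R" by (rule group_presented_group)
  show ?thesis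
    by (rule inv_equality)
      (use assms inverse_word_cancel[OF assms] in
        \<open>simp_all add: one_presented_group mult_presented_group word_class_eqI carrier_presented_group\<close>)
qed

section \<open>The universal property of a presentation\<close>

definition word_eval :: "('b, 'c) monoid_scheme \<Rightarrow> ('g \<Rightarrow> 'b) \<Rightarrow> 'g word \<Rightarrow> 'b" where
  "word_eval H f w = foldr (\<lambda>(x, b) y. (if b then inv\<^bsub>H\<^esub> f x else f x) \<otimes>\<^bsub>H\<^esub> y) w \<one>\<^bsub>H\<^esub>"

context group
begin

lemma word_eval_Nil [simp]: "word_eval G f [] = \<one>"
  by (simp add: word_eval_def)

lemma word_eval_Cons [simp]:
  "word_eval G f ((x, b) # w) = (if b then inv (f x) else f x) \<otimes> word_eval G f w"
  by (simp add: word_eval_def)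

lemma word_eval_closed [simp]:
  assumes "f \<in> X \<rightarrow> carrier G" "w \<in> words X"
  shows "word_eval G f w \<in> carrier G"
  using assms by (induction w) (auto simp: Pi_iff)

lemma word_eval_append:
  assumes "f \<in> X \<rightarrow> carrier G" "v \<in> words X" "w \<in> words X"
  shows "word_eval G f (v @ w) = word_eval G f v \<otimes> word_eval G f w"
  using assms(2)
proof (induction v)
  case (Cons p v)
  then have "f (fst p) \<in> carrier G" using assms(1) by auto
  then show ?case
    using Cons word_eval_closed[OF assms(1), of v] word_eval_closed[OF assms(1,3)] by (cases p) (auto simp: m_assoc)
qed (use assms in simp)

text \<open>Von Dyck's theorem. \<open>word_eq\<close> cancels only those relators that lie in
  \<open>words X\<close>, and the hypothesis on \<open>R\<close> is restricted accordingly.\<close>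

lemma presented_group_universal:
  assumes f: "f \<in> X \<rightarrow> carrier G" and R: "\<And>r. r \<in> R \<Longrightarrow> r \<in> words X \<Longrightarrow> word_eval G f r = \<one>"
  obtains h where "h \<in> hom (presented_group X R) G"
    "\<And>w. w \<in> words X \<Longrightarrow> h (word_class X R w) = word_eval G f w"
proof -
  have eq: "word_eval G f v = word_eval G f w" if "(v, w) \<in> word_eq X R" for v w
    using that
  proof (induction rule: word_eq.induct)
    case (cancel u v x b)
    then have "f x \<in> carrier G" using f by auto
    then have "(if b then inv (f x) else f x) \<otimes> ((if \<not> b then inv (f x) else f x) \<otimes> word_eval G f v) = word_eval G f v"
      using word_eval_closed[OF f, of v] cancel by (simp flip: m_assoc)
    then show ?case
      using cancel by (simp add: word_eval_append[OF f])
  next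
    case (relator u v r)
    then show ?case using R word_eval_closed[OF f, of v] by (simp add: word_eval_append[OF f])
  qed auto
  \<comment> \<open>An arbitrary representative of the class is evaluated; by \<open>eq\<close> the
    value does not depend on it.\<close>
  define h where "h A = word_eval G f (SOME w. w \<in> A)" for A
  have h: "h (word_class X R w) = word_eval G f w" if "w \<in> words X" for w
  proof -
    have "w \<in> word_class X R w" using that by (auto intro: word_eq.refl)
    then have "(SOME v. v \<in> word_class X R w) \<in> word_class X R w" by (rule someI)
    then show ?thesis unfolding h_def using eq by auto
  qed
  show thesis
  proof (rule that)
    show "h \<in> hom (presented_group X R) G"
      by (rule homI) (auto simp: carrier_presented_group h mult_presented_group word_eval_append[OF f] word_eval_closed[OF f])
  qed (fact h)
qed

end

section \<open>Flat labellings of planar four-valent maps\<close>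

text \<open>An edge with a flag is a dart, that is, the edge seen from one of its two ends;
  \<open>opp\<close> passes to the other end.\<close>

fun opp :: "'e \<times> bool \<Rightarrow> 'e \<times> bool" where
  "opp (e, b) = (e, \<not> b)"

lemma opp_opp [simp]: "opp (opp d) = d"
  by (cases d) simp

lemma fst_eq_iff_opp: "fst d = fst d' \<longleftrightarrow> d = d' \<or> d = opp d'"
  by (cases d; cases d') auto

text \<open>A breadth-first tree: \<open>par x\<close> is the last dart on a shortest path from
  \<open>r\<close> to \<open>x\<close>. No edge serves two nodes, because it would have to decrease
  the distance in both directions. With \<open>h\<close> left abstract, the same lemma gives a tree
  of the dual graph (\<open>h\<close> is the face of a dart) and one of the map itself
  (\<open>h\<close> is its vertex).\<close>

lemma spanning_tree:
  fixes h :: "'e \<times> bool \<Rightarrow> 'x"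
  assumes "\<And>x. x \<in> N \<Longrightarrow> (r, x) \<in> {(h (opp d), h d) | d. d \<in> DD}\<^sup>*"
  obtains dist :: "'x \<Rightarrow> nat" and par where
    "\<And>x. x \<in> N - {r} \<Longrightarrow> par x \<in> DD" "\<And>x. x \<in> N - {r} \<Longrightarrow> h (par x) = x"
    "\<And>x. x \<in> N - {r} \<Longrightarrow> dist (h (opp (par x))) < dist x"
    "inj_on (fst \<circ> par) (N - {r})"
proof -
  let ?R = "{(h (opp d), h d) | d. d \<in> DD}"
  define dist where "dist x = (LEAST k. (r, x) \<in> ?R ^^ k)" for x
  have "\<exists>d\<in>DD. h d = x \<and> dist (h (opp d)) < dist x" if "x \<in> N - {r}" for x
  proof -
    have "\<exists>k. (r, x) \<in> ?R ^^ k" using assms that by (auto dest: rtrancl_imp_relpow)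
    then have *: "(r, x) \<in> ?R ^^ dist x" unfolding dist_def by (rule LeastI_ex)
    moreover have "dist x \<noteq> 0"
    proof
      assume "dist x = 0"
      with * have "(r, x) \<in> ?R ^^ 0" by simp
      then show False using that by simp
    qed
    ultimately obtain k where k: "dist x = Suc k" "(r, x) \<in> ?R ^^ Suc k"
      by (cases "dist x") simp_all
    then obtain y where y: "(r, y) \<in> ?R ^^ k" "(y, x) \<in> ?R" by auto
    have "dist y \<le> k" unfolding dist_def by (rule Least_le) (fact y(1))
    obtain d where "d \<in> DD" "y = h (opp d)" "x = h d" using y(2) by blast
    then show ?thesis using \<open>dist y \<le> k\<close> k(1) by auto
  qed
  then have "\<forall>x\<in>N - {r}. \<exists>d. d \<in> DD \<and> h d = x \<and> dist (h (opp d)) < dist x" by blast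
  from bchoice[OF this] obtain par where
    par: "\<And>x. x \<in> N - {r} \<Longrightarrow> par x \<in> DD \<and> h (par x) = x \<and> dist (h (opp (par x))) < dist x"
    by blast
  have "inj_on (fst \<circ> par) (N - {r})"
  proof (rule inj_onI)
    fix x y assume xy: "x \<in> N - {r}" "y \<in> N - {r}" "(fst \<circ> par) x = (fst \<circ> par) y"
    then consider "par x = par y" | "par x = opp (par y)" by (auto simp: fst_eq_iff_opp)
    then show "x = y"
    proof cases
      case 1
      then show ?thesis using par[OF xy(1)] par[OF xy(2)] by metis
    next
      case 2
      then have "dist y < dist x" "dist x < dist y"
        using par[OF xy(1)] par[OF xy(2)] by (metis opp_opp)+
      then show ?thesis by simp
    qed
  qed
  with par show thesis by (intro that[of par dist]) blast+
qed

text \<open>A union of closed walks crosses a cut an even number of times: \<open>\<psi> d\<close>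
  starts where \<open>d\<close> ends, so as many darts of \<open>A\<close> start in \<open>S\<close>
  as end in \<open>S\<close>.\<close>

lemma even_cut_at_face:
  assumes fin: "finite A"
    and perm: "\<psi> ` A = A" and inj: "inj_on \<psi> A" and vt: "\<And>d. d \<in> A \<Longrightarrow> vt (\<psi> d) = vt (opp d)"
  shows "even (card {d \<in> A. (vt d \<in> S) \<noteq> (vt (opp d) \<in> S)})"
proof -
  let ?c = "\<lambda>d. of_bool (vt d \<in> S) :: nat"
  have "(\<Sum>d\<in>A. ?c (opp d)) = (\<Sum>d\<in>A. ?c (\<psi> d))"
    by (intro sum.cong) (simp_all add: vt)
  also have "\<dots> = (\<Sum>d\<in>A. ?c d)"
    using sum.reindex[OF inj, of ?c] perm by simp
  finally have "(\<Sum>d\<in>A. ?c d + ?c (opp d)) = 2 * (\<Sum>d\<in>A. ?c d)"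
    by (simp add: sum.distrib)
  moreover have "(\<Sum>d\<in>A. ?c d + ?c (opp d)) = (\<Sum>d\<in>A. of_bool ((vt d \<in> S) \<noteq> (vt (opp d) \<in> S)))
      + 2 * (\<Sum>d\<in>A. of_bool (vt d \<in> S \<and> vt (opp d) \<in> S))"
    unfolding sum_distrib_left sum.distrib[symmetric] by (intro sum.cong) auto
  moreover have "(\<Sum>d\<in>A. of_bool ((vt d \<in> S) \<noteq> (vt (opp d) \<in> S))) = card {d \<in> A. (vt d \<in> S) \<noteq> (vt (opp d) \<in> S)}"
    using fin by (simp add: sum_of_bool_eq Int_def)
  ultimately show ?thesis by presburger
qed

text \<open>Effect of a gauge transformation on the product around a four-valent vertex: the inner
  factors cancel and a conjugate remains.\<close>

lemma (in group) telescope4: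
  assumes "a \<in> carrier G" "b \<in> carrier G" "c \<in> carrier G" "d \<in> carrier G"
    and "p \<in> carrier G" "q \<in> carrier G" "r \<in> carrier G" "s \<in> carrier G"
  shows "a \<otimes> b \<otimes> c \<otimes> d = p \<otimes> ((inv p \<otimes> a \<otimes> q) \<otimes> (inv q \<otimes> b \<otimes> r) \<otimes> (inv r \<otimes> c \<otimes> s)
    \<otimes> (inv s \<otimes> d \<otimes> p)) \<otimes> inv p"
proof -
  have "x \<otimes> (inv x \<otimes> y) = y" if "x \<in> carrier G" "y \<in> carrier G" for x y
    using that by (simp flip: m_assoc)
  then show ?thesis using assms by (simp add: m_assoc)
qed

text \<open>A rotation system: \<open>rot v k\<close> is the \<open>k\<close>-th dart at
  \<open>v\<close> in cyclic order, and \<open>f d\<close> is the face along \<open>d\<close>. By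
  \<open>f_rot\<close>, a face is followed by going to the other end of an edge and turning to the
  next dart there. Connectedness is phrased as the absence of a proper nonempty set of darts closed
  under \<open>opp\<close> and turning, and \<open>euler\<close> makes the surface a sphere.\<close>

locale planar_map =
  fixes E :: "'e set" and V :: "'v set" and rot :: "'v \<Rightarrow> nat \<Rightarrow> 'e \<times> bool" and f :: "'e \<times> bool \<Rightarrow> 'f"
  assumes finE: "finite E" and finV: "finite V"
    and rot: "bij_betw (\<lambda>(v, k). rot v k) (V \<times> {..<4}) (E \<times> UNIV)"
    and f_rot: "\<And>v k. v \<in> V \<Longrightarrow> k < 4 \<Longrightarrow> f (rot v (Suc k mod 4)) = f (opp (rot v k))"
    and connected: "\<And>Z. Z \<subseteq> E \<times> UNIV \<Longrightarrow> Z \<noteq> {} \<Longrightarrow> (\<And>d. d \<in> Z \<Longrightarrow> opp d \<in> Z) \<Longrightarrow>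
      (\<And>v k. v \<in> V \<Longrightarrow> k < 4 \<Longrightarrow> rot v k \<in> Z \<Longrightarrow> rot v (Suc k mod 4) \<in> Z) \<Longrightarrow> Z = E \<times> UNIV"
    and euler: "card V + card (f ` (E \<times> UNIV)) = card E + 2"
begin

abbreviation "darts \<equiv> E \<times> (UNIV :: bool set)"

lemma opp_darts [simp]: "opp d \<in> darts \<longleftrightarrow> d \<in> darts"
  by (cases d) auto

lemma finite_darts: "finite darts"
  using finE by simp

definition vt :: "'e \<times> bool \<Rightarrow> 'v" where
  "vt d = fst (inv_into (V \<times> {..<4}) (\<lambda>(v, k). rot v k) d)"

lemma rot_darts: "v \<in> V \<Longrightarrow> k < 4 \<Longrightarrow> rot v k \<in> darts"
  using bij_betw_apply[OF rot, of "(v, k)"] by simp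

lemma vt_rot [simp]: "v \<in> V \<Longrightarrow> k < 4 \<Longrightarrow> vt (rot v k) = v"
  using inv_into_f_f[OF bij_betw_imp_inj_on[OF rot], of "(v, k)"] by (simp add: vt_def)

lemma rot_inj: "v \<in> V \<Longrightarrow> k < 4 \<Longrightarrow> k' < 4 \<Longrightarrow> rot v k = rot v k' \<Longrightarrow> k = k'"
  using inj_onD[OF bij_betw_imp_inj_on[OF rot], of "(v, k)" "(v, k')"] by simp

lemma dart_rot:
  assumes "d \<in> darts"
  obtains v k where "v \<in> V" "k < 4" "d = rot v k"
proof -
  have "d \<in> (\<lambda>(v, k). rot v k) ` (V \<times> {..<4})"
    using assms unfolding bij_betw_imp_surj_on[OF rot] .
  then obtain p where "p \<in> V \<times> {..<4}" "d = (\<lambda>(v, k). rot v k) p" by (rule imageE)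
  then show thesis using that[of "fst p" "snd p"] by (simp add: case_prod_unfold mem_Times_iff)
qed

text \<open>One step of the walk around a face: go to the other end of the edge, then turn to the
  next dart. On the darts of one face it is a permutation as required by
  \<open>even_cut_at_face\<close>.\<close>

definition face_perm :: "'e \<times> bool \<Rightarrow> 'e \<times> bool" where
  "face_perm d = rot (vt (opp d)) (Suc (THE k. k < 4 \<and> opp d = rot (vt (opp d)) k) mod 4)"

lemma face_perm_rot: "v \<in> V \<Longrightarrow> k < 4 \<Longrightarrow> face_perm (opp (rot v k)) = rot v (Suc k mod 4)"
proof -
  assume *: "v \<in> V" "k < 4"
  then have "(THE k'. k' < 4 \<and> rot v k = rot v k') = k"
    using rot_inj by (intro the_equality) auto
  then show ?thesis using * by (simp add: face_perm_def)
qed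

lemma dart_opp_rot:
  assumes "d \<in> darts"
  obtains v k where "v \<in> V" "k < 4" "d = opp (rot v k)"
proof -
  have "opp d \<in> darts" using assms by simp
  then obtain v k where "v \<in> V" "k < 4" "opp d = rot v k" by (rule dart_rot)
  moreover from this(3) have "d = opp (rot v k)" by (metis opp_opp)
  ultimately show thesis using that by blast
qed

lemma face_perm_props:
  assumes "d \<in> darts"
  shows "face_perm d \<in> darts" "f (face_perm d) = f d" "vt (face_perm d) = vt (opp d)"
proof -
  obtain v k where "v \<in> V" "k < 4" "d = opp (rot v k)" using assms by (rule dart_opp_rot)
  then show "face_perm d \<in> darts" "f (face_perm d) = f d" "vt (face_perm d) = vt (opp d)"
    by (simp_all add: face_perm_rot rot_darts f_rot del: mem_Sigma_iff)
qed

lemma inj_on_face_perm: "inj_on face_perm darts"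
proof (rule inj_onI)
  fix d d' assume d: "d \<in> darts" "d' \<in> darts" "face_perm d = face_perm d'"
  obtain v k where k: "v \<in> V" "k < 4" "d = opp (rot v k)" using d(1) by (rule dart_opp_rot)
  obtain v' k' where k': "v' \<in> V" "k' < 4" "d' = opp (rot v' k')" using d(2) by (rule dart_opp_rot)
  have eq: "rot v (Suc k mod 4) = rot v' (Suc k' mod 4)" using d(3) k k' by (simp add: face_perm_rot)
  then have "vt (rot v (Suc k mod 4)) = vt (rot v' (Suc k' mod 4))" by simp
  then have v: "v = v'" using k k' by simp
  then have "Suc k mod 4 = Suc k' mod 4" using rot_inj[OF k(1)] eq by simp
  then have "k = k'" using k(2) k'(2) by (auto simp: mod_Suc split: if_splits)
  then show "d = d'" using k k' v by simp
qed

lemma even_cut: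
  assumes "x \<in> f ` darts"
  shows "even (card {d \<in> darts. f d = x \<and> (vt d \<in> S) \<noteq> (vt (opp d) \<in> S)})"
proof -
  let ?A = "{d \<in> darts. f d = x}"
  have inj: "inj_on face_perm ?A" using inj_on_face_perm by (rule inj_on_subset) auto
  have "face_perm ` ?A \<subseteq> ?A" using face_perm_props by blast
  then have "face_perm ` ?A = ?A" using finite_darts inj by (intro endo_inj_surj) auto
  then have "even (card {d \<in> ?A. (vt d \<in> S) \<noteq> (vt (opp d) \<in> S)})"
    by (intro even_cut_at_face[OF _ _ inj]) (use finite_darts face_perm_props(3) in \<open>simp_all del: mem_Sigma_iff\<close>)
  then show ?thesis by (simp add: conj_assoc)
qed

lemma connected_reach:
  assumes "d0 \<in> darts" "\<And>d. d \<in> darts \<Longrightarrow> P d \<Longrightarrow> P (opp d)" "P d0"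
    "\<And>v k. v \<in> V \<Longrightarrow> k < 4 \<Longrightarrow> P (rot v k) \<Longrightarrow> P (rot v (Suc k mod 4))"
    "d \<in> darts"
  shows "P d"
proof -
  have "{d \<in> darts. P d} = darts"
  proof (rule connected)
    show "rot v (Suc k mod 4) \<in> {d \<in> darts. P d}"
      if "v \<in> V" "k < 4" "rot v k \<in> {d \<in> darts. P d}" for v k
      using that assms(4) rot_darts by simp
    show "opp d \<in> {d \<in> darts. P d}" if "d \<in> {d \<in> darts. P d}" for d
      using that assms(2) opp_darts by blast
  qed (use assms(1,3) in auto)
  then show ?thesis using assms(5) by blast
qed

text \<open>
  A spanning tree of the dual graph carries a gauge transformation that makes the labels of
  its edges trivial.  By Euler's formula the remaining edges are as few as those of a spanning
  tree of the map, and they connect the vertices: otherwise some cut of the map would consist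
  of tree edges only, but a cut meets every face an even number of times, so that a nonempty
  one does not fit into a tree.  Now the labels of the remaining edges are seen to be trivial
  successively, starting from the leaves.
\<close>

theorem flat_at_last_vertex:
  fixes G (structure)
  assumes "group G" and v0: "v0 \<in> V"
    and g_closed: "\<And>d. d \<in> darts \<Longrightarrow> g d \<in> carrier G"
    and g_opp: "\<And>d. d \<in> darts \<Longrightarrow> g (opp d) = inv (g d)"
    and flat: "\<And>v. v \<in> V \<Longrightarrow> v \<noteq> v0 \<Longrightarrow>
      g (rot v 0) \<otimes> g (rot v 1) \<otimes> g (rot v 2) \<otimes> g (rot v 3) = \<one>"
  shows "g (rot v0 0) \<otimes> g (rot v0 1) \<otimes> g (rot v0 2) \<otimes> g (rot v0 3) = \<one>"
proof -
  interpret group G by fact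
  let ?F = "f ` darts"
  define d0 where "d0 = rot v0 0"
  have d0: "d0 \<in> darts" "vt d0 = v0" using rot_darts[OF v0, of 0] v0 by (simp_all add: d0_def)
  define r where "r = f d0"
  \<comment> \<open>The dual graph is connected as well: turning at a vertex moves from the face of
    a dart to that of its opposite, which is adjacent to it.\<close>
  have "(r, f d) \<in> {(f (opp d), f d) | d. d \<in> darts}\<^sup>*" if "d \<in> darts" for d
  proof (rule connected_reach[OF d0(1) _ _ _ that])
    show step: "(r, f (opp d)) \<in> {(f (opp d), f d) | d. d \<in> darts}\<^sup>*"
      if "d \<in> darts" "(r, f d) \<in> {(f (opp d), f d) | d. d \<in> darts}\<^sup>*" for d
    proof -
      have "(f (opp (opp d)), f (opp d)) \<in> {(f (opp d), f d) | d. d \<in> darts}"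
        using that(1) opp_darts by blast
      then show ?thesis using that(2) by (simp add: rtrancl.rtrancl_into_rtrancl)
    qed
    show "(r, f (rot v (Suc k mod 4))) \<in> {(f (opp d), f d) | d. d \<in> darts}\<^sup>*"
      if "v \<in> V" "k < 4" "(r, f (rot v k)) \<in> {(f (opp d), f d) | d. d \<in> darts}\<^sup>*" for v k
      using step[OF rot_darts that(3)] that f_rot by simp
  qed (simp add: r_def)
  then have "(r, x) \<in> {(f (opp d), f d) | d. d \<in> darts}\<^sup>*" if "x \<in> ?F" for x
    using that by blast
  then obtain dF :: "'f \<Rightarrow> nat" and pF where
      pF: "\<And>x. x \<in> ?F - {r} \<Longrightarrow> pF x \<in> darts" "\<And>x. x \<in> ?F - {r} \<Longrightarrow> f (pF x) = x"
      "\<And>x. x \<in> ?F - {r} \<Longrightarrow> dF (f (opp (pF x))) < dF x" and injF: "inj_on (fst \<circ> pF) (?F - {r})"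
    by (rule spanning_tree[of ?F r f darts]) (assumption | rule that)+
  have finF: "finite ?F" using finite_darts by simp
  have rF: "r \<in> ?F" using d0 by (simp add: r_def)
  define T where "T = (fst \<circ> pF) ` (?F - {r})"
  define C where "C = E - T"
  have "T \<subseteq> E" using pF(1) by (force simp: T_def)
  have "card T = card ?F - 1"
    using card_image[OF injF] rF finF by (simp add: T_def)
  moreover have "card C = card E - card T"
    unfolding C_def using \<open>T \<subseteq> E\<close> finE by (meson card_Diff_subset finite_subset)
  moreover have "card ?F \<ge> 1" using rF finF by (metis One_nat_def Suc_leI card_gt_0_iff empty_iff)
  ultimately have cardC: "card C = card V - 1" using euler by linarith

  define R where "R = {(vt (opp d), vt d) | d. d \<in> C \<times> UNIV}"
  have RI: "(vt (opp d), vt d) \<in> R" if "d \<in> C \<times> UNIV" for d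
    unfolding R_def by (rule CollectI, rule exI[of _ d], use that in simp)
  have "(v0, v) \<in> R\<^sup>*" if "v \<in> V" for v
  proof (rule ccontr)
    assume "(v0, v) \<notin> R\<^sup>*"
    define S where "S = {v. (v0, v) \<in> R\<^sup>*}"
    define cut where "cut d \<longleftrightarrow> (vt d \<in> S) \<noteq> (vt (opp d) \<in> S)" for d
    have cut_opp: "cut (opp d) = cut d" for d by (auto simp: cut_def)
    have notC: "fst d \<in> T" if "d \<in> darts" "cut d" for d
    proof (rule ccontr)
      assume "fst d \<notin> T"
      then have "d \<in> C \<times> UNIV" "opp d \<in> C \<times> UNIV"
        using that(1) by (cases d; auto simp: C_def)+
      then have "(vt (opp d), vt d) \<in> R" "(vt d, vt (opp d)) \<in> R"
        using RI[of d] RI[of "opp d"] by simp_all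
      then have "vt d \<in> S \<longleftrightarrow> vt (opp d) \<in> S"
        unfolding S_def by (auto intro: rtrancl.rtrancl_into_rtrancl)
      then show False using that(2) by (simp add: cut_def)
    qed
    have "\<exists>d\<in>darts. cut d"
    proof (rule ccontr)
      assume no: "\<not> (\<exists>d\<in>darts. cut d)"
      have "vt d \<in> S" if "d \<in> darts" for d
      proof (rule connected_reach[OF d0(1) _ _ _ that])
        show "vt (opp d) \<in> S" if "d \<in> darts" "vt d \<in> S" for d
          using no that unfolding cut_def by blast
      qed (simp_all add: S_def d0)
      from this[of "rot v 0"] show False
        using \<open>v \<in> V\<close> \<open>(v0, v) \<notin> R\<^sup>*\<close> rot_darts by (simp add: S_def del: mem_Sigma_iff)
    qed
    then obtain d1 where d1: "d1 \<in> darts" "cut d1" by blast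
    define Q where "Q = {x \<in> ?F - {r}. cut (pF x)}"
    have Q: "\<exists>x\<in>Q. d = pF x \<or> d = opp (pF x)" if "d \<in> darts" "cut d" for d
    proof -
      have "fst d \<in> T" using that by (rule notC)
      then obtain x where x: "x \<in> ?F - {r}" "fst d = fst (pF x)" by (auto simp: T_def)
      then have "d = pF x \<or> d = opp (pF x)" by (simp add: fst_eq_iff_opp)
      moreover have "cut (pF x)" using calculation that(2) cut_opp by metis
      ultimately show ?thesis using x by (auto simp: Q_def)
    qed
    \<comment> \<open>Take a cut edge whose child face \<open>x\<close> is deepest in the dual tree.
      Another cut dart on \<open>x\<close> would cross over to a child of \<open>x\<close>, which is
      deeper; so \<open>x\<close> meets the cut exactly once, against parity.\<close>
    have "finite Q" "Q \<noteq> {}" using finF Q[OF d1] by (auto simp: Q_def)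
    then have "Max (dF ` Q) \<in> dF ` Q" by simp
    then obtain x where "x \<in> Q" "Max (dF ` Q) = dF x" by blast
    then have x: "x \<in> Q" "\<And>y. y \<in> Q \<Longrightarrow> dF y \<le> dF x"
      using \<open>finite Q\<close> Max_ge[of "dF ` Q"] by auto
    then have xF: "x \<in> ?F - {r}" "cut (pF x)" by (simp_all add: Q_def)
    have "{d \<in> darts. f d = x \<and> cut d} = {pF x}"
    proof (intro equalityI subsetI)
      fix d assume "d \<in> {d \<in> darts. f d = x \<and> cut d}"
      then have d: "d \<in> darts" "f d = x" "cut d" by auto
      obtain y where y: "y \<in> Q" "d = pF y \<or> d = opp (pF y)" using Q d by blast
      then have "y \<in> ?F - {r}" by (simp add: Q_def)
      then show "d \<in> {pF x}"
        using pF(2,3)[of y] x(2)[OF y(1)] y(2) d(2) by auto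
    qed (use pF[OF xF(1)] xF in simp)
    then have "card {d \<in> darts. f d = x \<and> cut d} = 1" by simp
    moreover have "even (card {d \<in> darts. f d = x \<and> cut d})"
      using even_cut[of x S] xF unfolding cut_def by blast
    ultimately show False by simp
  qed
  then obtain dV :: "'v \<Rightarrow> nat" and pV where
      pV: "\<And>x. x \<in> V - {v0} \<Longrightarrow> pV x \<in> C \<times> UNIV" "\<And>x. x \<in> V - {v0} \<Longrightarrow> vt (pV x) = x"
      "\<And>x. x \<in> V - {v0} \<Longrightarrow> dV (vt (opp (pV x))) < dV x" and injV: "inj_on (fst \<circ> pV) (V - {v0})"
    unfolding R_def by (rule spanning_tree[of V v0 vt "C \<times> UNIV"]) (assumption | rule that)+
  \<comment> \<open>The tree rooted at \<open>v0\<close> has |V| - 1 edges and lies in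
    \<open>C\<close>, which is of the same size; hence every edge of \<open>C\<close> joins some
    vertex to its parent.\<close>
  have "(fst \<circ> pV) ` (V - {v0}) = C"
  proof (rule card_subset_eq)
    show "finite C" using finE by (simp add: C_def)
    show "(fst \<circ> pV) ` (V - {v0}) \<subseteq> C" using pV(1) by force
    show "card ((fst \<circ> pV) ` (V - {v0})) = card C"
      using card_image[OF injV] v0 finV cardC by simp
  qed
  then have C: "\<exists>u\<in>V - {v0}. d = pV u \<or> d = opp (pV u)" if "fst d \<in> C" for d
    using that by (force simp: fst_eq_iff_opp)

  \<comment> \<open>A potential on the faces, built by recursion on the depth in the dual tree so
    that it absorbs the label of each tree edge. For \<open>K = 0\<close> there is nothing to
    satisfy, since a face other than the root has positive depth.\<close>
  have "\<exists>P. (\<forall>x. P x \<in> carrier G) \<and> (\<forall>x\<in>?F - {r}. dF x \<le> K \<longrightarrow> P x = g (pF x) \<otimes> P (f (opp (pF x))))" for K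
  proof (induction K)
    case 0
    then show ?case using pF(3) by (intro exI[of _ "\<lambda>_. \<one>"]) fastforce
  next
    case (Suc K)
    then obtain P where P: "\<And>x. P x \<in> carrier G"
      "\<And>x. x \<in> ?F - {r} \<Longrightarrow> dF x \<le> K \<Longrightarrow> P x = g (pF x) \<otimes> P (f (opp (pF x)))" by blast
    define P' where "P' x = (if x \<in> ?F - {r} \<and> dF x = Suc K then g (pF x) \<otimes> P (f (opp (pF x))) else P x)" for x
    have "P' x \<in> carrier G" for x
      using P(1) pF(1) g_closed by (simp add: P'_def del: mem_Sigma_iff)
    moreover have "P' x = g (pF x) \<otimes> P' (f (opp (pF x)))" if "x \<in> ?F - {r}" "dF x \<le> Suc K" for x
    proof -
      have "dF (f (opp (pF x))) \<noteq> Suc K" using pF(3)[OF that(1)] that(2) by simp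
      then have "P' (f (opp (pF x))) = P (f (opp (pF x)))" by (simp add: P'_def)
      then show ?thesis using that P(2)[OF that(1)] by (auto simp: P'_def le_Suc_eq)
    qed
    ultimately show ?case by blast
  qed
  from this[of "Max (dF ` ?F)"] obtain P where P: "\<And>x. P x \<in> carrier G"
      "\<And>x. x \<in> ?F - {r} \<Longrightarrow> P x = g (pF x) \<otimes> P (f (opp (pF x)))"
    using finF by (metis (no_types, lifting) DiffD1 Max_ge finite_imageI imageI)
  define g' where "g' d = inv (P (f d)) \<otimes> g d \<otimes> P (f (opp d))" for d
  have g'_closed: "g' d \<in> carrier G" if "d \<in> darts" for d
    using that P(1) g_closed by (simp add: g'_def del: mem_Sigma_iff)
  have g'_opp: "g' (opp d) = inv (g' d)" if "d \<in> darts" for d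
    using P(1) g_closed[OF that] g_opp[OF that] by (simp add: g'_def inv_mult_group m_assoc)
  have g'_opp1: "g' (opp d) = \<one>" if "d \<in> darts" "g' d = \<one>" for d
    using g'_opp[OF that(1)] that(2) by simp
  have T1: "g' d = \<one>" if "d \<in> darts" "fst d \<in> T" for d
  proof -
    from that(2) obtain x where x: "x \<in> ?F - {r}" "fst d = fst (pF x)" by (auto simp: T_def)
    have "inv (P x) \<otimes> (g (pF x) \<otimes> P (f (opp (pF x)))) = \<one>"
      unfolding P(2)[OF x(1), symmetric] using P(1) by simp
    then have "g' (pF x) = \<one>"
      using P(1) g_closed[OF pF(1)[OF x(1)]] pF(2)[OF x(1)] by (simp add: g'_def m_assoc)
    then show ?thesis using x pF(1)[OF x(1)] g'_opp1 by (auto simp: fst_eq_iff_opp)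
  qed
  have tele: "g (rot v 0) \<otimes> g (rot v 1) \<otimes> g (rot v 2) \<otimes> g (rot v 3) = 
      P (f (rot v 0)) \<otimes> (g' (rot v 0) \<otimes> g' (rot v 1) \<otimes> g' (rot v 2) \<otimes> g' (rot v 3)) \<otimes> inv (P (f (rot v 0)))"
    if "v \<in> V" for v
  proof -
    have c: "g (rot v k) \<in> carrier G" if "k < 4" for k using \<open>v \<in> V\<close> that g_closed rot_darts by simp
    have e: "g' (rot v k) = inv (P (f (rot v k))) \<otimes> g (rot v k) \<otimes> P (f (rot v (Suc k mod 4)))" if "k < 4" for k
      using \<open>v \<in> V\<close> that by (simp add: g'_def f_rot)
    have numerals: "Suc 0 mod 4 = 1" "Suc 1 mod 4 = 2" "Suc 2 mod 4 = 3" "Suc 3 mod 4 = 0" by simp_all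
    show ?thesis
      using e[of 0] e[of 1] e[of 2] e[of 3]
        telescope4[of "g (rot v 0)" "g (rot v 1)" "g (rot v 2)" "g (rot v 3)", OF c c c c P(1) P(1) P(1) P(1)]
      unfolding numerals by simp
  qed
  have flat': "g' (rot v 0) \<otimes> g' (rot v 1) \<otimes> g' (rot v 2) \<otimes> g' (rot v 3) = \<one>" if "v \<in> V" "v \<noteq> v0" for v
  proof -
    define z where "z = g' (rot v 0) \<otimes> g' (rot v 1) \<otimes> g' (rot v 2) \<otimes> g' (rot v 3)"
    have z: "z \<in> carrier G" unfolding z_def using that rot_darts g'_closed by simp
    have "P (f (rot v 0)) \<otimes> z \<otimes> inv (P (f (rot v 0))) = \<one>"
      using flat[OF that] tele[OF that(1)] by (simp add: z_def)
    then have "P (f (rot v 0)) \<otimes> z = P (f (rot v 0))"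
      using P(1) z by (metis inv_closed inv_inv inv_equality m_closed)
    then have "z = \<one>" using P(1) z by simp
    then show ?thesis by (simp only: z_def)
  qed
  \<comment> \<open>The induction goes downwards in the distance from \<open>v0\<close>. At
    \<open>v\<close>, each dart other than \<open>pV v\<close> belongs to \<open>T\<close> or leads
    to a child of \<open>v\<close>, so the relation at \<open>v\<close> reduces to the single factor
    \<open>g' (pV v)\<close>. Rooting the tree at \<open>v0\<close> means that only the relations at
    the other vertices are used up.\<close>
  have tree: "g' (pV v) = \<one>" if "v \<in> V - {v0}" for v
    using that
  proof (induction "Max (dV ` V) - dV v" arbitrary: v rule: less_induct)
    case less
    have pd: "pV u \<in> darts" if "u \<in> V - {v0}" for u using pV(1)[OF that] by (auto simp: C_def)
    have others: "g' d = \<one>" if d: "d \<in> darts" "vt d = v" "d \<noteq> pV v" for d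
    proof (cases "fst d \<in> T")
      case False
      then have "fst d \<in> C" using d(1) by (auto simp: C_def)
      from C[OF this] obtain u where u: "u \<in> V - {v0}" "d = pV u \<or> d = opp (pV u)" by blast
      then have eq: "d = opp (pV u)" using pV(2)[OF u(1)] d by auto
      then have "dV v < dV u" using pV(3)[OF u(1)] d(2) by simp
      moreover have "dV u \<le> Max (dV ` V)" using u(1) finV by simp
      ultimately have "g' (pV u) = \<one>" using less.hyps[OF _ u(1)] by simp
      then show ?thesis using g'_opp1[OF pd[OF u(1)]] eq by simp
    qed (use T1 d in blast)
    obtain w k where wk: "w \<in> V" "k < 4" "pV v = rot w k" using pd[OF less.prems] by (rule dart_rot)
    moreover have "w = v" using wk pV(2)[OF less.prems] by simp
    ultimately have k: "k < 4" "pV v = rot v k" "v \<in> V" by simp_all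
    have "g' (rot v k') = \<one>" if "k' < 4" "k' \<noteq> k" for k'
    proof (rule others)
      show "rot v k' \<noteq> pV v" using rot_inj[OF k(3) k(1) that(1)] that(2) k(2) by auto
    qed (use rot_darts[OF k(3) that(1)] that(1) k(3) in simp_all)
    moreover have "k = 0 \<or> k = 1 \<or> k = 2 \<or> k = 3" using k(1) by linarith
    moreover have "g' (rot v k) \<in> carrier G" using k g'_closed rot_darts by simp
    ultimately show ?case
      using flat'[of v] less.prems k(2) by auto
  qed
  have all: "g' d = \<one>" if "d \<in> darts" for d
  proof (cases "fst d \<in> T")
    case False
    then have "fst d \<in> C" using that by (auto simp: C_def)
    from C[OF this] obtain u where u: "u \<in> V - {v0}" "d = pV u \<or> d = opp (pV u)" by blast
    then show ?thesis using tree[OF u(1)] g'_opp1[of "opp d"] g'_opp1[of "pV u"] that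
      by (metis opp_darts opp_opp)
  qed (use T1 that in blast)
  show ?thesis
    unfolding tele[OF v0] using all[OF rot_darts[OF v0]] P(1) by simp
qed

end

section \<open>The sphere carrying a knot diagram\<close>

definition crossing_time :: "knot_diagram \<Rightarrow> nat \<Rightarrow> bool \<Rightarrow> nat" where
  "crossing_time D c b = (if b then over D c else under D c)"

definition face_class :: "knot_diagram \<Rightarrow> nat \<times> bool \<Rightarrow> (nat \<times> bool) set" where
  "face_class D d = ((face_step D)\<^sup>* \<inter> half_edges D \<times> half_edges D) `` {d}"

lemma half_edges_at_nth:
  assumes "k < 4"
  shows "half_edges_at D c ! k =
    (if k = 0 \<or> k = (if positive D c then 1 else 3) then (crossing_time D c (even k), True)
     else (edge_in D (crossing_time D c (even k)), False))"
proof -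
  have "k = 0 \<or> k = 1 \<or> k = 2 \<or> k = 3" using assms by linarith
  then show ?thesis by (auto simp: half_edges_at_def crossing_time_def Let_def)
qed

text \<open>The forward orbit of \<open>\<psi> x\<close> is mapped injectively into itself, hence
  onto itself by finiteness; so it contains a preimage of \<open>\<psi> x\<close>, which can only be
  \<open>x\<close>.\<close>

lemma finite_permutation_rtrancl_sym:
  assumes "finite H" "bij_betw \<psi> H H" "x \<in> H"
  shows "(\<psi> x, x) \<in> {(x, \<psi> x) | x. x \<in> H}\<^sup>*"
proof -
  let ?R = "{(x, \<psi> x) | x. x \<in> H}" and ?O = "{z \<in> H. (\<psi> x, z) \<in> {(x, \<psi> x) | x. x \<in> H}\<^sup>*}"
  have H: "\<psi> z \<in> H" if "z \<in> H" for z using bij_betw_apply[OF assms(2) that] .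
  have inj: "inj_on \<psi> H" using assms(2) by (rule bij_betw_imp_inj_on)
  have "\<psi> ` ?O \<subseteq> ?O"
  proof
    fix y assume "y \<in> \<psi> ` ?O"
    then obtain z where z: "z \<in> H" "(\<psi> x, z) \<in> ?R\<^sup>*" "y = \<psi> z" by blast
    then have "(z, y) \<in> ?R" by blast
    then show "y \<in> ?O" using z H by (auto intro: rtrancl.rtrancl_into_rtrancl)
  qed
  then have "\<psi> ` ?O = ?O"
    using assms(1) inj_on_subset[OF inj, of ?O] by (intro endo_inj_surj) auto
  moreover have "\<psi> x \<in> ?O" using H assms(3) by auto
  ultimately obtain z where "z \<in> ?O" "\<psi> x = \<psi> z" by blast
  then show ?thesis using inj_onD[OF inj, of x z] assms(3) by auto
qed

context
  fixes D :: knot_diagram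
  assumes D: "is_knot_diagram D"
begin

lemma crossings_pos: "crossings D \<ge> 1"
  using D by (simp add: is_knot_diagram_def)

lemma crossing_time_bij:
  "bij_betw (\<lambda>(c, b). crossing_time D c b) ({..<crossings D} \<times> UNIV) {..<2 * crossings D}"
  using D by (simp add: is_knot_diagram_def crossing_time_def)

lemma crossing_time_less: "c < crossings D \<Longrightarrow> crossing_time D c b < 2 * crossings D"
  using bij_betw_apply[OF crossing_time_bij, of "(c, b)"] by simp

lemma crossing_time_inj:
  "c < crossings D \<Longrightarrow> c' < crossings D \<Longrightarrow> crossing_time D c b = crossing_time D c' b' \<Longrightarrow> c = c' \<and> b = b'"
  using inj_onD[OF bij_betw_imp_inj_on[OF crossing_time_bij], of "(c, b)" "(c', b')"] by simp

lemma crossing_at: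
  assumes "t < 2 * crossings D"
  obtains c b where "c < crossings D" "t = crossing_time D c b"
proof -
  have "t \<in> (\<lambda>(c, b). crossing_time D c b) ` ({..<crossings D} \<times> UNIV)"
    using assms unfolding bij_betw_imp_surj_on[OF crossing_time_bij] by simp
  then obtain p where p: "p \<in> {..<crossings D} \<times> UNIV" "t = (\<lambda>(c, b). crossing_time D c b) p" by (rule imageE)
  then show thesis using that[of "fst p" "snd p"] by (simp add: case_prod_unfold mem_Times_iff)
qed

lemma edge_in_eq: "p < 2 * crossings D \<Longrightarrow> edge_in D p = (if p = 0 then 2 * crossings D - 1 else p - 1)"
proof (cases "p = 0")
  case False
  assume "p < 2 * crossings D"
  then have "edge_in D p = (p - 1 + 2 * crossings D) mod (2 * crossings D)"
    using False by (simp add: edge_in_def)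
  also have "\<dots> = p - 1" using \<open>p < 2 * crossings D\<close> by simp
  finally show ?thesis using False by simp
qed (use crossings_pos in \<open>simp add: edge_in_def\<close>)

lemma edge_in_less: "p < 2 * crossings D \<Longrightarrow> edge_in D p < 2 * crossings D"
  by (auto simp: edge_in_eq)

lemma edge_in_inj:
  assumes "p < 2 * crossings D" "p' < 2 * crossings D" "edge_in D p = edge_in D p'"
  shows "p = p'"
  using assms by (auto simp: edge_in_eq split: if_splits)

text \<open>After injectivity it is a count: four half-edges at each of n crossings against two ends
  of each of 2n edges.\<close>

lemma half_edges_at_bij:
  "bij_betw (\<lambda>(c, k). half_edges_at D c ! k) ({..<crossings D} \<times> {..<4}) ({..<2 * crossings D} \<times> UNIV)"
proof -
  let ?h = "\<lambda>(c, k). half_edges_at D c ! k" and ?A = "{..<crossings D} \<times> {..<4::nat}"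
    and ?B = "{..<2 * crossings D} \<times> (UNIV :: bool set)"
  have inj: "inj_on ?h ?A"
  proof (rule inj_onI, clarify)
    fix c k c' k' assume *: "c < crossings D" "k < (4::nat)" "c' < crossings D" "k' < (4::nat)"
      and eq: "half_edges_at D c ! k = half_edges_at D c' ! k'"
    then have "crossing_time D c (even k) = crossing_time D c' (even k')"
      using edge_in_inj crossing_time_less by (auto simp: half_edges_at_nth split: if_splits)
    then have c: "c = c'" and k: "even k = even k'" using crossing_time_inj * by blast+
    have "k = 0 \<or> k = 1 \<or> k = 2 \<or> k = 3" "k' = 0 \<or> k' = 1 \<or> k' = 2 \<or> k' = 3" using * by linarith+
    then show "c = c' \<and> k = k'"
      using eq c k by (auto simp: half_edges_at_nth split: if_splits)
  qed
  have sub: "?h ` ?A \<subseteq> ?B"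
    using crossing_time_less edge_in_less by (auto simp: half_edges_at_nth split: if_splits)
  have "card (?h ` ?A) = card ?B"
    using card_image[OF inj] by (simp add: card_cartesian_product)
  then have "?h ` ?A = ?B" using sub by (intro card_subset_eq) auto
  with inj show ?thesis by (simp add: bij_betw_def)
qed

lemma face_step_rot:
  "face_step D = {(opp (half_edges_at D c ! k), half_edges_at D c ! (Suc k mod 4)) | c k. c < crossings D \<and> k < 4}"
proof (intro equalityI subsetI)
  fix p assume "p \<in> face_step D"
  then obtain e b c k where p: "p = ((e, b), half_edges_at D c ! (Suc k mod 4))" "c < crossings D" "k < 4"
    "half_edges_at D c ! k = (e, \<not> b)" unfolding face_step_def by blast
  then have "(e, b) = opp (half_edges_at D c ! k)" by simp
  with p show "p \<in> {(opp (half_edges_at D c ! k), half_edges_at D c ! (Suc k mod 4)) | c k. c < crossings D \<and> k < 4}"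
    by blast
next
  fix p assume "p \<in> {(opp (half_edges_at D c ! k), half_edges_at D c ! (Suc k mod 4)) | c k. c < crossings D \<and> k < 4}"
  then obtain c k where p: "p = (opp (half_edges_at D c ! k), half_edges_at D c ! (Suc k mod 4))"
    "c < crossings D" "k < 4" by blast
  obtain e b where "half_edges_at D c ! k = (e, b)" by (cases "half_edges_at D c ! k")
  then have "half_edges_at D c ! k = (e, \<not> \<not> b)" "p = ((e, \<not> b), half_edges_at D c ! (Suc k mod 4))"
    using p by simp_all
  then show "p \<in> face_step D" unfolding face_step_def using p by blast
qed

text \<open>\<open>faces\<close> is defined with a reflexive transitive closure, and its classes are
  the orbits of the face walk only because that closure is symmetric. Symmetry holds since the walk
  \<open>\<psi>\<close> is a permutation of a finite set.\<close>

lemma face_class_rot: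
  assumes "c < crossings D" "k < 4"
  shows "face_class D (half_edges_at D c ! (Suc k mod 4)) = face_class D (opp (half_edges_at D c ! k))"
proof -
  let ?h = "\<lambda>(c, k). half_edges_at D c ! k" and ?A = "{..<crossings D} \<times> {..<4::nat}"
    and ?H = "half_edges D"
  have H: "?H = {..<2 * crossings D} \<times> UNIV" by (simp add: half_edges_def)
  have bij: "bij_betw ?h ?A ?H" unfolding H by (rule half_edges_at_bij)
  define s where "s = (\<lambda>(c :: nat, k). (c, Suc k mod 4))"
  have s: "bij_betw s ?A ?A"
  proof -
    have "inj_on s ?A"
      by (auto simp: inj_on_def s_def mod_Suc split: if_splits)
    moreover have "s ` ?A \<subseteq> ?A" by (auto simp: s_def)
    ultimately show ?thesis by (simp add: bij_betw_def endo_inj_surj)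
  qed
  have opp_bij: "bij_betw opp ?H ?H"
    by (rule bij_betw_byWitness[of _ opp]) (auto simp: H)
  define \<psi> where "\<psi> = ?h \<circ> s \<circ> inv_into ?A ?h \<circ> opp"
  have \<psi>: "bij_betw \<psi> ?H ?H"
    unfolding \<psi>_def comp_assoc
    by (rule bij_betw_trans[OF bij_betw_trans[OF bij_betw_trans[OF opp_bij bij_betw_inv_into[OF bij]] s] bij])
  have \<psi>_rot: "\<psi> (opp (half_edges_at D c ! k)) = half_edges_at D c ! (Suc k mod 4)"
    if "c < crossings D" "k < 4" for c k
    using inv_into_f_f[OF bij_betw_imp_inj_on[OF bij], of "(c, k)"] that by (simp add: \<psi>_def s_def)
  have mem: "opp (half_edges_at D c ! k) \<in> ?H" if "c < crossings D" "k < 4" for c k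
    using bij_betw_apply[OF opp_bij, OF bij_betw_apply[OF bij, of "(c, k)"]] that by simp
  have step: "face_step D = {(x, \<psi> x) | x. x \<in> ?H}"
  proof (intro equalityI subsetI)
    fix p assume "p \<in> face_step D"
    then obtain c k where "c < crossings D" "k < 4"
      "p = (opp (half_edges_at D c ! k), half_edges_at D c ! (Suc k mod 4))"
      unfolding face_step_rot by blast
    then show "p \<in> {(x, \<psi> x) | x. x \<in> ?H}" using \<psi>_rot mem by fastforce
  next
    fix p assume "p \<in> {(x, \<psi> x) | x. x \<in> ?H}"
    then obtain x where x: "x \<in> ?H" "p = (x, \<psi> x)" by blast
    then have "opp x \<in> ?H" using bij_betw_apply[OF opp_bij] by blast
    then obtain c k where ck: "c < crossings D" "k < 4" "opp x = half_edges_at D c ! k"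
      using bij_betw_imp_surj_on[OF bij] by force
    then have "x = opp (half_edges_at D c ! k)" by (metis opp_opp)
    then show "p \<in> face_step D" unfolding face_step_rot using x ck \<psi>_rot by auto
  qed
  define y where "y = opp (half_edges_at D c ! k)"
  define z where "z = half_edges_at D c ! (Suc k mod 4)"
  have "y \<in> ?H" using mem[OF assms] by (simp add: y_def)
  have z: "z = \<psi> y" using \<psi>_rot[OF assms] by (simp add: y_def z_def)
  have "z \<in> ?H" using bij_betw_apply[OF \<psi> \<open>y \<in> ?H\<close>] z by simp
  have "(y, z) \<in> (face_step D)\<^sup>*" unfolding step using \<open>y \<in> ?H\<close> z by blast
  moreover have "(z, y) \<in> (face_step D)\<^sup>*"
    unfolding step z using \<open>y \<in> ?H\<close> by (intro finite_permutation_rtrancl_sym[OF _ \<psi>]) (simp add: H)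
  ultimately have "face_class D z = face_class D y"
    unfolding face_class_def using \<open>y \<in> ?H\<close> \<open>z \<in> ?H\<close> by (auto intro: rtrancl_trans)
  then show ?thesis by (simp add: y_def z_def)
qed

lemma planar_map_diagram:
  "planar_map {..<2 * crossings D} {..<crossings D} (\<lambda>c k. half_edges_at D c ! k) (face_class D)"
proof
  show "bij_betw (\<lambda>(v, k). half_edges_at D v ! k) ({..<crossings D} \<times> {..<4}) ({..<2 * crossings D} \<times> UNIV)"
    by (rule half_edges_at_bij)
  show "face_class D (half_edges_at D v ! (Suc k mod 4)) = face_class D (opp (half_edges_at D v ! k))"
    if "v \<in> {..<crossings D}" "k < 4" for v k
    using face_class_rot that by simp
  have "faces D = face_class D ` ({..<2 * crossings D} \<times> UNIV)"
    unfolding faces_def quotient_def face_class_def half_edges_def by blast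
  then show "card {..<crossings D} + card (face_class D ` ({..<2 * crossings D} \<times> UNIV)) = card {..<2 * crossings D} + 2"
    using D by (simp add: is_knot_diagram_def)
  fix Z assume Z: "Z \<subseteq> {..<2 * crossings D} \<times> UNIV" "Z \<noteq> {}" and opp: "\<And>d. d \<in> Z \<Longrightarrow> opp d \<in> Z"
    and rot: "\<And>v k. v \<in> {..<crossings D} \<Longrightarrow> k < 4 \<Longrightarrow> half_edges_at D v ! k \<in> Z \<Longrightarrow>
      half_edges_at D v ! (Suc k mod 4) \<in> Z"
  \<comment> \<open>Turning twice at a crossing means going straight on along the same strand. A set
    closed under turning and \<open>opp\<close> thus contains with each edge the preceding one, and
    so the whole closed curve.\<close>
  have prev: "(edge_in D t, True) \<in> Z" if "t < 2 * crossings D" "(t, True) \<in> Z" for t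
  proof -
    obtain c b where c: "c < crossings D" "t = crossing_time D c b" using \<open>t < 2 * crossings D\<close> by (rule crossing_at)
    have "\<exists>k<4. half_edges_at D c ! k = (t, True) \<and>
      half_edges_at D c ! (Suc (Suc k mod 4) mod 4) = (edge_in D t, False)"
    proof (cases b)
      case True
      then show ?thesis using c by (intro exI[of _ 0]) (simp add: half_edges_at_nth)
    next
      case False
      then show ?thesis using c
        by (intro exI[of _ "if positive D c then 1 else 3"]) (simp add: half_edges_at_nth)
    qed
    then obtain k where "k < 4" "half_edges_at D c ! k = (t, True)"
      "half_edges_at D c ! (Suc (Suc k mod 4) mod 4) = (edge_in D t, False)" by blast
    then have "(edge_in D t, False) \<in> Z"
      using rot[of c k] rot[of c "Suc k mod 4"] c that by simp
    from opp[OF this] show ?thesis by simp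
  qed
  have down: "(j, True) \<in> Z" if "j \<le> m" "m < 2 * crossings D" "(m, True) \<in> Z" for j m
    using that
  proof (induction rule: inc_induct)
    case (step j)
    then show ?case using prev[of "Suc j"] by (simp add: edge_in_eq)
  qed
  obtain e b where "(e, b) \<in> Z" using Z(2) by auto
  then have e: "(e, True) \<in> Z" "e < 2 * crossings D"
    using opp[of "(e, b)"] Z(1) by (cases b; auto)+
  then have "(0, True) \<in> Z" using down[of 0 e] by simp
  then have "(2 * crossings D - 1, True) \<in> Z" using prev[of 0] crossings_pos by (simp add: edge_in_eq)
  then have all: "(j, True) \<in> Z" if "j < 2 * crossings D" for j
    using down[of j "2 * crossings D - 1"] that by simp
  show "Z = {..<2 * crossings D} \<times> UNIV"
  proof (intro equalityI Z(1) subsetI)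
    fix d assume "d \<in> {..<2 * crossings D} \<times> (UNIV :: bool set)"
    then obtain j b' where "d = (j, b')" "j < 2 * crossings D" by auto
    then show "d \<in> Z" using all[of j] opp[of "(j, True)"] by (cases b') auto
  qed
qed simp_all

lemma arc_range: "p < 2 * crossings D \<Longrightarrow> arc D p \<in> {1..crossings D}"
  using D unfolding is_knot_diagram_def by blast

lemma over_arc_range: "c < crossings D \<Longrightarrow> over_arc D c \<in> {1..crossings D}"
  using arc_range crossing_time_less[of c True] by (simp add: over_arc_def crossing_time_def)

lemma under_arc_in_range: "c < crossings D \<Longrightarrow> under_arc_in D c \<in> {1..crossings D}"
  using arc_range edge_in_less crossing_time_less[of c False]
  by (simp add: under_arc_in_def crossing_time_def)

lemma under_arc_out_range: "c < crossings D \<Longrightarrow> under_arc_out D c \<in> {1..crossings D}"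
  using arc_range crossing_time_less[of c False] by (simp add: under_arc_out_def crossing_time_def)

lemma group_knot_group: "group (knot_group D)"
  unfolding knot_group_def by (rule group_presented_group)

lemma wirtinger_relator_words:
  "c < crossings D \<Longrightarrow> wirtinger_relator D c \<in> words {1..crossings D}"
  using over_arc_range under_arc_in_range under_arc_out_range by (simp add: wirtinger_relator_def Let_def)

text \<open>
  The relator at a crossing is the product of the labels of its half-edges, each edge being
  labelled by its arc; so the relator that was left out of the presentation is a consequence of the
  others because the diagram lies on a sphere.
\<close>

lemma wirtinger_relator_trivial:
  assumes "c < crossings D"
  shows "word_class {1..crossings D} (wirtinger_relator D ` {..<crossings D - 1}) (wirtinger_relator D c)
    = \<one>\<^bsub>knot_group D\<^esub>"
proof -
  define X where "X = {1..crossings D}"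
  define R where "R = wirtinger_relator D ` {..<crossings D - 1}"
  let ?G = "knot_group D"
  interpret group ?G by (rule group_knot_group)
  interpret planar_map "{..<2 * crossings D}" "{..<crossings D}" "\<lambda>c k. half_edges_at D c ! k" "face_class D"
    by (rule planar_map_diagram)
  have G: "?G = presented_group X R" by (simp add: knot_group_def X_def R_def)
  have arc_X: "arc D e \<in> X" if "e < 2 * crossings D" for e using arc_range[OF that] by (simp add: X_def)
  \<comment> \<open>An outgoing half-edge is labelled by the generator of its arc, an incoming one
    by the inverse. The negation is due to opposite conventions: \<open>True\<close> marks the
    beginning of an edge, but an inverse letter.\<close>
  define g where "g = (\<lambda>(e, b). word_class X R [(arc D e, \<not> b)])"
  have product: "g (half_edges_at D c ! 0) \<otimes>\<^bsub>?G\<^esub> g (half_edges_at D c ! 1) \<otimes>\<^bsub>?G\<^esub> g (half_edges_at D c ! 2)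
      \<otimes>\<^bsub>?G\<^esub> g (half_edges_at D c ! 3) = word_class X R (wirtinger_relator D c)"
    if c: "c < crossings D" for c
  proof -
    \<comment> \<open>Both upper half-edges must carry the same arc for the product around the
      crossing to be the Wirtinger relator.\<close>
    have "arc D (edge_in D (over D c)) = arc D (over D c)" using D c by (simp add: is_knot_diagram_def)
    moreover have "arc D (over D c) \<in> X" "arc D (under D c) \<in> X" "arc D (edge_in D (under D c)) \<in> X"
      using arc_X edge_in_less crossing_time_less[OF c, of True] crossing_time_less[OF c, of False]
      by (simp_all add: crossing_time_def)
    ultimately show ?thesis
      unfolding G over_arc_def under_arc_in_def under_arc_out_def wirtinger_relator_def
      by (simp add: half_edges_at_def Let_def g_def mult_presented_group)
  qed
  have trivial: "word_class X R (wirtinger_relator D c) = \<one>\<^bsub>?G\<^esub>" if "c < crossings D - 1" for c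
    unfolding G one_presented_group
  proof (rule word_class_eqI)
    have "wirtinger_relator D c \<in> words X" using wirtinger_relator_words that by (simp add: X_def)
    moreover have "wirtinger_relator D c \<in> R" using that by (simp add: R_def)
    ultimately show "(wirtinger_relator D c, []) \<in> word_eq X R"
      using word_eq.relator[of "[]" X "[]" "wirtinger_relator D c" R] by simp
  qed
  have "word_class X R (wirtinger_relator D c) = \<one>\<^bsub>?G\<^esub>"
  proof (cases "c < crossings D - 1")
    case False
    then have c: "c = crossings D - 1" using assms by simp
    have "g (half_edges_at D c ! 0) \<otimes>\<^bsub>?G\<^esub> g (half_edges_at D c ! 1) \<otimes>\<^bsub>?G\<^esub> g (half_edges_at D c ! 2)
      \<otimes>\<^bsub>?G\<^esub> g (half_edges_at D c ! 3) = \<one>\<^bsub>?G\<^esub>"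
    proof (rule flat_at_last_vertex[OF group_knot_group])
      show "c \<in> {..<crossings D}" using assms by simp
      show "g d \<in> carrier ?G" if "d \<in> {..<2 * crossings D} \<times> UNIV" for d
        using that arc_X by (auto simp: g_def G carrier_presented_group)
      show "g (opp d) = inv\<^bsub>?G\<^esub> g d" if "d \<in> {..<2 * crossings D} \<times> UNIV" for d
        using that arc_X by (cases d) (auto simp: g_def G inv_presented_group inverse_word_def)
      show "g (half_edges_at D v ! 0) \<otimes>\<^bsub>?G\<^esub> g (half_edges_at D v ! 1) \<otimes>\<^bsub>?G\<^esub> g (half_edges_at D v ! 2)
        \<otimes>\<^bsub>?G\<^esub> g (half_edges_at D v ! 3) = \<one>\<^bsub>?G\<^esub>" if "v \<in> {..<crossings D}" "v \<noteq> c" for v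
        using product[of v] trivial[of v] that c by simp
    qed
    then show ?thesis using product assms by simp
  qed (use trivial in simp)
  then show ?thesis by (simp only: X_def R_def)
qed

end

section \<open>Matrices of size two\<close>

definition scale2 :: "complex \<Rightarrow> complex^2^2 \<Rightarrow> complex^2^2" (infixr \<open>\<cdot>\<close> 75)
  where "c \<cdot> A = (\<chi> i j. c * A $ i $ j)"

text \<open>The adjugate, written as the conjugation of the quaternion algebra of 2x2 matrices: a
  linear anti-automorphism whose norm form is the determinant, and which is inversion on determinant
  1. Unlike the inverse it is defined everywhere and satisfies polynomial identities.\<close>

definition adj2 :: "complex^2^2 \<Rightarrow> complex^2^2"
  where "adj2 A = trace A \<cdot> mat 1 - A"

lemma mat2_eq_iff: "A = B \<longleftrightarrow> A$1$1 = B$1$1 \<and> A$1$2 = B$1$2 \<and> A$2$1 = B$2$1 \<and> A$2$2 = B$2$2"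
  for A B :: "complex^2^2"
  by (auto simp: vec_eq_iff forall_2)

lemma trace_2: "trace A = A$1$1 + A$2$2" for A :: "complex^2^2"
  by (simp add: trace_def sum_2)

lemma mult_2: "(A ** B) $ i $ j = A$i$1 * B$1$j + A$i$2 * B$2$j" for A B :: "complex^2^2"
  by (simp add: matrix_matrix_mult_def sum_2)

lemma mat1_2: "(mat 1 :: complex^2^2) $ i $ j = (if i = j then 1 else 0)"
  by (simp add: mat_def)

lemma scale2_nth: "(c \<cdot> A) $ i $ j = c * A $ i $ j"
  by (simp add: scale2_def)

lemma adj2_nth: "adj2 A $ i $ j = (if i = j then trace A else 0) - A $ i $ j"
  by (simp add: adj2_def scale2_nth mat1_2)

lemmas mat2_simps = mat2_eq_iff trace_2 mult_2 mat1_2 det_2 scale2_nth adj2_nth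

lemma adj2_mult: "adj2 (A ** B) = adj2 B ** adj2 A"
  by (simp add: mat2_simps algebra_simps)

lemma adj2_adj2 [simp]: "adj2 (adj2 A) = A"
  by (simp add: mat2_simps)

lemma trace_adj2 [simp]: "trace (adj2 A) = trace A"
  by (simp add: mat2_simps)

lemma det_adj2 [simp]: "det (adj2 A) = det A"
  by (simp add: mat2_simps algebra_simps)

lemma adj2_one [simp]: "adj2 (mat 1) = mat 1"
  by (simp add: mat2_simps)

lemma adj2_right: "A ** adj2 A = det A \<cdot> mat 1"
  by (simp add: mat2_simps algebra_simps)

lemma adj2_left: "adj2 A ** A = det A \<cdot> mat 1"
  by (simp add: mat2_simps algebra_simps)

lemma one_scale2 [simp]: "1 \<cdot> A = A"
  by (simp add: mat2_simps)

text \<open>Fricke's identity, tr(AB) + tr(AB^-1) = tr(A) tr(B) on SL2(C).\<close>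

lemma trace_mult_adj2: "trace (A ** adj2 B) = trace A * trace B - trace (A ** B)"
  by (simp add: mat2_simps algebra_simps)

text \<open>Polarization of \<open>adj2_left\<close>. This is the Clifford relation on which the
  calculus of alternating words rests.\<close>

lemma adj2_polarized: "adj2 A ** B + adj2 B ** A = trace (adj2 A ** B) \<cdot> mat 1"
  by (simp add: mat2_simps algebra_simps)

lemma adj2_polarized': "A ** adj2 B + B ** adj2 A = trace (adj2 A ** B) \<cdot> mat 1"
  by (simp add: mat2_simps algebra_simps)

lemma trace_adj2_mult_commute: "trace (adj2 A ** B) = trace (adj2 B ** A)"
  by (simp add: mat2_simps algebra_simps)

lemma trace_square: "trace (A ** A) = trace A * trace A - 2 * det A" for A :: "complex^2^2"
  by (simp add: mat2_simps algebra_simps)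

lemma trace_square_mult: "trace (A ** A ** B) = trace A * trace (A ** B) - det A * trace B"
  for A :: "complex^2^2"
  by (simp add: mat2_simps; algebra)

text \<open>The sum of two expansions. ABC + CBA equals A(BC + CB) - (AC + CA)B + C(AB + BA), where
  the polarized Cayley-Hamilton identity applies to the brackets. ABC - CBA results from \<open>A **
  B ** C + adj2 (A ** B ** C) = trace (A ** B ** C) \<cdot> mat 1\<close> by multiplying out
  \<open>adj2 C ** adj2 B ** adj2 A\<close>.\<close>

lemma triple_product_reduction:
  fixes A B C :: "complex^2^2"
  shows "2 \<cdot> (A ** B ** C) = trace B \<cdot> (A ** C + C ** A) + (trace (B**C) - trace B * trace C) \<cdot> A
    + (- (trace (A**C) - trace A * trace C)) \<cdot> B + (trace (A**B) - trace A * trace B) \<cdot> C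
    + (trace (A**B**C) - trace A * trace B * trace C) \<cdot> mat 1
    + (trace B * trace C) \<cdot> A + (trace A * trace C) \<cdot> B + (trace A * trace B) \<cdot> C
    + (- trace C) \<cdot> (B ** A) + (- trace B) \<cdot> (C ** A) + (- trace A) \<cdot> (C ** B)"
  by (simp add: mat2_simps; algebra)

text \<open>Both cyclic orders of three matrices have traces with a sum polynomial in shorter
  traces; this is why coordinates with increasing indices suffice.\<close>

lemma trace_triple_swap:
  fixes A B C :: "complex^2^2"
  shows "trace (A ** C ** B) = - trace (A ** B ** C) + trace B * trace (A ** C) + trace C * trace (A ** B)
    + (trace (B ** C) - trace B * trace C) * trace A"
  by (simp add: mat2_simps; algebra)

section \<open>Traces of words in several matrices\<close>

definition word_trace_coords :: "nat \<Rightarrow> (nat \<Rightarrow> complex^2^2) \<Rightarrow> (nat list \<Rightarrow> complex)" where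
  "word_trace_coords r m = (\<lambda>is \<in> trace_indices r. trace (foldr (**) (map m is) (mat 1)))"

text \<open>The formula is tested on tuples of determinant 1 only, because the reduction of repeated
  letters by Cayley-Hamilton replaces determinants by 1.\<close>

definition trace_polynomials :: "nat \<Rightarrow> ((nat \<Rightarrow> complex^2^2) \<Rightarrow> complex) set" where
  "trace_polynomials r = {f. \<exists>p\<in>polynomial_functions (trace_indices r).
     \<forall>m. (\<forall>i<r. det (m i) = 1) \<longrightarrow> f m = p (word_trace_coords r m)}"

lemma trace_polynomials_const: "(\<lambda>m. c) \<in> trace_polynomials r"
  unfolding trace_polynomials_def by (auto intro!: bexI[OF _ polynomial_functions.const])

lemma trace_polynomials_add:
  assumes "f \<in> trace_polynomials r" "g \<in> trace_polynomials r"
  shows "(\<lambda>m. f m + g m) \<in> trace_polynomials r"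
proof -
  obtain p q where "p \<in> polynomial_functions (trace_indices r)" "q \<in> polynomial_functions (trace_indices r)"
    "\<forall>m. (\<forall>i<r. det (m i) = 1) \<longrightarrow> f m = p (word_trace_coords r m)"
    "\<forall>m. (\<forall>i<r. det (m i) = 1) \<longrightarrow> g m = q (word_trace_coords r m)"
    using assms unfolding trace_polynomials_def by blast
  then show ?thesis unfolding trace_polynomials_def
    by (auto intro!: bexI[OF _ polynomial_functions.add[of p _ q]])
qed

lemma trace_polynomials_mult:
  assumes "f \<in> trace_polynomials r" "g \<in> trace_polynomials r"
  shows "(\<lambda>m. f m * g m) \<in> trace_polynomials r"
proof -
  obtain p q where "p \<in> polynomial_functions (trace_indices r)" "q \<in> polynomial_functions (trace_indices r)"
    "\<forall>m. (\<forall>i<r. det (m i) = 1) \<longrightarrow> f m = p (word_trace_coords r m)"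
    "\<forall>m. (\<forall>i<r. det (m i) = 1) \<longrightarrow> g m = q (word_trace_coords r m)"
    using assms unfolding trace_polynomials_def by blast
  then show ?thesis unfolding trace_polynomials_def
    by (auto intro!: bexI[OF _ polynomial_functions.mult[of p _ q]])
qed

lemma trace_polynomials_uminus:
  assumes "f \<in> trace_polynomials r"
  shows "(\<lambda>m. - f m) \<in> trace_polynomials r"
  using trace_polynomials_mult[OF trace_polynomials_const[of "-1"] assms] by simp

lemma trace_polynomials_diff:
  assumes "f \<in> trace_polynomials r" "g \<in> trace_polynomials r"
  shows "(\<lambda>m. f m - g m) \<in> trace_polynomials r"
  using trace_polynomials_add[OF assms(1) trace_polynomials_uminus[OF assms(2)]] by simp

lemmas trace_polynomials_ring = trace_polynomials_const trace_polynomials_add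
  trace_polynomials_mult trace_polynomials_uminus trace_polynomials_diff

lemma trace_polynomials_cong:
  assumes "f \<in> trace_polynomials r" "\<And>m. (\<And>i. i < r \<Longrightarrow> det (m i) = 1) \<Longrightarrow> g m = f m"
  shows "g \<in> trace_polynomials r"
  using assms unfolding trace_polynomials_def by simp

lemma trace_polynomials_coord:
  assumes "is \<in> trace_indices r"
  shows "(\<lambda>m. trace (foldr (**) (map m is) (mat 1))) \<in> trace_polynomials r"
  unfolding trace_polynomials_def
  by (auto intro!: bexI[OF _ polynomial_functions.coord[OF assms]] simp: word_trace_coords_def assms)

lemma trace_polynomials_gen: "i < r \<Longrightarrow> (\<lambda>m. trace (m i)) \<in> trace_polynomials r"
  using trace_polynomials_coord[of "[i]" r] by (simp add: trace_indices_def)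

lemma trace_polynomials_gen2:
  assumes "i < r" "j < r"
  shows "(\<lambda>m. trace (m i ** m j)) \<in> trace_polynomials r"
proof -
  have *: "(\<lambda>m. trace (m i ** m j)) \<in> trace_polynomials r" if "i < j" "j < r" for i j
    using trace_polynomials_coord[of "[i, j]" r] that by (simp add: trace_indices_def)
  consider "i < j" | "j < i" | "i = j" by linarith
  then show ?thesis
  proof cases
    case 1 then show ?thesis using * assms by blast
  next
    case 2 then show ?thesis using *[OF 2 assms(1)] by (subst trace_mul_sym)
  next
    case 3
    have "(\<lambda>m. trace (m i) * trace (m i) - 2) \<in> trace_polynomials r"
      by (intro trace_polynomials_ring trace_polynomials_gen assms)
    then show ?thesis
      by (rule trace_polynomials_cong) (use assms 3 in \<open>simp add: trace_square\<close>)
  qed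
qed

lemma trace_rotate3: "trace (A ** B ** C) = trace (B ** C ** A)" for A :: "complex^2^2"
  by (metis matrix_mul_assoc trace_mul_sym)

text \<open>Cyclic rotation brings a least index to the front, \<open>swap\<close> then sorts
  distinct indices, and a repeated letter is removed by Cayley-Hamilton.\<close>

lemma trace_polynomials_gen3:
  assumes "i < r" "j < r" "k < r"
  shows "(\<lambda>m. trace (m i ** m j ** m k)) \<in> trace_polynomials r"
proof -
  let ?P = "\<lambda>i j k. (\<lambda>m. trace (m i ** m j ** m k)) \<in> trace_polynomials r"
  have sorted: "?P i j k" if "i < j" "j < k" "k < r" for i j k
    using trace_polynomials_coord[of "[i, j, k]" r] that
    by (simp add: trace_indices_def matrix_mul_assoc)
  have rot: "?P i j k \<longleftrightarrow> ?P j k i" for i j k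
    by (subst trace_rotate3) simp
  have swap: "?P i k j" if "?P i j k" "i < r" "j < r" "k < r" for i j k
    unfolding trace_triple_swap[of "_ i" "_ k" "_ j"]
    by (intro trace_polynomials_ring trace_polynomials_gen trace_polynomials_gen2 that)
  have eq: "?P i i k" if "i < r" "k < r" for i k
  proof -
    have "(\<lambda>m. trace (m i) * trace (m i ** m k) - trace (m k)) \<in> trace_polynomials r"
      by (intro trace_polynomials_ring trace_polynomials_gen trace_polynomials_gen2 that)
    then show ?thesis
      by (rule trace_polynomials_cong) (use that in \<open>simp add: trace_square_mult\<close>)
  qed
  have least: "?P i j k" if "i < j" "i < k" "j < r" "k < r" for i j k
  proof -
    have "i < r" using that by simp
    consider "j < k" | "k < j" | "j = k" by linarith
    then show ?thesis
    proof cases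
      case 1 then show ?thesis using sorted that by simp
    next
      case 2
      then have "?P i k j" using sorted that by simp
      then show ?thesis using swap that \<open>i < r\<close> by simp
    next
      case 3
      then show ?thesis using eq[of j i] that \<open>i < r\<close> rot[of i j j] by simp
    qed
  qed
  consider "i = j" | "j = k" | "k = i" | "i < j" "i < k" | "j < i" "j < k" | "k < i" "k < j"
    by linarith
  then show ?thesis
  proof cases
    case 1 then show ?thesis using eq assms by simp
  next
    case 2 then show ?thesis using eq[of j i] assms rot[of i j j] by simp
  next
    case 3 then show ?thesis using eq[of i j] assms rot[of i j i] rot[of j i i] by simp
  next
    case 4 then show ?thesis using least assms by simp
  next
    case 5 then show ?thesis using least[of j k i] assms rot[of i j k] by simp
  next
    case 6 then show ?thesis using least[of k i j] assms rot[of i j k] rot[of j k i] by simp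
  qed
qed

text \<open>The span, over the trace polynomials, of all products of at most two matrices. The
  reduction of triple products makes it an algebra, so it contains every word; its elements visibly
  have traces that are trace polynomials.\<close>

inductive_set word_module :: "nat \<Rightarrow> ((nat \<Rightarrow> complex^2^2) \<Rightarrow> complex^2^2) set" for r where
  one: "(\<lambda>m. mat 1) \<in> word_module r"
| gen: "i < r \<Longrightarrow> (\<lambda>m. m i) \<in> word_module r"
| gen2: "i < r \<Longrightarrow> j < r \<Longrightarrow> (\<lambda>m. m i ** m j) \<in> word_module r"
| add: "M \<in> word_module r \<Longrightarrow> N \<in> word_module r \<Longrightarrow> (\<lambda>m. M m + N m) \<in> word_module r"
| scale: "f \<in> trace_polynomials r \<Longrightarrow> M \<in> word_module r \<Longrightarrow> (\<lambda>m. f m \<cdot> M m) \<in> word_module r"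

lemma trace_scale2: "trace (c \<cdot> A) = c * trace A"
  by (simp add: mat2_simps algebra_simps)

lemma scale2_mult_right: "A ** (c \<cdot> B) = c \<cdot> (A ** B)"
  by (simp add: mat2_simps algebra_simps)

lemma scale2_mult_left: "(c \<cdot> A) ** B = c \<cdot> (A ** B)"
  by (simp add: mat2_simps algebra_simps)

lemma word_module_trace:
  assumes "M \<in> word_module r"
  shows "(\<lambda>m. trace (M m)) \<in> trace_polynomials r"
  using assms
proof induction
  case one then show ?case using trace_polynomials_const[of 2 r] by (simp add: trace_I)
qed (simp_all add: trace_polynomials_gen trace_polynomials_gen2 trace_add trace_scale2
      trace_polynomials_add trace_polynomials_mult)

text \<open>Only a product of two generators needs work: multiplied by a third it leaves the
  spanning set, and \<open>triple_product_reduction\<close> brings it back.\<close>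

lemma word_module_mult_gen:
  assumes "M \<in> word_module r" "k < r"
  shows "(\<lambda>m. m k ** M m) \<in> word_module r"
  using assms(1)
proof induction
  case one then show ?case using word_module.gen[OF assms(2)] by simp
next
  case (gen i) then show ?case using word_module.gen2[OF assms(2)] by simp
next
  case (gen2 i j)
  have *: "A = (1/2) \<cdot> (2 \<cdot> A)" for A :: "complex^2^2" by (simp add: mat2_simps)
  have "(\<lambda>m. (1/2) \<cdot> (2 \<cdot> (m k ** m i ** m j))) \<in> word_module r"
    unfolding triple_product_reduction
    by (intro word_module.intros trace_polynomials_ring trace_polynomials_gen trace_polynomials_gen2
        trace_polynomials_gen3 assms gen2)
  then show ?case unfolding *[symmetric] by (simp add: matrix_mul_assoc)
next
  case (add M N) then show ?case by (simp add: matrix_add_ldistrib word_module.add)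
next
  case (scale f M) then show ?case by (simp add: scale2_mult_right word_module.scale)
qed

lemma word_module_mult:
  assumes "M \<in> word_module r" "N \<in> word_module r"
  shows "(\<lambda>m. M m ** N m) \<in> word_module r"
  using assms(1)
proof induction
  case (gen2 i j)
  then show ?case using assms(2)
    by (simp add: matrix_mul_assoc[symmetric] word_module_mult_gen)
next
  case (add M M')
  have "(A + B) ** C = A ** C + B ** C" for A B C :: "complex^2^2"
    by (simp add: mat2_simps algebra_simps)
  with add show ?case by (simp add: word_module.add)
next
  case (scale f M) then show ?case by (simp add: scale2_mult_left word_module.scale)
qed (use assms(2) in \<open>simp_all add: word_module_mult_gen\<close>)

lemma word_module_adj2:
  assumes "i < r"
  shows "(\<lambda>m. adj2 (m i)) \<in> word_module r"
proof -
  have "(\<lambda>m. trace (m i) \<cdot> mat 1 + (-1) \<cdot> m i) \<in> word_module r"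
    by (intro word_module.intros trace_polynomials_ring trace_polynomials_gen assms)
  moreover have "adj2 A = trace A \<cdot> mat 1 + (-1) \<cdot> A" for A
    by (simp add: mat2_simps)
  ultimately show ?thesis by simp
qed

section \<open>Alternating words\<close>

text \<open>With \<open>a i\<close> the value at m_1 m_i, the element m_i m_j = (m_1 m_i)^-1 (m_1
  m_j) has the value \<open>adj2 (a i) ** a j\<close>. So \<open>alt_word a False l\<close> is the
  value of a word of even length in the meridians, and the flag \<open>True\<close> gives its image
  under the covering involution.\<close>

fun alt_word :: "(nat \<Rightarrow> complex^2^2) \<Rightarrow> bool \<Rightarrow> nat list \<Rightarrow> complex^2^2" where
  "alt_word a b [] = mat 1"
| "alt_word a b (i # l) = (if b then a i else adj2 (a i)) ** alt_word a (\<not> b) l"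

definition alt_trace :: "(nat \<Rightarrow> complex^2^2) \<Rightarrow> nat list \<Rightarrow> complex" where
  "alt_trace a l = trace (alt_word a False l) + trace (alt_word a True l)"

definition gram :: "(nat \<Rightarrow> complex^2^2) \<Rightarrow> nat \<Rightarrow> nat \<Rightarrow> complex" where
  "gram a i j = trace (adj2 (a i) ** a j)"

definition gram_coords :: "nat \<Rightarrow> (nat \<Rightarrow> complex^2^2) \<Rightarrow> (nat \<times> nat \<Rightarrow> complex)" where
  "gram_coords n a = (\<lambda>(i, j) \<in> {(i, j). 1 \<le> i \<and> i < j \<and> j \<le> n}. gram a i j)"

lemma gram_commute: "gram a i j = gram a j i"
  by (simp add: gram_def trace_adj2_mult_commute)

lemma gram_refl: "det (a i) = 1 \<Longrightarrow> gram a i i = 2"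
  by (simp add: gram_def adj2_left trace_I)

lemma pair_coord_gram_coords:
  assumes "i \<in> {1..n}" "j \<in> {1..n}" "\<And>i. i \<in> {1..n} \<Longrightarrow> det (a i) = 1"
  shows "pair_coord (gram_coords n a) i j = gram a i j"
  using assms gram_commute[of a i j] by (auto simp: pair_coord_def gram_coords_def gram_refl)

lemma matrix_add_rdistrib: "(A + B) ** C = A ** C + B ** C" for A B C :: "complex^2^2"
  by (simp add: mat2_simps algebra_simps)

lemma alt_word_append:
  "alt_word a b (l @ l') = alt_word a b l ** alt_word a (b = even (length l)) l'"
proof (induction l arbitrary: b)
  case (Cons i l)
  have "((\<not> b) = even (length l)) = (b = even (length (i # l)))" by auto
  then show ?case using Cons by (simp add: matrix_mul_assoc)
qed simp

text \<open>Neighbouring letters are always of opposite kinds, so the polarized norm identity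
  applies to them in any position.\<close>

lemma alt_word_swap:
  "alt_word a b (l @ i # j # l') + alt_word a b (l @ j # i # l') = gram a i j \<cdot> alt_word a b (l @ l')"
proof (induction l arbitrary: b)
  case Nil
  have "alt_word a b [i, j] + alt_word a b [j, i] = gram a i j \<cdot> mat 1"
    by (cases b) (simp_all add: gram_def adj2_polarized adj2_polarized')
  then have "(alt_word a b [i, j] + alt_word a b [j, i]) ** alt_word a b l' = gram a i j \<cdot> alt_word a b l'"
    by (simp add: scale2_mult_left)
  then show ?case by (simp add: matrix_add_rdistrib matrix_mul_assoc)
next
  case (Cons k l)
  then show ?case by (simp add: matrix_add_ldistrib[symmetric] scale2_mult_right)
qed

lemma alt_trace_swap:
  "alt_trace a (l @ i # j # l') = gram a i j * alt_trace a (l @ l') - alt_trace a (l @ j # i # l')"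
proof -
  have "trace (alt_word a b (l @ i # j # l')) + trace (alt_word a b (l @ j # i # l'))
      = gram a i j * trace (alt_word a b (l @ l'))" for b
    using arg_cong[OF alt_word_swap[of a b l i j l'], of trace] by (simp add: trace_add trace_scale2)
  from this[of True] this[of False] show ?thesis
    by (simp add: alt_trace_def algebra_simps)
qed

text \<open>The word has even length, so the rotated letter keeps its kind, but the new word begins
  with the other kind: rotation exchanges the two summands of \<open>alt_trace\<close>. Their sum is
  cyclically invariant although the summands are not.\<close>

lemma alt_trace_rotate:
  assumes "odd (length l)"
  shows "alt_trace a (i # l) = alt_trace a (l @ [i])"
  using assms trace_mul_sym[of "a i"] trace_mul_sym[of "adj2 (a i)"]
  by (simp add: alt_trace_def alt_word_append)

lemma polynomial_functions_diff:
  assumes "p \<in> polynomial_functions I" "q \<in> polynomial_functions I"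
  shows "(\<lambda>x. p x - q x) \<in> polynomial_functions I"
  using polynomial_functions.add[OF assms(1)
      polynomial_functions.mult[OF polynomial_functions.const[of "-1"] assms(2)]] by simp

lemma pair_coord_polynomial:
  assumes "i \<in> {1..n}" "j \<in> {1..n}"
  shows "(\<lambda>x. pair_coord x i j) \<in> polynomial_functions {(i, j). 1 \<le> i \<and> i < j \<and> j \<le> n}"
proof -
  consider "i = j" | "i < j" | "j < i" by linarith
  then show ?thesis
    using assms by cases
      (auto simp: pair_coord_def intro: polynomial_functions.const polynomial_functions.coord)
qed

text \<open>
  The letters of an alternating word anticommute up to scalars, as in a Clifford algebra:
  moving the first letter to the end changes the sign of the trace modulo traces of
  shorter words, while cyclic invariance of the trace says that it does not change.
\<close>

lemma alt_trace_polynomial: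
  assumes "even (length l)" "set l \<subseteq> {1..n}"
  shows "\<exists>p \<in> polynomial_functions {(i, j). 1 \<le> i \<and> i < j \<and> j \<le> n}.
    \<forall>a. (\<forall>i\<in>{1..n}. det (a i) = 1) \<longrightarrow> alt_trace a l = p (gram_coords n a)"
  using assms
proof (induction "length l" arbitrary: l rule: less_induct)
  case less
  let ?P = "polynomial_functions {(i, j). 1 \<le> i \<and> i < j \<and> j \<le> n}"
  show ?case
  proof (cases l)
    case Nil
    then have "alt_trace a l = 4" for a by (simp add: alt_trace_def trace_I)
    then show ?thesis using polynomial_functions.const by fastforce
  next
    case (Cons i l')
    \<comment> \<open>\<open>l1\<close> collects the letters already passed. Each transposition of
      \<open>i\<close> with the next letter leaves behind a word shorter by two, hence still even,
      to which the outer induction applies.\<close>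
    have move: "set (l1 @ l2) \<subseteq> {1..n} \<Longrightarrow> Suc (length (l1 @ l2)) = length l \<Longrightarrow>
      \<exists>p \<in> ?P. \<forall>a. (\<forall>i\<in>{1..n}. det (a i) = 1) \<longrightarrow>
        alt_trace a (l1 @ i # l2) = (-1) ^ length l2 * alt_trace a (l1 @ l2 @ [i]) + p (gram_coords n a)"
      for l1 l2
    proof (induction l2 arbitrary: l1)
      case Nil
      show ?case by (rule bexI[OF _ polynomial_functions.const[of 0]]) simp
    next
      case (Cons j l2)
      have "length (l1 @ l2) < length l" "even (length (l1 @ l2))" "set (l1 @ l2) \<subseteq> {1..n}"
        using Cons.prems less.prems by (auto simp flip: Cons.prems(2))
      from less.hyps[OF this] obtain p where p: "p \<in> ?P"
        "\<And>a. (\<forall>i\<in>{1..n}. det (a i) = 1) \<Longrightarrow> alt_trace a (l1 @ l2) = p (gram_coords n a)"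
        by blast
      obtain q where q: "q \<in> ?P" "\<And>a. (\<forall>i\<in>{1..n}. det (a i) = 1) \<Longrightarrow>
          alt_trace a ((l1 @ [j]) @ i # l2)
            = (-1) ^ length l2 * alt_trace a ((l1 @ [j]) @ l2 @ [i]) + q (gram_coords n a)"
        using Cons.IH[of "l1 @ [j]"] Cons.prems by auto
      have ij: "i \<in> {1..n}" "j \<in> {1..n}" using \<open>l = i # l'\<close> less.prems Cons.prems by auto
      show ?case
      proof (rule bexI)
        show "(\<lambda>x. pair_coord x i j * p x - q x) \<in> ?P"
          by (intro polynomial_functions_diff polynomial_functions.mult pair_coord_polynomial ij p q)
        show "\<forall>a. (\<forall>i\<in>{1..n}. det (a i) = 1) \<longrightarrow> alt_trace a (l1 @ i # j # l2) =
          (-1) ^ length (j # l2) * alt_trace a (l1 @ (j # l2) @ [i]) +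
          (pair_coord (gram_coords n a) i j * p (gram_coords n a) - q (gram_coords n a))"
        proof (intro allI impI)
          fix a assume a: "\<forall>i\<in>{1..n}. det (a i :: complex^2^2) = 1"
          have "pair_coord (gram_coords n a) i j = gram a i j"
            using pair_coord_gram_coords[OF ij] a by blast
          then show "alt_trace a (l1 @ i # j # l2) =
            (-1) ^ length (j # l2) * alt_trace a (l1 @ (j # l2) @ [i]) +
            (pair_coord (gram_coords n a) i j * p (gram_coords n a) - q (gram_coords n a))"
            using q(2)[OF a] p(2)[OF a] by (simp add: alt_trace_swap[of _ l1 i j])
        qed
      qed
    qed
    have odd: "odd (length l')" using Cons less.prems by simp
    obtain p where p: "p \<in> ?P" "\<And>a. (\<forall>i\<in>{1..n}. det (a i) = 1) \<Longrightarrow>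
        alt_trace a l = (-1) ^ length l' * alt_trace a (l' @ [i]) + p (gram_coords n a)"
      using move[of "[]" l'] Cons less.prems by auto
    show ?thesis
    proof (rule bexI)
      \<comment> \<open>An even word moves its first letter past an odd number of others, so
        \<open>alt_trace a l = - alt_trace a l + p\<close>.\<close>
      show "(\<lambda>x. 1/2 * p x) \<in> ?P"
        by (intro polynomial_functions.mult polynomial_functions.const p)
      show "\<forall>a. (\<forall>i\<in>{1..n}. det (a i) = 1) \<longrightarrow> alt_trace a l = 1/2 * p (gram_coords n a)"
      proof (intro allI impI)
        fix a assume "\<forall>i\<in>{1..n}. det (a i :: complex^2^2) = 1"
        from p(2)[OF this] show "alt_trace a l = 1/2 * p (gram_coords n a)"
          using odd alt_trace_rotate[OF odd, of a i] Cons by (simp add: mult.commute)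
      qed
    qed
  qed
qed

lemma det_alt_word:
  assumes "\<And>i. i \<in> set l \<Longrightarrow> det (a i) = 1"
  shows "det (alt_word a b l) = 1"
  using assms by (induction l arbitrary: b) (simp_all add: det_mul)

lemma alt_word_rev:
  assumes "even (length l)"
  shows "alt_word a b (rev l) = adj2 (alt_word a (b) l)"
proof -
  have "alt_word a (b = even (length l)) (rev l) = adj2 (alt_word a b l)" for b
  proof (induction l arbitrary: b)
    case (Cons i l)
    have "alt_word a (b = even (length (i # l))) (rev (i # l)) =
      alt_word a ((\<not> b) = even (length l)) (rev l) ** alt_word a (\<not> b) [i]"
      unfolding rev.simps alt_word_append by simp
    then show ?case using Cons by (simp add: adj2_mult)
  qed simp
  from this[of b] assms show ?thesis by simp
qed

text \<open>The letter \<open>c\<close> stands for m_1, whose matrix is the identity: it contributes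
  nothing but shifts the alternation, so conjugation by m_1 is the covering involution on
  words.\<close>

lemma alt_word_conj:
  assumes "even (length l)" "a c = mat 1"
  shows "alt_word a b (c # l @ [c]) = alt_word a (\<not> b) l"
  using assms by (simp add: alt_word_append)

text \<open>
  The traces of \<open>U = alt_word a False l\<close> and \<open>V = alt_word a True l\<close> have sum \<open>alt_trace a l\<close>,
  and their product is \<open>trace (U ** V) + trace (U ** adj2 V)\<close>, where both summands are
  unchanged when \<open>U\<close> and \<open>V\<close> are exchanged.
\<close>

lemma alt_word_trace_difference:
  assumes "even (length l)" "a c = mat 1"
  shows "(trace (alt_word a False l) - trace (alt_word a True l))\<^sup>2 =
    (alt_trace a l)\<^sup>2 - 2 * alt_trace a (l @ c # l @ [c]) - 2 * alt_trace a (l @ c # rev l @ [c])"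
proof -
  let ?U = "alt_word a False l" and ?V = "alt_word a True l"
  have 1: "alt_trace a (l @ c # l @ [c]) = 2 * trace (?U ** ?V)"
    unfolding alt_trace_def alt_word_append[of a _ l "c # l @ [c]"]
    using assms alt_word_conj[of l a c] trace_mul_sym[of ?V ?U] by (simp del: alt_word.simps)
  have "trace (?V ** adj2 ?U) = trace (?U ** adj2 ?V)"
    using trace_mult_adj2[of ?U ?V] trace_mult_adj2[of ?V ?U] trace_mul_sym[of ?V ?U] by simp
  then have 2: "alt_trace a (l @ c # rev l @ [c]) = 2 * trace (?U ** adj2 ?V)"
    unfolding alt_trace_def alt_word_append[of a _ l "c # rev l @ [c]"]
    using assms alt_word_conj[of "rev l" a c] alt_word_rev[of l a] by (simp del: alt_word.simps)
  show ?thesis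
    unfolding 1 2 trace_mult_adj2 by (simp add: alt_trace_def power2_eq_square algebra_simps)
qed

section \<open>Lifting to trace-free matrices\<close>

text \<open>The commutator of two matrices is, up to a factor, the cross product of their trace-free
  parts, and the hypothesis says that it is orthogonal to every third matrix. If all the matrices
  commute, their trace-free parts are proportional and a vector orthogonal to one of them
  suffices.\<close>

lemma ex_trace_free_perp:
  fixes a :: "'i \<Rightarrow> complex^2^2"
  assumes "\<And>i j k. i \<in> I \<Longrightarrow> j \<in> I \<Longrightarrow> k \<in> I \<Longrightarrow> trace (a i ** a j ** a k) = trace (a k ** a j ** a i)"
  obtains B :: "complex^2^2" where "B \<noteq> 0" "trace B = 0" "\<And>i. i \<in> I \<Longrightarrow> trace (B ** a i) = 0"
proof (cases "\<exists>i\<in>I. \<exists>j\<in>I. a i ** a j \<noteq> a j ** a i")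
  case True
  then obtain i j where ij: "i \<in> I" "j \<in> I" "a i ** a j \<noteq> a j ** a i" by blast
  show ?thesis
  proof (rule that[of "a i ** a j - a j ** a i"])
    show "trace (a i ** a j - a j ** a i) = 0" using trace_mul_sym[of "a i"] by (simp add: trace_sub)
    fix k assume "k \<in> I"
    then have "trace (a i ** a j ** a k) = trace (a j ** a i ** a k)"
      using assms[OF ij(1,2)] trace_rotate3[of "a k" "a j" "a i"] by simp
    moreover have "(A - B) ** C = A ** C - B ** C" for A B C :: "complex^2^2"
      by (simp add: mat2_simps algebra_simps)
    ultimately show "trace ((a i ** a j - a j ** a i) ** a k) = 0" by (simp add: trace_sub)
  qed (use ij in simp)
next
  case False
  then have comm: "a i ** a j = a j ** a i" if "i \<in> I" "j \<in> I" for i j using that by blast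
  define mk :: "complex \<Rightarrow> complex \<Rightarrow> complex \<Rightarrow> complex^2^2" where
    "mk x y z = (\<chi> i j. if i = 1 then (if j = 1 then x else y) else (if j = 1 then z else - x))" for x y z
  note mk = mk_def mat2_simps
  consider i where "i \<in> I" "a i $ 1 $ 2 \<noteq> 0 \<or> a i $ 2 $ 1 \<noteq> 0"
    | "\<And>i. i \<in> I \<Longrightarrow> a i $ 1 $ 2 = 0 \<and> a i $ 2 $ 1 = 0" by blast
  then show ?thesis
  proof cases
    case (1 i)
    \<comment> \<open>Commuting makes the off-diagonal entries of \<open>a j\<close> proportional to
      those of \<open>a i\<close>, which is what the antidiagonal matrix built from the latter
      detects.\<close>
    show ?thesis
    proof (rule that[of "mk 0 (a i $ 1 $ 2) (- a i $ 2 $ 1)"])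
      fix j assume "j \<in> I"
      then have "(a i ** a j) $ 1 $ 1 = (a j ** a i) $ 1 $ 1" using comm \<open>i \<in> I\<close> by simp
      then have "a i $ 1 $ 2 * a j $ 2 $ 1 = a i $ 2 $ 1 * a j $ 1 $ 2" by (simp add: mult_2 mult.commute)
      then show "trace (mk 0 (a i $ 1 $ 2) (- a i $ 2 $ 1) ** a j) = 0"
        by (simp add: mk_def trace_2 mult_2)
    qed (use 1 in \<open>auto simp: mk\<close>)
  next
    case 2
    show ?thesis
      by (rule that[of "mk 0 1 1"]) (use 2 in \<open>auto simp: mk\<close>)
  qed
qed

lemma trace_by_eigenvector:
  fixes A :: "complex^2^2"
  assumes "det A = 1" "A *v u = c *s u" "u \<noteq> 0"
  shows "c \<noteq> 0" "trace A = c + 1 / c"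
proof -
  have 1: "A$1$1 * u$1 + A$1$2 * u$2 = c * u$1" "A$2$1 * u$1 + A$2$2 * u$2 = c * u$2"
    using assms(2) by (simp_all add: vec_eq_iff forall_2 matrix_vector_mult_def sum_2)
  have 2: "A$1$1 * A$2$2 - A$1$2 * A$2$1 = 1" using assms(1) by (simp add: det_2)
  have "(c * c - trace A * c + 1) * u$1 = 0" "(c * c - trace A * c + 1) * u$2 = 0"
    using 1 2 unfolding trace_2 by algebra+
  moreover have "u$1 \<noteq> 0 \<or> u$2 \<noteq> 0" using assms(3) by (simp add: vec_eq_iff forall_2)
  ultimately have *: "c * c - trace A * c + 1 = 0" by auto
  then show "c \<noteq> 0" by auto
  with * show "trace A = c + 1 / c" by (simp add: field_simps)
qed

lemma det_scale2: "det (c \<cdot> A) = c * c * det A"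
  by (simp add: mat2_simps algebra_simps)

lemma minus_one_scale2 [simp]: "(- 1) \<cdot> A = - A"
  by (simp add: mat2_simps)

lemma trace_free_square:
  assumes "trace C = 0"
  shows "C ** C = (- det C) \<cdot> mat 1"
proof -
  have "C$2$2 = - C$1$1" using assms by (simp add: trace_2 add_eq_0_iff)
  then show ?thesis by (simp add: mat2_simps algebra_simps)
qed

text \<open>\<open>adj2\<close> negates trace-free matrices, here both \<open>C\<close> and
  \<open>C ** A\<close>; compare this with \<open>adj2 (C ** A) = adj2 A ** adj2 C\<close>.\<close>

lemma trace_free_twist:
  fixes A C :: "complex^2^2"
  assumes "trace C = 0" "trace (C ** A) = 0"
  shows "C ** A = adj2 A ** C"
proof -
  have 1: "C$2$2 = - C$1$1" using assms(1) by (simp add: trace_2 add_eq_0_iff)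
  have 2: "C$2$1 * A$1$2 = C$1$1 * A$2$2 - C$1$1 * A$1$1 - C$1$2 * A$2$1"
    using assms(2) 1 by (simp add: trace_2 mult_2 algebra_simps)
  show ?thesis by (simp add: mat2_simps 1 2 algebra_simps) (use 2 in \<open>simp add: algebra_simps\<close>)
qed

text \<open>As \<open>M i\<close> has inverse \<open>- M i\<close>, the last conclusion is the
  Wirtinger relation m_k = m_i m_j m_i^-1, derived from its form a_k = a_i a_j^-1 a_i in the
  branched cover.\<close>

lemma trace_free_lift:
  fixes a :: "'i \<Rightarrow> complex^2^2"
  assumes det: "\<And>i. i \<in> I \<Longrightarrow> det (a i) = 1"
    and sym: "\<And>i j k. i \<in> I \<Longrightarrow> j \<in> I \<Longrightarrow> k \<in> I \<Longrightarrow> trace (a i ** a j ** a k) = trace (a k ** a j ** a i)"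
  obtains M :: "'i \<Rightarrow> complex^2^2" where
    "\<And>i. i \<in> I \<Longrightarrow> det (M i) = 1" "\<And>i. i \<in> I \<Longrightarrow> trace (M i) = 0"
    "\<And>i j. i \<in> I \<Longrightarrow> j \<in> I \<Longrightarrow> - trace (M i ** M j) = trace (adj2 (a i) ** a j)"
    "\<And>i j k. i \<in> I \<Longrightarrow> j \<in> I \<Longrightarrow> k \<in> I \<Longrightarrow> a k = a i ** adj2 (a j) ** a i \<Longrightarrow> M k = - (M i ** M j ** M i)"
proof -
  obtain B :: "complex^2^2" where B: "B \<noteq> 0" "trace B = 0" "\<And>i. i \<in> I \<Longrightarrow> trace (B ** a i) = 0"
    by (rule ex_trace_free_perp[of I a, OF sym]) (assumption | rule that)+
  show thesis
  proof (cases "det B = 0")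
    case False
    \<comment> \<open>Normalized to determinant 1, so that \<open>C\<close> squares to -1;
      \<open>C\<close> then inverts all \<open>a i\<close> by conjugation and serves as the image of
      m_1 up to the factor \<open>a 1\<close>.\<close>
    define C where "C = (1 / csqrt (det B)) \<cdot> B"
    have "csqrt (det B) * csqrt (det B) = det B"
      using power2_csqrt[of "det B"] by (simp only: power2_eq_square)
    then have "det C = 1" "trace C = 0"
      using False B(2) by (simp_all add: C_def trace_scale2 det_scale2)
    have CC: "C ** C = - mat 1"
      using trace_free_square[OF \<open>trace C = 0\<close>] \<open>det C = 1\<close> by simp
    have Ca: "C ** a i = adj2 (a i) ** C" "C ** adj2 (a i) = a i ** C" if "i \<in> I" for i
    proof -
      have "trace (C ** a i) = 0" using B(3)[OF that] by (simp add: C_def scale2_mult_left trace_scale2)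
      then show "C ** a i = adj2 (a i) ** C" "C ** adj2 (a i) = a i ** C"
        using trace_free_twist[OF \<open>trace C = 0\<close>, of "a i"]
          trace_free_twist[OF \<open>trace C = 0\<close>, of "adj2 (a i)"] \<open>trace C = 0\<close>
        by (simp_all add: trace_mult_adj2)
    qed
    have neg: "A ** (- D) = - (A ** D)" "(- A) ** D = - (A ** D)" for A D :: "complex^2^2"
      by (simp_all add: mat2_simps)
    have tneg: "trace (- A) = - trace A" for A :: "complex^2^2" by (simp add: mat2_simps)
    have MM: "(C ** a i) ** (C ** a j) = - (adj2 (a i) ** a j)" if "i \<in> I" "j \<in> I" for i j
    proof -
      have "(C ** a i) ** (C ** a j) = adj2 (a i) ** (C ** C) ** a j"
        by (simp add: Ca(1)[OF that(1)] matrix_mul_assoc)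
      then show ?thesis by (simp add: CC neg)
    qed
    show ?thesis
    proof (rule that[of "\<lambda>i. C ** a i"])
      show "det (C ** a i) = 1" if "i \<in> I" for i
        using that det \<open>det C = 1\<close> by (simp add: det_mul)
      show "trace (C ** a i) = 0" if "i \<in> I" for i
        using B(3)[OF that] by (simp add: C_def scale2_mult_left trace_scale2)
      show "- trace ((C ** a i) ** (C ** a j)) = trace (adj2 (a i) ** a j)" if "i \<in> I" "j \<in> I" for i j
        using that by (simp add: MM tneg)
      show "C ** a k = - ((C ** a i) ** (C ** a j) ** (C ** a i))"
        if "i \<in> I" "j \<in> I" "k \<in> I" "a k = a i ** adj2 (a j) ** a i" for i j k
      proof -
        have "- ((C ** a i) ** (C ** a j) ** (C ** a i)) = adj2 (a i) ** a j ** C ** a i"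
          unfolding MM[OF that(1,2)] by (simp add: neg matrix_mul_assoc)
        also have "\<dots> = adj2 (a i) ** (C ** adj2 (a j)) ** a i"
          unfolding Ca(2)[OF that(2)] by (simp add: matrix_mul_assoc)
        also have "\<dots> = C ** a i ** adj2 (a j) ** a i"
          unfolding Ca(1)[OF that(1)] by (simp add: matrix_mul_assoc)
        finally show ?thesis using that by (simp add: matrix_mul_assoc)
      qed
    qed
  next
    case True
    \<comment> \<open>Trace and determinant of \<open>B\<close> vanish, so \<open>B\<close> is
      nilpotent and \<open>u\<close> spans its kernel, which is also its image. Then
      \<open>trace (B ** a i)\<close> is, up to a nonzero factor, the determinant of the pair
      \<open>u\<close>, \<open>a i *v u\<close>, and orthogonality makes \<open>u\<close> a common
      eigenvector.\<close>
    define u where "u = (if B$1$1 = 0 \<and> B$1$2 = 0 then vector [B$1$1, B$2$1] else vector [B$1$2, - B$1$1] :: complex^2)"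
    have "u \<noteq> 0"
      using B(1,2) by (auto simp: u_def vec_eq_iff forall_2 trace_2)
    have cross: "u$1 * (a i *v u)$2 = u$2 * (a i *v u)$1" if "i \<in> I" for i
    proof -
      have "B$1$1 + B$2$2 = 0" "B$1$1 * B$2$2 - B$1$2 * B$2$1 = 0"
        using True B(2) by (simp_all add: det_2 trace_2)
      then have "B$1$1 * B$1$1 + B$1$2 * B$2$1 = 0" "B$2$2 = - B$1$1"
        by algebra+
      moreover have "B$1$1 * a i$1$1 + B$1$2 * a i$2$1 + B$2$1 * a i$1$2 + B$2$2 * a i$2$2 = 0"
        using B(3)[OF that] by (simp add: mat2_simps add.assoc)
      ultimately have "B$1$2 * (a i$2$1 * B$1$2 - a i$2$2 * B$1$1) = - B$1$1 * (a i$1$1 * B$1$2 - a i$1$2 * B$1$1)"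
        "B$1$1 = 0 \<Longrightarrow> B$1$2 = 0 \<Longrightarrow> B$2$1 * (a i$1$2 * B$2$1) = 0"
        by algebra+
      then show ?thesis
        by (simp add: u_def matrix_vector_mult_def sum_2)
    qed
    have "\<exists>c. a i *v u = c *s u" if "i \<in> I" for i
    proof (cases "u$1 = 0")
      case True
      then have "u$2 \<noteq> 0" using \<open>u \<noteq> 0\<close> by (simp add: vec_eq_iff forall_2)
      then have "a i *v u = ((a i *v u)$2 / u$2) *s u"
        using cross[OF that] True by (simp add: vec_eq_iff forall_2)
      then show ?thesis ..
    next
      case False
      then have "a i *v u = ((a i *v u)$1 / u$1) *s u"
        using cross[OF that] by (simp add: vec_eq_iff forall_2 field_simps)
      then show ?thesis ..
    qed
    then obtain c where c: "\<And>i. i \<in> I \<Longrightarrow> a i *v u = c i *s u" by metis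
    have c0: "c i \<noteq> 0" if "i \<in> I" for i
      using trace_by_eigenvector(1)[OF det c \<open>u \<noteq> 0\<close>] that by blast
    have cadj: "adj2 (a i) *v u = (1 / c i) *s u" if "i \<in> I" for i
    proof -
      have "adj2 (a i) *v (c i *s u) = u"
        using c[OF that] det[OF that] by (metis adj2_left matrix_vector_mul_assoc matrix_vector_mul_lid one_scale2)
      then have "c i *s (adj2 (a i) *v u) = u" by (simp add: vector_scalar_commute)
      then have "(1 / c i) *s (c i *s (adj2 (a i) *v u)) = (1 / c i) *s u" by simp
      then show ?thesis using c0[OF that] by simp
    qed
    \<comment> \<open>The same lift as before for the diagonal matrices with entries 1/c_i and c_i,
      taken with the antidiagonal matrix (0, 1; -1, 0) in place of \<open>C\<close>. Passing to the
      diagonal loses nothing, since the Gram matrix depends on the eigenvalues only.\<close>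
    define M where "M i = (\<chi> k l. if k = (1::2) then (if l = (1::2) then 0 else c i) else (if l = 1 then - 1 / c i else 0))" for i
    show ?thesis
    proof (rule that[of M])
      show "det (M i) = 1" "trace (M i) = 0" if "i \<in> I" for i
        using c0[OF that] by (simp_all add: M_def mat2_simps)
      show "- trace (M i ** M j) = trace (adj2 (a i) ** a j)" if "i \<in> I" "j \<in> I" for i j
      proof -
        have "(adj2 (a i) ** a j) *v u = (c j / c i) *s u"
          using c[OF that(2)] cadj[OF that(1)]
          by (simp flip: matrix_vector_mul_assoc add: vector_scalar_commute)
        then have "trace (adj2 (a i) ** a j) = c j / c i + c i / c j"
          using trace_by_eigenvector(2)[OF _ _ \<open>u \<noteq> 0\<close>, of "adj2 (a i) ** a j" "c j / c i"] det that
          by (simp add: det_mul)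
        then show ?thesis by (simp add: M_def mat2_simps)
      qed
      show "M k = - (M i ** M j ** M i)"
        if "i \<in> I" "j \<in> I" "k \<in> I" "a k = a i ** adj2 (a j) ** a i" for i j k
      proof -
        have "a k *v u = (c i * c i / c j) *s u"
          using c[OF that(1)] cadj[OF that(2)] unfolding that(4)
          by (simp flip: matrix_vector_mul_assoc add: vector_scalar_commute)
        then have "c k *s u = (c i * c i / c j) *s u" using c[OF that(3)] by simp
        then have "c k = c i * c i / c j" using \<open>u \<noteq> 0\<close> by simp
        then show ?thesis
          using c0[OF that(1)] c0[OF that(2)] by (simp add: M_def mat2_simps)
      qed
    qed
  qed
qed

section \<open>The orbifold group\<close>

lemma even_exponent_sum: "even (exponent_sum w) \<longleftrightarrow> even (length w)"
  by (induction w) (auto simp: exponent_sum_def split: if_splits)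

lemma (in group) conj_eq_one_iff:
  assumes "x \<in> carrier G" "y \<in> carrier G"
  shows "y \<otimes> x \<otimes> inv y = \<one> \<longleftrightarrow> x = \<one>"
proof
  assume "y \<otimes> x \<otimes> inv y = \<one>"
  then have "inv y \<otimes> (y \<otimes> x \<otimes> inv y) \<otimes> y = \<one>" using assms by simp
  moreover have "inv y \<otimes> (y \<otimes> x) = x" using assms by (simp flip: m_assoc)
  ultimately show "x = \<one>" using assms by (simp add: m_assoc)
qed (use assms in simp)

lemma (in group) conj_square:
  assumes "x \<in> carrier G" "y \<in> carrier G"
  shows "(y \<otimes> x \<otimes> inv y) \<otimes> (y \<otimes> x \<otimes> inv y) = y \<otimes> (x \<otimes> x) \<otimes> inv y"
proof -
  have "inv y \<otimes> (y \<otimes> z) = z" if "z \<in> carrier G" for z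
    using assms that by (simp flip: m_assoc)
  then show ?thesis using assms by (simp add: m_assoc)
qed

text \<open>
  This group contains the fundamental group of the double branched cover as the subgroup of even
  elements; as its meridians are involutions, words in them need no exponents.
\<close>

definition orbifold_group :: "knot_diagram \<Rightarrow> nat word set set monoid" where
  "orbifold_group D = knot_group D Mod branch_kernel D"

definition orbifold_meridian :: "knot_diagram \<Rightarrow> nat \<Rightarrow> nat word set set" where
  "orbifold_meridian D i = branch_kernel D #>\<^bsub>knot_group D\<^esub> meridian D i"

definition meridian_word :: "knot_diagram \<Rightarrow> nat list \<Rightarrow> nat word set set" where
  "meridian_word D l = foldr (mult (orbifold_group D)) (map (orbifold_meridian D) l) \<one>\<^bsub>orbifold_group D\<^esub>"

context
  fixes D :: knot_diagram
  assumes D: "is_knot_diagram D"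
begin

declare One_nat_def [simp del]

interpretation G: group "knot_group D"
  using D by (rule group_knot_group)

abbreviation (input) "arcs \<equiv> {1..crossings D}"
abbreviation (input) "relators \<equiv> wirtinger_relator D ` {..<crossings D - 1}"

lemma carrier_knot_group: "carrier (knot_group D) = word_class arcs relators ` words arcs"
  by (simp add: knot_group_def carrier_presented_group)

lemma mult_knot_group:
  "v \<in> words arcs \<Longrightarrow> w \<in> words arcs \<Longrightarrow>
    word_class arcs relators v \<otimes>\<^bsub>knot_group D\<^esub> word_class arcs relators w = word_class arcs relators (v @ w)"
  unfolding knot_group_def by (rule mult_presented_group)

lemma inv_knot_group:
  "w \<in> words arcs \<Longrightarrow> inv\<^bsub>knot_group D\<^esub> word_class arcs relators w = word_class arcs relators (inverse_word w)"
  unfolding knot_group_def by (rule inv_presented_group)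

lemma one_knot_group: "\<one>\<^bsub>knot_group D\<^esub> = word_class arcs relators []"
  by (simp add: knot_group_def one_presented_group)

lemma meridian_carrier: "i \<in> arcs \<Longrightarrow> meridian D i \<in> carrier (knot_group D)"
  unfolding carrier_knot_group meridian_def by (rule imageI) simp

lemma inv_meridian: "i \<in> arcs \<Longrightarrow> inv\<^bsub>knot_group D\<^esub> meridian D i = word_class arcs relators [(i, True)]"
  using inv_knot_group[of "[(i, False)]"] by (simp add: meridian_def inverse_word_def)

lemma mem_even_subgroup:
  "g \<in> even_subgroup D \<longleftrightarrow> (\<exists>w\<in>words arcs. even (length w) \<and> g = word_class arcs relators w)"
proof
  assume "g \<in> even_subgroup D"
  then obtain w where w: "g \<in> carrier (knot_group D)" "w \<in> g" "even (length w)"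
    by (auto simp: even_subgroup_def even_exponent_sum)
  then obtain v where v: "v \<in> words arcs" "g = word_class arcs relators v"
    unfolding carrier_knot_group by blast
  then have "(v, w) \<in> word_eq arcs relators" using w(2) by simp
  then have "w \<in> words arcs" "g = word_class arcs relators w"
    using word_eq_words word_class_eqI v(2) by blast+
  then show "\<exists>w\<in>words arcs. even (length w) \<and> g = word_class arcs relators w" using w(3) by blast
next
  assume "\<exists>w\<in>words arcs. even (length w) \<and> g = word_class arcs relators w"
  then obtain w where w: "w \<in> words arcs" "even (length w)" "g = word_class arcs relators w" by blast
  then have "w \<in> g" by (auto intro: word_eq.refl)
  then show "g \<in> even_subgroup D"
    using w unfolding even_subgroup_def carrier_knot_group by (auto simp: even_exponent_sum)
qed

lemma length_inverse_word [simp]: "length (inverse_word w) = length w"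
  by (simp add: inverse_word_def)

lemma subgroup_even_subgroup: "subgroup (even_subgroup D) (knot_group D)"
proof (rule G.subgroupI)
  show "even_subgroup D \<subseteq> carrier (knot_group D)" by (auto simp: even_subgroup_def)
  have "word_class arcs relators [] \<in> even_subgroup D"
    unfolding mem_even_subgroup by (intro bexI[of _ "[]"]) simp_all
  then show "even_subgroup D \<noteq> {}" by blast
next
  fix a assume "a \<in> even_subgroup D"
  then obtain w where w: "w \<in> words arcs" "even (length w)" "a = word_class arcs relators w"
    unfolding mem_even_subgroup by blast
  then show "inv\<^bsub>knot_group D\<^esub> a \<in> even_subgroup D"
    unfolding mem_even_subgroup by (intro bexI[of _ "inverse_word w"]) (simp_all add: inv_knot_group)
next
  fix a b assume "a \<in> even_subgroup D" "b \<in> even_subgroup D"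
  then obtain v w where w: "w \<in> words arcs" "even (length w)" "b = word_class arcs relators w"
    and v: "v \<in> words arcs" "even (length v)" "a = word_class arcs relators v"
    unfolding mem_even_subgroup by blast
  then show "a \<otimes>\<^bsub>knot_group D\<^esub> b \<in> even_subgroup D"
    unfolding mem_even_subgroup by (intro bexI[of _ "v @ w"]) (simp_all add: mult_knot_group)
qed

lemma one_in_arcs: "1 \<in> arcs"
  using crossings_pos[OF D] by simp

text \<open>An odd \<open>g\<close> may be replaced by the even element g m_1, because m_1 commutes
  with its own square. Hence the normal closure taken in the even subgroup is already normal in the
  whole knot group, and the orbifold group makes sense.\<close>

lemma meridian_conj_set:
  "{g \<otimes>\<^bsub>double_cover_group D\<^esub> s \<otimes>\<^bsub>double_cover_group D\<^esub> inv\<^bsub>double_cover_group D\<^esub> g | g s.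
      g \<in> carrier (double_cover_group D) \<and> s \<in> {meridian D 1 \<otimes>\<^bsub>knot_group D\<^esub> meridian D 1}} =
    {g \<otimes>\<^bsub>knot_group D\<^esub> (meridian D 1 \<otimes>\<^bsub>knot_group D\<^esub> meridian D 1) \<otimes>\<^bsub>knot_group D\<^esub> inv\<^bsub>knot_group D\<^esub> g | g.
      g \<in> carrier (knot_group D)}" (is "?L = ?R")
proof (intro equalityI subsetI)
  have inv: "inv\<^bsub>double_cover_group D\<^esub> g = inv\<^bsub>knot_group D\<^esub> g" if "g \<in> even_subgroup D" for g
    unfolding double_cover_group_def by (rule G.m_inv_consistent[OF subgroup_even_subgroup that])
  have carr: "carrier (double_cover_group D) = even_subgroup D"
    and mult: "mult (double_cover_group D) = mult (knot_group D)"
    by (simp_all add: double_cover_group_def)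
  fix x
  show "x \<in> ?R" if x: "x \<in> ?L"
  proof -
    obtain g where "g \<in> carrier (double_cover_group D)"
      "x = g \<otimes>\<^bsub>double_cover_group D\<^esub> (meridian D 1 \<otimes>\<^bsub>knot_group D\<^esub> meridian D 1)
        \<otimes>\<^bsub>double_cover_group D\<^esub> inv\<^bsub>double_cover_group D\<^esub> g"
      using x by blast
    then have g: "g \<in> even_subgroup D"
      "x = g \<otimes>\<^bsub>knot_group D\<^esub> (meridian D 1 \<otimes>\<^bsub>knot_group D\<^esub> meridian D 1) \<otimes>\<^bsub>knot_group D\<^esub> inv\<^bsub>knot_group D\<^esub> g"
      using inv[of g] by (simp_all add: carr mult)
    then have "g \<in> carrier (knot_group D)" by (simp add: even_subgroup_def)
    then show ?thesis using g by blast
  qed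
  show "x \<in> ?L" if x: "x \<in> ?R"
  proof -
    let ?m = "meridian D 1"
    have m: "?m \<in> carrier (knot_group D)" using meridian_carrier one_in_arcs by blast
    obtain g where g: "g \<in> carrier (knot_group D)"
      "x = g \<otimes>\<^bsub>knot_group D\<^esub> (?m \<otimes>\<^bsub>knot_group D\<^esub> ?m) \<otimes>\<^bsub>knot_group D\<^esub> inv\<^bsub>knot_group D\<^esub> g"
      using x by blast
    obtain w where w: "w \<in> words arcs" "g = word_class arcs relators w"
      using g(1) unfolding carrier_knot_group by blast
    have "\<exists>h\<in>even_subgroup D. x = h \<otimes>\<^bsub>knot_group D\<^esub> (?m \<otimes>\<^bsub>knot_group D\<^esub> ?m) \<otimes>\<^bsub>knot_group D\<^esub> inv\<^bsub>knot_group D\<^esub> h"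
    proof (cases "even (length w)")
      case True
      then have "g \<in> even_subgroup D" unfolding mem_even_subgroup using w by blast
      then show ?thesis using g by blast
    next
      case False
      have "g \<otimes>\<^bsub>knot_group D\<^esub> ?m = word_class arcs relators (w @ [(1, False)])"
        unfolding w(2) meridian_def using w(1) one_in_arcs by (intro mult_knot_group) simp_all
      then have "g \<otimes>\<^bsub>knot_group D\<^esub> ?m \<in> even_subgroup D"
        unfolding mem_even_subgroup using w(1) False one_in_arcs
        by (intro bexI[of _ "w @ [(1, False)]"]) simp_all
      moreover have "x = (g \<otimes>\<^bsub>knot_group D\<^esub> ?m) \<otimes>\<^bsub>knot_group D\<^esub> (?m \<otimes>\<^bsub>knot_group D\<^esub> ?m)
          \<otimes>\<^bsub>knot_group D\<^esub> inv\<^bsub>knot_group D\<^esub> (g \<otimes>\<^bsub>knot_group D\<^esub> ?m)"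
      proof -
        have "?m \<otimes>\<^bsub>knot_group D\<^esub> (inv\<^bsub>knot_group D\<^esub> ?m \<otimes>\<^bsub>knot_group D\<^esub> inv\<^bsub>knot_group D\<^esub> g) = inv\<^bsub>knot_group D\<^esub> g"
          using g(1) m by (simp flip: G.m_assoc)
        then show ?thesis
          unfolding g(2) using g(1) m by (simp add: G.inv_mult_group G.m_assoc)
      qed
      ultimately show ?thesis by blast
    qed
    then obtain h where h: "h \<in> even_subgroup D"
      "x = h \<otimes>\<^bsub>knot_group D\<^esub> (?m \<otimes>\<^bsub>knot_group D\<^esub> ?m) \<otimes>\<^bsub>knot_group D\<^esub> inv\<^bsub>knot_group D\<^esub> h" by blast
    show ?thesis
      by (rule CollectI, rule exI[of _ h], rule exI[of _ "?m \<otimes>\<^bsub>knot_group D\<^esub> ?m"])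
        (use h inv[of h] in \<open>simp add: carr mult\<close>)
  qed
qed

lemma branch_kernel_eq:
  "branch_kernel D = generate (knot_group D)
    {g \<otimes>\<^bsub>knot_group D\<^esub> (meridian D 1 \<otimes>\<^bsub>knot_group D\<^esub> meridian D 1) \<otimes>\<^bsub>knot_group D\<^esub> inv\<^bsub>knot_group D\<^esub> g | g.
      g \<in> carrier (knot_group D)}" (is "_ = generate _ ?S")
proof -
  have "?S \<subseteq> even_subgroup D"
  proof
    fix x assume "x \<in> ?S"
    then obtain g where g: "g \<in> carrier (knot_group D)"
      "x = g \<otimes>\<^bsub>knot_group D\<^esub> (meridian D 1 \<otimes>\<^bsub>knot_group D\<^esub> meridian D 1) \<otimes>\<^bsub>knot_group D\<^esub> inv\<^bsub>knot_group D\<^esub> g"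
      by blast
    obtain w where w: "w \<in> words arcs" "g = word_class arcs relators w"
      using g(1) unfolding carrier_knot_group by blast
    have "x = word_class arcs relators (w @ [(1, False), (1, False)] @ inverse_word w)"
      unfolding g(2) w(2) meridian_def using w(1) one_in_arcs inv_knot_group[OF w(1)] mult_knot_group
      by simp
    then show "x \<in> even_subgroup D"
      unfolding mem_even_subgroup using w(1) one_in_arcs
      by (intro bexI[of _ "w @ [(1, False), (1, False)] @ inverse_word w"]) simp_all
  qed
  from G.generate_consistent[OF this subgroup_even_subgroup] show ?thesis
    unfolding branch_kernel_def normal_closure_def meridian_conj_set
    by (simp add: double_cover_group_def)
qed

lemma normal_branch_kernel: "branch_kernel D \<lhd> knot_group D"
  unfolding branch_kernel_eq
proof (rule G.normal_generateI)
  let ?m = "meridian D 1 \<otimes>\<^bsub>knot_group D\<^esub> meridian D 1"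
  have m: "?m \<in> carrier (knot_group D)" using meridian_carrier one_in_arcs by simp
  show "{g \<otimes>\<^bsub>knot_group D\<^esub> ?m \<otimes>\<^bsub>knot_group D\<^esub> inv\<^bsub>knot_group D\<^esub> g | g. g \<in> carrier (knot_group D)}
    \<subseteq> carrier (knot_group D)" using m by auto
  fix h g
  assume "h \<in> {g \<otimes>\<^bsub>knot_group D\<^esub> ?m \<otimes>\<^bsub>knot_group D\<^esub> inv\<^bsub>knot_group D\<^esub> g | g. g \<in> carrier (knot_group D)}"
    and g: "g \<in> carrier (knot_group D)"
  then obtain k where k: "k \<in> carrier (knot_group D)"
    "h = k \<otimes>\<^bsub>knot_group D\<^esub> ?m \<otimes>\<^bsub>knot_group D\<^esub> inv\<^bsub>knot_group D\<^esub> k" by blast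
  have "g \<otimes>\<^bsub>knot_group D\<^esub> h \<otimes>\<^bsub>knot_group D\<^esub> inv\<^bsub>knot_group D\<^esub> g =
    (g \<otimes>\<^bsub>knot_group D\<^esub> k) \<otimes>\<^bsub>knot_group D\<^esub> ?m \<otimes>\<^bsub>knot_group D\<^esub> inv\<^bsub>knot_group D\<^esub> (g \<otimes>\<^bsub>knot_group D\<^esub> k)"
    unfolding k(2) using g k(1) m by (simp add: G.inv_mult_group G.m_assoc del: G.m_closed) (simp add: G.m_assoc)
  then show "g \<otimes>\<^bsub>knot_group D\<^esub> h \<otimes>\<^bsub>knot_group D\<^esub> inv\<^bsub>knot_group D\<^esub> g
    \<in> {g \<otimes>\<^bsub>knot_group D\<^esub> ?m \<otimes>\<^bsub>knot_group D\<^esub> inv\<^bsub>knot_group D\<^esub> g | g. g \<in> carrier (knot_group D)}"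
    using G.m_closed[OF g k(1)] by blast
qed

interpretation K: normal "branch_kernel D" "knot_group D"
  by (rule normal_branch_kernel)

interpretation Q: group "orbifold_group D"
  unfolding orbifold_group_def by (rule K.factorgroup_is_group)

lemma group_orbifold_group: "group (orbifold_group D)"
  by (rule Q.group_axioms)

lemma coset_hom: "(\<lambda>g. branch_kernel D #>\<^bsub>knot_group D\<^esub> g) \<in> hom (knot_group D) (orbifold_group D)"
  unfolding orbifold_group_def by (rule K.r_coset_hom_Mod)

interpretation coset: group_hom "knot_group D" "orbifold_group D" "\<lambda>g. branch_kernel D #>\<^bsub>knot_group D\<^esub> g"
  by (intro group_hom.intro group_hom_axioms.intro G.group_axioms Q.group_axioms coset_hom)

lemma orbifold_meridian_carrier: "i \<in> arcs \<Longrightarrow> orbifold_meridian D i \<in> carrier (orbifold_group D)"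
  unfolding orbifold_meridian_def using coset.hom_closed meridian_carrier by blast

text \<open>The alternatives belong to positive and negative crossings. The crossing whose relator
  is left out of the presentation is included, by \<open>wirtinger_relator_trivial\<close>.\<close>

lemma wirtinger_relation:
  assumes "c < crossings D"
  shows "meridian D (over_arc D c) \<otimes>\<^bsub>knot_group D\<^esub> meridian D (under_arc_out D c) =
      meridian D (under_arc_in D c) \<otimes>\<^bsub>knot_group D\<^esub> meridian D (over_arc D c) \<or>
    meridian D (under_arc_out D c) \<otimes>\<^bsub>knot_group D\<^esub> meridian D (over_arc D c) =
      meridian D (over_arc D c) \<otimes>\<^bsub>knot_group D\<^esub> meridian D (under_arc_in D c)"
proof -
  define i j k where "i = over_arc D c" "j = under_arc_in D c" "k = under_arc_out D c"
  have arcs: "i \<in> arcs" "j \<in> arcs" "k \<in> arcs"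
    using over_arc_range[OF D assms] under_arc_in_range[OF D assms] under_arc_out_range[OF D assms]
    by (simp_all add: i_j_k_def)
  let ?m = "meridian D"
  have m: "?m i \<in> carrier (knot_group D)" "?m j \<in> carrier (knot_group D)" "?m k \<in> carrier (knot_group D)"
    using meridian_carrier arcs by blast+
  define cl where "cl = word_class arcs relators"
  have word: "cl ((x, b) # w) =
    (if b then inv\<^bsub>knot_group D\<^esub> ?m x else ?m x) \<otimes>\<^bsub>knot_group D\<^esub> cl w"
    if "x \<in> arcs" "w \<in> words arcs" for x b w
    unfolding cl_def using mult_knot_group[of "[(x, b)]" w] that inv_meridian[OF that(1)]
    by (cases b) (simp_all add: meridian_def)
  have one: "cl [] = \<one>\<^bsub>knot_group D\<^esub>" by (simp add: cl_def one_knot_group)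
  have rel: "cl (wirtinger_relator D c) = \<one>\<^bsub>knot_group D\<^esub>"
    unfolding cl_def using D assms by (rule wirtinger_relator_trivial)
  show ?thesis
  proof (cases "positive D c")
    case True
    then have "?m i \<otimes>\<^bsub>knot_group D\<^esub> (?m k \<otimes>\<^bsub>knot_group D\<^esub> (inv\<^bsub>knot_group D\<^esub> ?m i \<otimes>\<^bsub>knot_group D\<^esub> inv\<^bsub>knot_group D\<^esub> ?m j))
      = \<one>\<^bsub>knot_group D\<^esub>"
      using rel arcs m unfolding wirtinger_relator_def i_j_k_def[symmetric] Let_def
      by (simp add: word one)
    then have "(?m i \<otimes>\<^bsub>knot_group D\<^esub> ?m k) \<otimes>\<^bsub>knot_group D\<^esub> inv\<^bsub>knot_group D\<^esub> (?m j \<otimes>\<^bsub>knot_group D\<^esub> ?m i) = \<one>\<^bsub>knot_group D\<^esub>"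
      using m by (simp add: G.inv_mult_group G.m_assoc)
    then have "?m i \<otimes>\<^bsub>knot_group D\<^esub> ?m k = ?m j \<otimes>\<^bsub>knot_group D\<^esub> ?m i"
      using m by (metis G.inv_closed G.inv_equality G.inv_inv G.m_closed)
    then show ?thesis by (simp add: i_j_k_def)
  next
    case False
    then have "?m i \<otimes>\<^bsub>knot_group D\<^esub> (inv\<^bsub>knot_group D\<^esub> ?m j \<otimes>\<^bsub>knot_group D\<^esub> (inv\<^bsub>knot_group D\<^esub> ?m i \<otimes>\<^bsub>knot_group D\<^esub> ?m k))
      = \<one>\<^bsub>knot_group D\<^esub>"
      using rel arcs m unfolding wirtinger_relator_def i_j_k_def[symmetric] Let_def
      by (simp add: word one)
    then have "(?m i \<otimes>\<^bsub>knot_group D\<^esub> inv\<^bsub>knot_group D\<^esub> ?m j) \<otimes>\<^bsub>knot_group D\<^esub> (inv\<^bsub>knot_group D\<^esub> ?m i \<otimes>\<^bsub>knot_group D\<^esub> ?m k)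
      = \<one>\<^bsub>knot_group D\<^esub>"
      using m by (simp add: G.m_assoc)
    then have "inv\<^bsub>knot_group D\<^esub> (inv\<^bsub>knot_group D\<^esub> ?m i \<otimes>\<^bsub>knot_group D\<^esub> ?m k) = ?m i \<otimes>\<^bsub>knot_group D\<^esub> inv\<^bsub>knot_group D\<^esub> ?m j"
      using m by (intro G.inv_equality) simp_all
    then have "inv\<^bsub>knot_group D\<^esub> ?m i \<otimes>\<^bsub>knot_group D\<^esub> ?m k = inv\<^bsub>knot_group D\<^esub> (?m i \<otimes>\<^bsub>knot_group D\<^esub> inv\<^bsub>knot_group D\<^esub> ?m j)"
      using m by (metis G.inv_closed G.inv_inv G.m_closed)
    also have "\<dots> = ?m j \<otimes>\<^bsub>knot_group D\<^esub> inv\<^bsub>knot_group D\<^esub> ?m i"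
      using m by (simp add: G.inv_mult_group)
    finally have "?m i \<otimes>\<^bsub>knot_group D\<^esub> (inv\<^bsub>knot_group D\<^esub> ?m i \<otimes>\<^bsub>knot_group D\<^esub> ?m k) \<otimes>\<^bsub>knot_group D\<^esub> ?m i
        = ?m i \<otimes>\<^bsub>knot_group D\<^esub> (?m j \<otimes>\<^bsub>knot_group D\<^esub> inv\<^bsub>knot_group D\<^esub> ?m i) \<otimes>\<^bsub>knot_group D\<^esub> ?m i" by simp
    moreover have "?m i \<otimes>\<^bsub>knot_group D\<^esub> (inv\<^bsub>knot_group D\<^esub> ?m i \<otimes>\<^bsub>knot_group D\<^esub> ?m k) = ?m k"
      using m by (simp flip: G.m_assoc)
    ultimately have "?m k \<otimes>\<^bsub>knot_group D\<^esub> ?m i = ?m i \<otimes>\<^bsub>knot_group D\<^esub> ?m j"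
      using m by (simp add: G.m_assoc)
    then show ?thesis by (simp add: i_j_k_def)
  qed
qed

text \<open>Travel along the knot: an over-pass does not change the arc, and an under-pass
  conjugates the meridian by that of the over-arc or its inverse.\<close>

lemma meridians_conjugate:
  assumes "p < 2 * crossings D"
  shows "\<exists>g\<in>carrier (knot_group D). meridian D (arc D p) =
    g \<otimes>\<^bsub>knot_group D\<^esub> meridian D (arc D 0) \<otimes>\<^bsub>knot_group D\<^esub> inv\<^bsub>knot_group D\<^esub> g"
  using assms
proof (induction p)
  case 0
  have "meridian D (arc D 0) \<in> carrier (knot_group D)" using arc_range[OF D 0] meridian_carrier by blast
  then show ?case by (intro bexI[of _ "\<one>\<^bsub>knot_group D\<^esub>"]) simp_all
next
  case (Suc p)
  let ?m = "meridian D"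
  obtain g where g: "g \<in> carrier (knot_group D)"
    "?m (arc D p) = g \<otimes>\<^bsub>knot_group D\<^esub> ?m (arc D 0) \<otimes>\<^bsub>knot_group D\<^esub> inv\<^bsub>knot_group D\<^esub> g"
    using Suc by auto
  have edge: "edge_in D (Suc p) = p" using edge_in_eq[OF D Suc.prems] by simp
  obtain c b where c: "c < crossings D" "Suc p = crossing_time D c b"
    using crossing_at[OF D Suc.prems] by blast
  have m: "?m (arc D q) \<in> carrier (knot_group D)" if "q < 2 * crossings D" for q
    using arc_range[OF D that] meridian_carrier by blast
  have m0: "?m (arc D 0) \<in> carrier (knot_group D)" using m Suc.prems by simp
  show ?case
  proof (cases b)
    case True
    then have "arc D (edge_in D (Suc p)) = arc D (Suc p)"
      using D c by (simp add: is_knot_diagram_def crossing_time_def)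
    then show ?thesis using g unfolding edge by metis
  next
    case False
    define h where "h = ?m (over_arc D c)"
    have h: "h \<in> carrier (knot_group D)" unfolding h_def using over_arc_range[OF D c(1)] meridian_carrier by blast
    have arcs: "under_arc_in D c = arc D p" "under_arc_out D c = arc D (Suc p)"
      using c(2) edge False by (simp_all add: under_arc_in_def under_arc_out_def crossing_time_def)
    have mp: "?m (arc D p) \<in> carrier (knot_group D)" "?m (arc D (Suc p)) \<in> carrier (knot_group D)"
      using m Suc.prems by simp_all
    have "\<exists>k\<in>carrier (knot_group D). ?m (arc D (Suc p)) = k \<otimes>\<^bsub>knot_group D\<^esub> ?m (arc D p) \<otimes>\<^bsub>knot_group D\<^esub> inv\<^bsub>knot_group D\<^esub> k"
      using wirtinger_relation[OF c(1), folded h_def, unfolded arcs]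
    proof
      assume *: "h \<otimes>\<^bsub>knot_group D\<^esub> ?m (arc D (Suc p)) = ?m (arc D p) \<otimes>\<^bsub>knot_group D\<^esub> h"
      have "?m (arc D (Suc p)) = inv\<^bsub>knot_group D\<^esub> h \<otimes>\<^bsub>knot_group D\<^esub> (h \<otimes>\<^bsub>knot_group D\<^esub> ?m (arc D (Suc p)))"
        using h mp by (simp flip: G.m_assoc)
      then have "?m (arc D (Suc p)) = inv\<^bsub>knot_group D\<^esub> h \<otimes>\<^bsub>knot_group D\<^esub> ?m (arc D p) \<otimes>\<^bsub>knot_group D\<^esub> inv\<^bsub>knot_group D\<^esub> (inv\<^bsub>knot_group D\<^esub> h)"
        unfolding * using h mp by (simp add: G.m_assoc)
      then show ?thesis using h G.inv_closed by blast
    next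
      assume *: "?m (arc D (Suc p)) \<otimes>\<^bsub>knot_group D\<^esub> h = h \<otimes>\<^bsub>knot_group D\<^esub> ?m (arc D p)"
      have "?m (arc D (Suc p)) = ?m (arc D (Suc p)) \<otimes>\<^bsub>knot_group D\<^esub> h \<otimes>\<^bsub>knot_group D\<^esub> inv\<^bsub>knot_group D\<^esub> h"
        using h mp by (simp add: G.m_assoc)
      then show ?thesis unfolding * using h by blast
    qed
    then obtain k where k: "k \<in> carrier (knot_group D)"
      "?m (arc D (Suc p)) = k \<otimes>\<^bsub>knot_group D\<^esub> ?m (arc D p) \<otimes>\<^bsub>knot_group D\<^esub> inv\<^bsub>knot_group D\<^esub> k" by blast
    have "?m (arc D (Suc p)) = (k \<otimes>\<^bsub>knot_group D\<^esub> g) \<otimes>\<^bsub>knot_group D\<^esub> ?m (arc D 0) \<otimes>\<^bsub>knot_group D\<^esub> inv\<^bsub>knot_group D\<^esub> (k \<otimes>\<^bsub>knot_group D\<^esub> g)"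
      unfolding k(2) g(2) using k(1) g(1) m0 by (simp add: G.inv_mult_group G.m_assoc)
    then show ?thesis using k(1) g(1) G.m_closed by blast
  qed
qed

text \<open>The branch kernel is generated by conjugates of the square of m_1 alone; the other
  squares die because all meridians are conjugate.\<close>

lemma orbifold_meridian_square:
  assumes "i \<in> arcs"
  shows "orbifold_meridian D i \<otimes>\<^bsub>orbifold_group D\<^esub> orbifold_meridian D i = \<one>\<^bsub>orbifold_group D\<^esub>"
proof -
  let ?m = "meridian D" and ?k = "\<lambda>g. branch_kernel D #>\<^bsub>knot_group D\<^esub> g"
  have "\<exists>p<2 * crossings D. arc D p = i" if "i \<in> arcs" for i
  proof -
    have "i \<in> arc D ` {..<2 * crossings D}" using D that by (simp add: is_knot_diagram_def)
    then show ?thesis by blast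
  qed
  then obtain p p1 where p: "p < 2 * crossings D" "arc D p = i" and p1: "p1 < 2 * crossings D" "arc D p1 = 1"
    using assms one_in_arcs by blast
  obtain g where g: "g \<in> carrier (knot_group D)"
    "?m i = g \<otimes>\<^bsub>knot_group D\<^esub> ?m (arc D 0) \<otimes>\<^bsub>knot_group D\<^esub> inv\<^bsub>knot_group D\<^esub> g"
    using meridians_conjugate[OF p(1)] p(2) by blast
  obtain h where h: "h \<in> carrier (knot_group D)"
    "?m 1 = h \<otimes>\<^bsub>knot_group D\<^esub> ?m (arc D 0) \<otimes>\<^bsub>knot_group D\<^esub> inv\<^bsub>knot_group D\<^esub> h"
    using meridians_conjugate[OF p1(1)] p1(2) by auto
  have m0: "?m (arc D 0) \<in> carrier (knot_group D)"
    using arc_range[OF D, of 0] p(1) meridian_carrier by simp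
  have m1: "?m 1 \<in> carrier (knot_group D)" using meridian_carrier one_in_arcs by blast
  have "\<one>\<^bsub>knot_group D\<^esub> \<otimes>\<^bsub>knot_group D\<^esub> (?m 1 \<otimes>\<^bsub>knot_group D\<^esub> ?m 1) \<otimes>\<^bsub>knot_group D\<^esub> inv\<^bsub>knot_group D\<^esub> \<one>\<^bsub>knot_group D\<^esub> \<in> branch_kernel D"
    unfolding branch_kernel_eq by (rule generate.incl) blast
  then have "?k (?m 1 \<otimes>\<^bsub>knot_group D\<^esub> ?m 1) = \<one>\<^bsub>orbifold_group D\<^esub>"
    using m1 K.rcos_const by (simp add: orbifold_group_def)
  then have sq1: "?k (?m 1) \<otimes>\<^bsub>orbifold_group D\<^esub> ?k (?m 1) = \<one>\<^bsub>orbifold_group D\<^esub>"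
    using m1 by simp
  note conj = Q.conj_eq_one_iff and sq = Q.conj_square
  have "?k (?m (arc D 0)) \<otimes>\<^bsub>orbifold_group D\<^esub> ?k (?m (arc D 0)) = \<one>\<^bsub>orbifold_group D\<^esub>"
    using sq1 h m0 conj[of "?k (?m (arc D 0)) \<otimes>\<^bsub>orbifold_group D\<^esub> ?k (?m (arc D 0))" "?k h"]
      sq[of "?k (?m (arc D 0))" "?k h"] by simp
  then show ?thesis
    using g m0 conj[of "?k (?m (arc D 0)) \<otimes>\<^bsub>orbifold_group D\<^esub> ?k (?m (arc D 0))" "?k g"]
      sq[of "?k (?m (arc D 0))" "?k g"] by (simp add: orbifold_meridian_def)
qed

lemma orbifold_meridian_inv:
  "i \<in> arcs \<Longrightarrow> inv\<^bsub>orbifold_group D\<^esub> orbifold_meridian D i = orbifold_meridian D i"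
  using orbifold_meridian_square orbifold_meridian_carrier by (intro Q.inv_equality) blast+

end

section \<open>Representations of the double branched cover\<close>

lemma SL2C_simps [simp]:
  "A \<in> carrier SL2C \<longleftrightarrow> det A = 1" "mult SL2C = (**)" "\<one>\<^bsub>SL2C\<^esub> = mat 1"
  by (simp_all add: SL2C_def)

lemma group_SL2C: "group SL2C"
proof (rule groupI)
  fix A assume "A \<in> carrier SL2C"
  then show "\<exists>B\<in>carrier SL2C. B \<otimes>\<^bsub>SL2C\<^esub> A = \<one>\<^bsub>SL2C\<^esub>"
    by (intro bexI[of _ "adj2 A"]) (simp_all add: adj2_left)
qed (auto simp: det_mul matrix_mul_assoc)

lemma inv_SL2C: "det A = 1 \<Longrightarrow> inv\<^bsub>SL2C\<^esub> A = adj2 A"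
  using group.inv_equality[OF group_SL2C, of "adj2 A" A] by (simp add: adj2_left)

text \<open>The target for the orbifold group: its odd elements will be represented by matrices of
  determinant -1.\<close>

definition GL2C :: "(complex^2^2) monoid" where
  "GL2C = \<lparr>carrier = {A. det A \<noteq> 0}, mult = (**), one = mat 1\<rparr>"

lemma GL2C_simps [simp]:
  "A \<in> carrier GL2C \<longleftrightarrow> det A \<noteq> 0" "mult GL2C = (**)" "\<one>\<^bsub>GL2C\<^esub> = mat 1"
  by (simp_all add: GL2C_def)

lemma group_GL2C: "group GL2C"
proof (rule groupI)
  fix A assume "A \<in> carrier GL2C"
  then have "det A \<noteq> 0" by simp
  moreover have "((1 / det A) \<cdot> adj2 A) ** A = mat 1"
    using \<open>det A \<noteq> 0\<close> by (simp add: scale2_mult_left adj2_left) (simp add: mat2_simps)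
  ultimately show "\<exists>B\<in>carrier GL2C. B \<otimes>\<^bsub>GL2C\<^esub> A = \<one>\<^bsub>GL2C\<^esub>"
    by (intro bexI[of _ "(1 / det A) \<cdot> adj2 A"]) (simp_all add: det_scale2)
qed (auto simp: det_mul matrix_mul_assoc)

context
  fixes D :: knot_diagram
  assumes D: "is_knot_diagram D"
begin

declare One_nat_def [simp del]

interpretation G: group "knot_group D"
  using D by (rule group_knot_group)

interpretation K: normal "branch_kernel D" "knot_group D"
  using D by (rule normal_branch_kernel)

interpretation Q: group "orbifold_group D"
  using D by (rule group_orbifold_group)

interpretation coset: group_hom "knot_group D" "orbifold_group D" "\<lambda>g. branch_kernel D #>\<^bsub>knot_group D\<^esub> g"
  by (intro group_hom.intro group_hom_axioms.intro G.group_axioms Q.group_axioms coset_hom[OF D])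

section \<open>The branched cover group as the group of even words in involutions\<close>

lemma meridian_word_Nil [simp]: "meridian_word D [] = \<one>\<^bsub>orbifold_group D\<^esub>"
  by (simp add: meridian_word_def)

lemma meridian_word_Cons:
  "meridian_word D (i # l) = orbifold_meridian D i \<otimes>\<^bsub>orbifold_group D\<^esub> meridian_word D l"
  by (simp add: meridian_word_def)

lemma meridian_word_closed: "set l \<subseteq> (arcs D) \<Longrightarrow> meridian_word D l \<in> carrier (orbifold_group D)"
  by (induction l) (simp_all add: meridian_word_Cons orbifold_meridian_carrier[OF D] del: atLeastAtMost_iff)

lemma meridian_word_append:
  "set v \<subseteq> (arcs D) \<Longrightarrow> set w \<subseteq> (arcs D) \<Longrightarrow>
    meridian_word D (v @ w) = meridian_word D v \<otimes>\<^bsub>orbifold_group D\<^esub> meridian_word D w"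
  by (induction v) (simp_all add: meridian_word_Cons orbifold_meridian_carrier[OF D] meridian_word_closed
      Q.m_assoc del: atLeastAtMost_iff)

lemma meridian_word_cancel:
  assumes "i \<in> (arcs D)" "set l \<subseteq> (arcs D)"
  shows "meridian_word D (i # i # l) = meridian_word D l"
proof -
  have "meridian_word D (i # i # l) = (orbifold_meridian D i \<otimes>\<^bsub>orbifold_group D\<^esub> orbifold_meridian D i)
      \<otimes>\<^bsub>orbifold_group D\<^esub> meridian_word D l"
    using assms orbifold_meridian_carrier[OF D] meridian_word_closed by (simp add: meridian_word_Cons Q.m_assoc)
  then show ?thesis using orbifold_meridian_square[OF D] assms meridian_word_closed by simp
qed

lemma coset_word_class:
  assumes "w \<in> words (arcs D)"
  shows "branch_kernel D #>\<^bsub>knot_group D\<^esub> word_class (arcs D) (relators D) w = meridian_word D (map fst w)"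
  using assms
proof (induction w)
  case Nil
  then show ?case using coset.hom_one by (simp add: one_knot_group[OF D, symmetric])
next
  case (Cons p w)
  obtain i b where p: "p = (i, b)" by (cases p)
  then have i: "i \<in> (arcs D)" and w: "w \<in> words (arcs D)" using Cons.prems by simp_all
  have m: "meridian D i \<in> carrier (knot_group D)" using meridian_carrier[OF D i] .
  have letter: "branch_kernel D #>\<^bsub>knot_group D\<^esub> word_class (arcs D) (relators D) [(i, b)] = orbifold_meridian D i"
  proof (cases b)
    case True
    have "branch_kernel D #>\<^bsub>knot_group D\<^esub> inv\<^bsub>knot_group D\<^esub> meridian D i = orbifold_meridian D i"
      using coset.hom_inv[OF m] orbifold_meridian_inv[OF D i] by (simp add: orbifold_meridian_def)
    then show ?thesis using inv_meridian[OF D i] True by simp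
  qed (simp add: orbifold_meridian_def meridian_def)
  have "word_class (arcs D) (relators D) (p # w) = word_class (arcs D) (relators D) [(i, b)] \<otimes>\<^bsub>knot_group D\<^esub> word_class (arcs D) (relators D) w"
    using mult_knot_group[OF D, of "[(i, b)]" w] i w p by simp
  moreover have "word_class (arcs D) (relators D) [(i, b)] \<in> carrier (knot_group D)"
    "word_class (arcs D) (relators D) w \<in> carrier (knot_group D)"
    unfolding carrier_knot_group[OF D] using i w by (auto intro!: imageI)
  ultimately show ?case
    using Cons.IH[OF w] letter coset.hom_mult by (simp add: p meridian_word_Cons)
qed

text \<open>A coset of the branch kernel is the same set whether formed in the even subgroup or in
  the knot group, so the branched cover group sits inside the orbifold group literally, without an
  embedding map.\<close>

lemma carrier_branched_cover_group:
  "carrier (branched_cover_group D) = meridian_word D ` {l. set l \<subseteq> (arcs D) \<and> even (length l)}"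
proof -
  have "carrier (branched_cover_group D) = (\<lambda>g. branch_kernel D #>\<^bsub>knot_group D\<^esub> g) ` even_subgroup D"
    by (auto simp: branched_cover_group_def FactGroup_def RCOSETS_def double_cover_group_def)
  also have "even_subgroup D = word_class (arcs D) (relators D) ` {w \<in> words (arcs D). even (length w)}"
    using mem_even_subgroup[OF D] by blast
  also have "(\<lambda>g. branch_kernel D #>\<^bsub>knot_group D\<^esub> g) ` \<dots> = (\<lambda>w. meridian_word D (map fst w)) ` {w \<in> words (arcs D). even (length w)}"
    unfolding image_image by (intro image_cong) (simp_all add: coset_word_class)
  also have "\<dots> = meridian_word D ` {l. set l \<subseteq> (arcs D) \<and> even (length l)}"
  proof (intro equalityI subsetI)
    fix x assume "x \<in> (\<lambda>w. meridian_word D (map fst w)) ` {w \<in> words (arcs D). even (length w)}"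
    then obtain w where "w \<in> words (arcs D)" "even (length w)" "x = meridian_word D (map fst w)" by blast
    moreover from this have "set (map fst w) \<subseteq> (arcs D)" by (auto simp: words_def)
    ultimately show "x \<in> meridian_word D ` {l. set l \<subseteq> (arcs D) \<and> even (length l)}" by auto
  next
    fix x assume "x \<in> meridian_word D ` {l. set l \<subseteq> (arcs D) \<and> even (length l)}"
    then obtain l where l: "set l \<subseteq> (arcs D)" "even (length l)" "x = meridian_word D l" by blast
    define w where "w = map (\<lambda>i. (i, False)) l"
    have "w \<in> words (arcs D)" "even (length w)" "map fst w = l"
      using l by (auto simp: w_def words_def comp_def)
    then show "x \<in> (\<lambda>w. meridian_word D (map fst w)) ` {w \<in> words (arcs D). even (length w)}"
      using l(3) by auto
  qed
  finally show ?thesis .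
qed

lemma mult_branched_cover_group: "mult (branched_cover_group D) = mult (orbifold_group D)"
  by (intro ext) (simp add: branched_cover_group_def orbifold_group_def FactGroup_def double_cover_group_def)

lemma one_branched_cover_group: "\<one>\<^bsub>branched_cover_group D\<^esub> = \<one>\<^bsub>orbifold_group D\<^esub>"
  by (simp add: branched_cover_group_def orbifold_group_def FactGroup_def)

lemma meridian_product_eq:
  assumes "i \<in> (arcs D)" "j \<in> (arcs D)"
  shows "meridian_product D i j = meridian_word D [i, j]"
proof -
  have "meridian_product D i j = branch_kernel D #>\<^bsub>knot_group D\<^esub> (meridian D i \<otimes>\<^bsub>knot_group D\<^esub> meridian D j)"
    by (simp add: meridian_product_def double_cover_group_def)
  also have "\<dots> = meridian_word D [i, j]"
    using assms meridian_carrier[OF D] orbifold_meridian_carrier[OF D]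
    by (simp add: meridian_word_Cons orbifold_meridian_def)
  finally show ?thesis .
qed

lemma group_branched_cover_group: "group (branched_cover_group D)"
proof (rule groupI, unfold mult_branched_cover_group one_branched_cover_group carrier_branched_cover_group)
  let ?C = "meridian_word D ` {l. set l \<subseteq> (arcs D) \<and> even (length l)}"
  show "x \<otimes>\<^bsub>orbifold_group D\<^esub> y \<in> ?C" if "x \<in> ?C" "y \<in> ?C" for x y
  proof -
    from that obtain v w where "set v \<subseteq> (arcs D)" "even (length v)" "x = meridian_word D v"
      "set w \<subseteq> (arcs D)" "even (length w)" "y = meridian_word D w" by blast
    then show ?thesis by (intro image_eqI[of _ _ "v @ w"]) (simp_all add: meridian_word_append)
  qed
  show "\<one>\<^bsub>orbifold_group D\<^esub> \<in> ?C" by (intro image_eqI[of _ _ "[]"]) simp_all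
  show "\<exists>y\<in>?C. y \<otimes>\<^bsub>orbifold_group D\<^esub> x = \<one>\<^bsub>orbifold_group D\<^esub>" if "x \<in> ?C" for x
  proof -
    from that obtain v where v: "set v \<subseteq> (arcs D)" "even (length v)" "x = meridian_word D v" by blast
    have "meridian_word D (rev v) \<otimes>\<^bsub>orbifold_group D\<^esub> meridian_word D v = \<one>\<^bsub>orbifold_group D\<^esub>"
      using v(1)
    proof (induction v)
      case (Cons i v)
      then have "meridian_word D (rev (i # v)) \<otimes>\<^bsub>orbifold_group D\<^esub> meridian_word D (i # v)
          = meridian_word D (rev v @ i # i # v)"
        using meridian_word_append[of "rev v @ [i]" "i # v"] by simp
      also have "\<dots> = meridian_word D (rev v) \<otimes>\<^bsub>orbifold_group D\<^esub> meridian_word D v"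
        using Cons.prems by (simp add: meridian_word_append meridian_word_cancel)
      finally show ?case using Cons by simp
    qed simp
    then show ?thesis using v by (intro bexI[of _ "meridian_word D (rev v)"]) auto
  qed
qed (auto simp: meridian_word_closed Q.m_assoc)

text \<open>For an involution, conjugating by it and by its inverse is the same, so the sign of the
  crossing and the direction of the under-strand disappear.\<close>

lemma orbifold_relation:
  assumes "c < crossings D"
  shows "meridian_word D [over_arc D c, under_arc_in D c, over_arc D c] = meridian_word D [under_arc_out D c]"
proof -
  define i j k where "i = over_arc D c" "j = under_arc_in D c" "k = under_arc_out D c"
  have arcs: "i \<in> (arcs D)" "j \<in> (arcs D)" "k \<in> (arcs D)"
    using over_arc_range[OF D assms] under_arc_in_range[OF D assms] under_arc_out_range[OF D assms]
    by (simp_all add: i_j_k_def)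
  let ?u = "orbifold_meridian D"
  note u = orbifold_meridian_carrier[OF D arcs(1)] orbifold_meridian_carrier[OF D arcs(2)]
    orbifold_meridian_carrier[OF D arcs(3)]
  note sq = orbifold_meridian_square[OF D arcs(1)]
  have push: "?u x \<otimes>\<^bsub>orbifold_group D\<^esub> ?u y = ?u z \<otimes>\<^bsub>orbifold_group D\<^esub> ?u w"
    if "meridian D x \<otimes>\<^bsub>knot_group D\<^esub> meridian D y = meridian D z \<otimes>\<^bsub>knot_group D\<^esub> meridian D w"
      "x \<in> (arcs D)" "y \<in> (arcs D)" "z \<in> (arcs D)" "w \<in> (arcs D)" for x y z w
  proof -
    have "branch_kernel D #>\<^bsub>knot_group D\<^esub> (meridian D x \<otimes>\<^bsub>knot_group D\<^esub> meridian D y) =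
      branch_kernel D #>\<^bsub>knot_group D\<^esub> (meridian D z \<otimes>\<^bsub>knot_group D\<^esub> meridian D w)"
      using that(1) by simp
    then show ?thesis using that(2-) meridian_carrier[OF D] by (simp add: orbifold_meridian_def)
  qed
  have "?u i \<otimes>\<^bsub>orbifold_group D\<^esub> ?u j \<otimes>\<^bsub>orbifold_group D\<^esub> ?u i = ?u k"
    using wirtinger_relation[OF D assms, folded i_j_k_def]
  proof
    assume "meridian D i \<otimes>\<^bsub>knot_group D\<^esub> meridian D k = meridian D j \<otimes>\<^bsub>knot_group D\<^esub> meridian D i"
    then have "?u i \<otimes>\<^bsub>orbifold_group D\<^esub> ?u k = ?u j \<otimes>\<^bsub>orbifold_group D\<^esub> ?u i"
      using push arcs by blast
    then have "?u i \<otimes>\<^bsub>orbifold_group D\<^esub> ?u j \<otimes>\<^bsub>orbifold_group D\<^esub> ?u i = ?u i \<otimes>\<^bsub>orbifold_group D\<^esub> (?u i \<otimes>\<^bsub>orbifold_group D\<^esub> ?u k)"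
      using u by (simp add: Q.m_assoc)
    then show ?thesis using u sq by (simp flip: Q.m_assoc)
  next
    assume "meridian D k \<otimes>\<^bsub>knot_group D\<^esub> meridian D i = meridian D i \<otimes>\<^bsub>knot_group D\<^esub> meridian D j"
    then have "?u k \<otimes>\<^bsub>orbifold_group D\<^esub> ?u i = ?u i \<otimes>\<^bsub>orbifold_group D\<^esub> ?u j"
      using push arcs by blast
    then have "?u i \<otimes>\<^bsub>orbifold_group D\<^esub> ?u j \<otimes>\<^bsub>orbifold_group D\<^esub> ?u i = ?u k \<otimes>\<^bsub>orbifold_group D\<^esub> (?u i \<otimes>\<^bsub>orbifold_group D\<^esub> ?u i)"
      using u by (simp flip: Q.m_assoc)
    then show ?thesis using u sq by simp
  qed
  then show ?thesis
    unfolding i_j_k_def[symmetric] using u by (simp add: meridian_word_Cons Q.m_assoc)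
qed

text \<open>In effect the presentation of the orbifold group by the meridians, their squares and one
  relation per crossing.\<close>

lemma orbifold_universal:
  fixes M (structure)
  assumes "group M" and f: "\<And>i. i \<in> (arcs D) \<Longrightarrow> f i \<in> carrier M" "\<And>i. i \<in> (arcs D) \<Longrightarrow> f i \<otimes> f i = \<one>"
    and rel: "\<And>c. c < crossings D \<Longrightarrow> f (over_arc D c) \<otimes> f (under_arc_in D c) \<otimes> f (over_arc D c) = f (under_arc_out D c)"
  obtains h where "h \<in> hom (orbifold_group D) M"
    "\<And>l. set l \<subseteq> (arcs D) \<Longrightarrow> h (meridian_word D l) = foldr (\<otimes>) (map f l) \<one>"
proof -
  interpret M: group M by fact
  have inv: "inv f i = f i" if "i \<in> (arcs D)" for i using f that by (intro M.inv_equality) auto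
  have cancel: "f i \<otimes> (f i \<otimes> y) = y" if "i \<in> (arcs D)" "y \<in> carrier M" for i y
    using f that by (simp flip: M.m_assoc)
  have fX: "f \<in> (arcs D) \<rightarrow> carrier M" using f by blast
  have "word_eval M f r = \<one>" if r: "r \<in> (relators D)" "r \<in> words (arcs D)" for r
  proof -
    from r(1) obtain c where "c < crossings D - 1" "r = wirtinger_relator D c" by blast
    then have c: "c < crossings D" "r = wirtinger_relator D c" by simp_all
    note arcs = over_arc_range[OF D c(1)] under_arc_in_range[OF D c(1)] under_arc_out_range[OF D c(1)]
    note closed = f(1)[OF arcs(1)] f(1)[OF arcs(2)] f(1)[OF arcs(3)]
    show ?thesis
      unfolding c(2) wirtinger_relator_def Let_def
      using closed inv[OF arcs(1)] inv[OF arcs(2)] cancel[OF arcs(1)] cancel[OF arcs(2)] f(2)[OF arcs(1)] f(2)[OF arcs(2)]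
      by (simp add: rel[OF c(1), symmetric] M.m_assoc)
  qed
  then obtain h where "h \<in> hom (presented_group (arcs D) (relators D)) M"
    and hw: "\<And>w. w \<in> words (arcs D) \<Longrightarrow> h (word_class (arcs D) (relators D) w) = word_eval M f w"
    by (rule M.presented_group_universal[OF fX]) (assumption | rule that)+
  then have h: "h \<in> hom (knot_group D) M" by (simp add: knot_group_def)
  interpret h: group_hom "knot_group D" M h
    by (intro group_hom.intro group_hom_axioms.intro G.group_axioms M.group_axioms h)
  have hm: "h (meridian D i) = f i" if "i \<in> (arcs D)" for i
    using hw[of "[(i, False)]"] that f by (simp add: meridian_def)
  have "branch_kernel D \<subseteq> kernel (knot_group D) M h"
    unfolding branch_kernel_eq[OF D]
  proof (rule G.generate_subgroup_incl[OF _ h.subgroup_kernel], clarify)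
    fix g assume g: "g \<in> carrier (knot_group D)"
    have "1 \<in> (arcs D)" by (rule one_in_arcs[OF D])
    then show "g \<otimes>\<^bsub>knot_group D\<^esub> (meridian D 1 \<otimes>\<^bsub>knot_group D\<^esub> meridian D 1) \<otimes>\<^bsub>knot_group D\<^esub> inv\<^bsub>knot_group D\<^esub> g
      \<in> kernel (knot_group D) M h"
      using g meridian_carrier[OF D] f hm[of 1] by (simp add: kernel_def)
  qed
  then obtain h' where "h' \<in> hom (knot_group D Mod branch_kernel D) M"
    and hc: "\<And>x. x \<in> carrier (knot_group D) \<Longrightarrow> h' (branch_kernel D #>\<^bsub>knot_group D\<^esub> x) = h x"
    by (rule h.FactGroup_universal_kernel[OF normal_branch_kernel[OF D]]) (assumption | rule that)+
  then have h': "h' \<in> hom (orbifold_group D) M" by (simp add: orbifold_group_def)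
  interpret h': group_hom "orbifold_group D" M h'
    by (intro group_hom.intro group_hom_axioms.intro Q.group_axioms M.group_axioms h')
  have "h' (meridian_word D l) = foldr (\<otimes>) (map f l) \<one>" if "set l \<subseteq> (arcs D)" for l
    using that
  proof (induction l)
    case (Cons i l)
    then have "h' (orbifold_meridian D i) = f i"
      using hc meridian_carrier[OF D] hm by (simp add: orbifold_meridian_def)
    then show ?case
      using Cons orbifold_meridian_carrier[OF D] meridian_word_closed by (simp add: meridian_word_Cons)
  qed simp
  with h' that show thesis by blast
qed

end

section \<open>Characters and their trace coordinates\<close>

definition char_of :: "('a, 'b) monoid_scheme \<Rightarrow> ('a \<Rightarrow> complex^2^2) \<Rightarrow> ('a \<Rightarrow> complex)" where
  "char_of G \<rho> = restrict (\<lambda>g. trace (\<rho> g)) (carrier G)"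

lemma characters_eq: "characters G = char_of G ` hom G SL2C"
  by (auto simp: characters_def char_of_def)

lemma hom_SL2C:
  assumes "group G" "\<rho> \<in> hom G SL2C"
  shows "\<rho> \<one>\<^bsub>G\<^esub> = mat 1" "x \<in> carrier G \<Longrightarrow> det (\<rho> x) = 1"
    "x \<in> carrier G \<Longrightarrow> y \<in> carrier G \<Longrightarrow> \<rho> (x \<otimes>\<^bsub>G\<^esub> y) = \<rho> x ** \<rho> y"
    "x \<in> carrier G \<Longrightarrow> \<rho> (inv\<^bsub>G\<^esub> x) = adj2 (\<rho> x)"
proof -
  interpret group_hom G SL2C \<rho>
    using assms group_SL2C by (intro group_hom.intro group_hom_axioms.intro)
  show "\<rho> \<one>\<^bsub>G\<^esub> = mat 1" using hom_one by simp
  show det: "det (\<rho> x) = 1" if "x \<in> carrier G" for x using hom_closed[OF that] by simp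
  then show "x \<in> carrier G \<Longrightarrow> \<rho> (inv\<^bsub>G\<^esub> x) = adj2 (\<rho> x)"
    using hom_inv[of x] inv_SL2C by simp
  show "x \<in> carrier G \<Longrightarrow> y \<in> carrier G \<Longrightarrow> \<rho> (x \<otimes>\<^bsub>G\<^esub> y) = \<rho> x ** \<rho> y" using hom_mult[of x y] by simp
qed

lemma trace_coordinates_char_of:
  assumes "group G" "\<rho> \<in> hom G SL2C" "set gs \<subseteq> carrier G"
  shows "trace_coordinates G gs (char_of G \<rho>) = word_trace_coords (length gs) (\<lambda>i. \<rho> (gs ! i))"
proof -
  interpret group G by fact
  have *: "foldr (\<otimes>\<^bsub>G\<^esub>) (map ((!) gs) is) \<one>\<^bsub>G\<^esub> \<in> carrier G \<and>
      \<rho> (foldr (\<otimes>\<^bsub>G\<^esub>) (map ((!) gs) is) \<one>\<^bsub>G\<^esub>) = foldr (**) (map (\<lambda>i. \<rho> (gs ! i)) is) (mat 1)"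
    if "set is \<subseteq> {..<length gs}" for "is"
    using that
  proof (induction "is")
    case (Cons i "is")
    then have "gs ! i \<in> carrier G" using assms(3) by auto
    then show ?case using Cons hom_SL2C(3)[OF assms(1,2)] by simp
  qed (simp add: hom_SL2C(1)[OF assms(1,2)])
  show ?thesis
    unfolding trace_coordinates_def word_trace_coords_def
  proof (rule restrict_ext)
    fix "is" assume "is \<in> trace_indices (length gs)"
    then have "set is \<subseteq> {..<length gs}" by (simp add: trace_indices_def)
    from *[OF this] show "char_of G \<rho> (foldr (\<otimes>\<^bsub>G\<^esub>) (map ((!) gs) is) \<one>\<^bsub>G\<^esub>) =
      trace (foldr (**) (map (\<lambda>i. \<rho> (gs ! i)) is) (mat 1))" by (simp add: char_of_def)
  qed
qed

text \<open>The induction over \<open>generate\<close> produces one element of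
  \<open>word_module\<close> that computes \<open>\<rho> g\<close> for all representations at once;
  this uniformity is what makes its trace a polynomial function on the character variety.\<close>

lemma character_polynomial:
  assumes "group G" "set gs \<subseteq> carrier G" "g \<in> generate G (set gs)"
  obtains p where "p \<in> polynomial_functions (trace_indices (length gs))"
    "\<And>\<rho>. \<rho> \<in> hom G SL2C \<Longrightarrow> trace (\<rho> g) = p (trace_coordinates G gs (char_of G \<rho>))"
proof -
  interpret group G by fact
  let ?r = "length gs"
  have "\<exists>M\<in>word_module ?r. \<forall>\<rho>\<in>hom G SL2C. \<rho> g = M (\<lambda>i. \<rho> (gs ! i))"
    using assms(3)
  proof induction
    case one
    show ?case using hom_SL2C(1)[OF assms(1)] by (intro bexI[OF _ word_module.one]) simp
  next
    case (incl h)
    then obtain i where "i < ?r" "h = gs ! i" by (auto simp: in_set_conv_nth)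
    then show ?case by (intro bexI[OF _ word_module.gen[of i]]) simp_all
  next
    case (inv h)
    then obtain i where "i < ?r" "h = gs ! i" by (auto simp: in_set_conv_nth)
    moreover have "h \<in> carrier G" using inv assms(2) by blast
    ultimately show ?case using hom_SL2C(4)[OF assms(1)] by (intro bexI[OF _ word_module_adj2[of i]]) simp_all
  next
    case (eng g h)
    then obtain M N where MN: "M \<in> word_module ?r" "\<forall>\<rho>\<in>hom G SL2C. \<rho> g = M (\<lambda>i. \<rho> (gs ! i))"
      "N \<in> word_module ?r" "\<forall>\<rho>\<in>hom G SL2C. \<rho> h = N (\<lambda>i. \<rho> (gs ! i))" by blast
    have "g \<in> carrier G" "h \<in> carrier G" using eng generate_in_carrier[OF assms(2)] by blast+
    then show ?case
      using MN hom_SL2C(3)[OF assms(1)] by (intro bexI[OF _ word_module_mult[OF MN(1,3)]]) simp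
  qed
  then obtain M where M: "M \<in> word_module ?r" "\<And>\<rho>. \<rho> \<in> hom G SL2C \<Longrightarrow> \<rho> g = M (\<lambda>i. \<rho> (gs ! i))" by blast
  obtain p where p: "p \<in> polynomial_functions (trace_indices ?r)"
    "\<And>m. (\<forall>i<?r. det (m i) = 1) \<Longrightarrow> trace (M m) = p (word_trace_coords ?r m)"
    using word_module_trace[OF M(1)] unfolding trace_polynomials_def by blast
  show thesis
  proof (rule that[OF p(1)])
    fix \<rho> assume \<rho>: "\<rho> \<in> hom G SL2C"
    have "\<forall>i<?r. det (\<rho> (gs ! i)) = 1" using hom_SL2C(2)[OF assms(1) \<rho>] assms(2) nth_mem by blast
    then show "trace (\<rho> g) = p (trace_coordinates G gs (char_of G \<rho>))"
      using p(2) M(2)[OF \<rho>] trace_coordinates_char_of[OF assms(1) \<rho> assms(2)] by simp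
  qed
qed

text \<open>Guarantees that the inverse taken in \<open>h_star_coords\<close> really recovers the
  character from its coordinates.\<close>

lemma inj_on_trace_coordinates:
  assumes "group G" "set gs \<subseteq> carrier G" "generate G (set gs) = carrier G"
  shows "inj_on (trace_coordinates G gs) (characters G)"
proof (rule inj_onI)
  fix \<xi> \<xi>' assume "\<xi> \<in> characters G" "\<xi>' \<in> characters G"
    and eq: "trace_coordinates G gs \<xi> = trace_coordinates G gs \<xi>'"
  then obtain \<rho> \<rho>' where \<rho>: "\<rho> \<in> hom G SL2C" "\<xi> = char_of G \<rho>" "\<rho>' \<in> hom G SL2C" "\<xi>' = char_of G \<rho>'"
    unfolding characters_eq by blast
  have "trace (\<rho> g) = trace (\<rho>' g)" if "g \<in> carrier G" for g
  proof -
    have "g \<in> generate G (set gs)" using that assms(3) by simp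
    then obtain p where "\<And>\<rho>. \<rho> \<in> hom G SL2C \<Longrightarrow> trace (\<rho> g) = p (trace_coordinates G gs (char_of G \<rho>))"
      using character_polynomial[OF assms(1,2)] by metis
    then show ?thesis using \<rho> eq by metis
  qed
  then show "\<xi> = \<xi>'" unfolding \<rho> char_of_def by (rule restrict_ext)
qed

section \<open>Representations of the branched cover, Gram matrices and trace-free lifts\<close>

definition rep_matrices :: "knot_diagram \<Rightarrow> (nat word set set \<Rightarrow> complex^2^2) \<Rightarrow> nat \<Rightarrow> complex^2^2" where
  "rep_matrices D \<rho> i = \<rho> (meridian_product D 1 i)"

context
  fixes D :: knot_diagram
  assumes D: "is_knot_diagram D"
begin

declare One_nat_def [simp del]

interpretation \<pi>: group "branched_cover_group D"
  using D by (rule group_branched_cover_group)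

lemma word_carrier:
  "set l \<subseteq> arcs D \<Longrightarrow> even (length l) \<Longrightarrow> meridian_word D l \<in> carrier (branched_cover_group D)"
  unfolding carrier_branched_cover_group[OF D] by blast

lemma word_append:
  "set v \<subseteq> arcs D \<Longrightarrow> set w \<subseteq> arcs D \<Longrightarrow>
    meridian_word D (v @ w) = meridian_word D v \<otimes>\<^bsub>branched_cover_group D\<^esub> meridian_word D w"
  unfolding mult_branched_cover_group[OF D] by (rule meridian_word_append[OF D])

lemma word_cancel:
  assumes "set v \<subseteq> arcs D" "set w \<subseteq> arcs D" "i \<in> arcs D"
  shows "meridian_word D (v @ i # i # w) = meridian_word D (v @ w)"
proof -
  have "set (i # i # w) \<subseteq> arcs D" using assms by simp
  then show ?thesis
    using assms meridian_word_append[OF D] meridian_word_cancel[OF D] by simp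
qed

context
  fixes \<rho>
  assumes \<rho>: "\<rho> \<in> hom (branched_cover_group D) SL2C"
begin

abbreviation (input) "a \<equiv> rep_matrices D \<rho>"

lemma rep_matrices_word: "i \<in> arcs D \<Longrightarrow> a i = \<rho> (meridian_word D [1, i])"
  using meridian_product_eq[OF D one_in_arcs[OF D]] by (simp add: rep_matrices_def)

lemma det_rep_matrices: "i \<in> arcs D \<Longrightarrow> det (a i) = 1"
  using hom_SL2C(2)[OF \<pi>.group_axioms \<rho>] word_carrier one_in_arcs[OF D] rep_matrices_word by simp

lemma rep_matrices_one: "a 1 = mat 1"
proof -
  have "meridian_word D [1, 1] = \<one>\<^bsub>branched_cover_group D\<^esub>"
    using word_cancel[of "[]" "[]" 1] one_in_arcs[OF D] one_branched_cover_group[OF D] meridian_word_Nil[OF D] by simp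
  then show ?thesis
    using rep_matrices_word[OF one_in_arcs[OF D]] hom_SL2C(1)[OF \<pi>.group_axioms \<rho>] by simp
qed

lemma rep_pair:
  assumes "i \<in> arcs D" "j \<in> arcs D"
  shows "\<rho> (meridian_word D [i, j]) = adj2 (a i) ** a j"
proof -
  have "meridian_word D [1, i] \<otimes>\<^bsub>branched_cover_group D\<^esub> meridian_word D [i, j] = meridian_word D [1, j]"
    using word_append[of "[1, i]" "[i, j]"] word_cancel[of "[1]" "[j]" i] assms one_in_arcs[OF D] by simp
  then have "a i ** \<rho> (meridian_word D [i, j]) = a j"
    using hom_SL2C(3)[OF \<pi>.group_axioms \<rho>, of "meridian_word D [1, i]" "meridian_word D [i, j]"]
      word_carrier assms one_in_arcs[OF D] rep_matrices_word by simp
  then have "adj2 (a i) ** a j = (adj2 (a i) ** a i) ** \<rho> (meridian_word D [i, j])"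
    by (metis matrix_mul_assoc)
  then show ?thesis using det_rep_matrices[OF assms(1)] by (simp add: adj2_left)
qed

lemma rep_word:
  assumes "set l \<subseteq> arcs D" "even (length l)"
  shows "\<rho> (meridian_word D l) = alt_word a False l"
  using assms
proof (induction l rule: induct_list012)
  case 1
  then show ?case
    using hom_SL2C(1)[OF \<pi>.group_axioms \<rho>] one_branched_cover_group[OF D] meridian_word_Nil[OF D] by simp
next
  case (3 i j l)
  have "\<rho> (meridian_word D (i # j # l)) = \<rho> (meridian_word D [i, j]) ** \<rho> (meridian_word D l)"
    using word_append[of "[i, j]" l] 3 hom_SL2C(3)[OF \<pi>.group_axioms \<rho>] word_carrier by simp
  then show ?case using 3 rep_pair[of i j] by (simp add: matrix_mul_assoc)
qed simp

text \<open>The relation is symmetric in the two under-arcs. Both forms are stated because a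
  Wirtinger triple lists the under-arcs by label and not by direction of travel.\<close>

lemma rep_relation:
  assumes "c < crossings D"
  shows "a (under_arc_out D c) = a (over_arc D c) ** adj2 (a (under_arc_in D c)) ** a (over_arc D c)"
    "a (under_arc_in D c) = a (over_arc D c) ** adj2 (a (under_arc_out D c)) ** a (over_arc D c)"
proof -
  define i j k where "i = over_arc D c" "j = under_arc_in D c" "k = under_arc_out D c"
  have ijk: "i \<in> arcs D" "j \<in> arcs D" "k \<in> arcs D"
    using over_arc_range[OF D assms] under_arc_in_range[OF D assms] under_arc_out_range[OF D assms]
    by (simp_all add: i_j_k_def)
  have "meridian_word D [1, k] = meridian_word D [1, i, j, i]"
    using orbifold_relation[OF D assms] meridian_word_Cons[OF D, of 1] by (simp add: i_j_k_def)
  then have "\<rho> (meridian_word D [1, k]) = \<rho> (meridian_word D [1, i, j, i])" by simp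
  then have "a k = adj2 (a 1) ** (a i ** (adj2 (a j) ** (a i ** mat 1)))"
    using rep_matrices_word[OF ijk(3)] rep_word[of "[1, i, j, i]"] ijk one_in_arcs[OF D] by simp
  then have k: "a k = a i ** adj2 (a j) ** a i" by (simp add: rep_matrices_one matrix_mul_assoc)
  then have "a i ** adj2 (a k) ** a i = (a i ** adj2 (a i)) ** a j ** (adj2 (a i) ** a i)"
    by (simp add: adj2_mult matrix_mul_assoc)
  then have j: "a j = a i ** adj2 (a k) ** a i"
    using det_rep_matrices[OF ijk(1)] by (simp add: adj2_left adj2_right)
  from k j show "a (under_arc_out D c) = a (over_arc D c) ** adj2 (a (under_arc_in D c)) ** a (over_arc D c)"
    "a (under_arc_in D c) = a (over_arc D c) ** adj2 (a (under_arc_out D c)) ** a (over_arc D c)"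
    by (simp_all add: i_j_k_def)
qed

lemma h_star_char_of: "h_star D (char_of (branched_cover_group D) \<rho>) = gram_coords (crossings D) a"
  unfolding h_star_def gram_coords_def arc_pairs_def
proof (rule restrict_ext, clarify)
  fix i j assume "1 \<le> i" "i < j" "j \<le> crossings D"
  then have ij: "i \<in> arcs D" "j \<in> arcs D" by simp_all
  then have "meridian_word D [i, j] \<in> carrier (branched_cover_group D)" by (intro word_carrier) simp_all
  then show "char_of (branched_cover_group D) \<rho> (meridian_product D i j) = gram a i j"
    using meridian_product_eq[OF D ij] rep_pair[OF ij] by (simp add: char_of_def gram_def)
qed

text \<open>The equations of the fundamental variety are Fricke's identity for X = a_b^-1 a_i and Y
  = a_i^-1 a_j: then XY = a_b^-1 a_j, and X Y^-1 = a_b^-1 a_k by the Wirtinger relation.\<close>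

lemma gram_coords_fundamental: "gram_coords (crossings D) a \<in> fundamental_variety D"
proof -
  let ?x = "gram_coords (crossings D) a"
  have pc: "pair_coord ?x i j = gram a i j" if "i \<in> arcs D" "j \<in> arcs D" for i j
    using pair_coord_gram_coords[OF that] det_rep_matrices by blast
  have rel: "gram a b k = gram a i j * gram a b i - gram a b j"
    if "a k = a i ** adj2 (a j) ** a i" "i \<in> arcs D" for b i j k
  proof -
    have "adj2 (a b) ** a k = adj2 (a b) ** a i ** adj2 (adj2 (a i) ** a j)"
      unfolding that(1) by (simp add: adj2_mult matrix_mul_assoc)
    moreover have "adj2 (a b) ** a i ** (adj2 (a i) ** a j) = adj2 (a b) ** (a i ** adj2 (a i)) ** a j"
      by (simp add: matrix_mul_assoc)
    ultimately show ?thesis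
      using trace_mult_adj2[of "adj2 (a b) ** a i" "adj2 (a i) ** a j"] det_rep_matrices[OF that(2)]
      by (simp add: gram_def adj2_right mult.commute)
  qed
  have "pair_coord ?x b (max j k) = pair_coord ?x i (min j k) * pair_coord ?x b i - pair_coord ?x b (min j k)"
    if "c < crossings D" "b \<in> arcs D" "i = over_arc D c" "j = under_arc_in D c" "k = under_arc_out D c" for b c i j k
  proof -
    have "i \<in> arcs D" "j \<in> arcs D" "k \<in> arcs D"
      using over_arc_range[OF D that(1)] under_arc_in_range[OF D that(1)] under_arc_out_range[OF D that(1)]
      by (simp_all only: that)
    then show ?thesis
      using rel[OF rep_relation(1)[OF that(1)], of b] rel[OF rep_relation(2)[OF that(1)], of b] that(2)
      by (cases "j \<le> k") (simp_all add: that(3-5) pc min_def max_def del: atLeastAtMost_iff)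
  qed
  moreover have "?x \<in> extensional (arc_pairs D)"
    by (simp add: gram_coords_def arc_pairs_def)
  ultimately show ?thesis
    unfolding fundamental_variety_def wirtinger_triples_def by blast
qed

lemma trace_free_lift_hom:
  assumes sym: "\<And>l. set l \<subseteq> arcs D \<Longrightarrow> even (length l) \<Longrightarrow> trace (alt_word a False l) = trace (alt_word a True l)"
  shows "gram_coords (crossings D) a \<in> fst ` trace_free_slice D"
proof -
  let ?X = "arcs D"
  have tri: "trace (a i ** a j ** a k) = trace (a k ** a j ** a i)" if "i \<in> ?X" "j \<in> ?X" "k \<in> ?X" for i j k
  proof -
    \<comment> \<open>The interspersed letters 1 have the identity as matrix and put
      \<open>i\<close>, \<open>j\<close>, \<open>k\<close> into positions of the same kind, so
      invariance compares the product of the three matrices with its reversal.\<close>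
    have "trace (alt_word a False [i, 1, j, 1, k, 1]) = trace (alt_word a True [i, 1, j, 1, k, 1])"
      using that one_in_arcs[OF D] by (intro sym) simp_all
    then have "trace (adj2 (a k ** a j ** a i)) = trace (a i ** a j ** a k)"
      by (simp add: rep_matrices_one adj2_mult matrix_mul_assoc)
    then show ?thesis by simp
  qed
  obtain M :: "nat \<Rightarrow> complex^2^2" where M: "\<And>i. i \<in> ?X \<Longrightarrow> det (M i) = 1" "\<And>i. i \<in> ?X \<Longrightarrow> trace (M i) = 0"
    "\<And>i j. i \<in> ?X \<Longrightarrow> j \<in> ?X \<Longrightarrow> - trace (M i ** M j) = trace (adj2 (a i) ** a j)"
    "\<And>i j k. i \<in> ?X \<Longrightarrow> j \<in> ?X \<Longrightarrow> k \<in> ?X \<Longrightarrow> a k = a i ** adj2 (a j) ** a i \<Longrightarrow> M k = - (M i ** M j ** M i)"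
    by (rule trace_free_lift[of ?X a]) (assumption | rule det_rep_matrices tri | rule that)+
  interpret S: group SL2C by (rule group_SL2C)
  have adjM: "adj2 (M i) = - M i" if "i \<in> ?X" for i
    using M(2)[OF that] by (simp add: mat2_simps)
  have MM: "M i ** M i = - mat 1" if "i \<in> ?X" for i
    using trace_free_square[OF M(2)[OF that]] M(1)[OF that] by simp
  have neg: "A ** (- B) = - (A ** B)" "(- A) ** B = - (A ** B)" for A B :: "complex^2^2"
    by (simp_all add: mat2_simps)
  have MMl: "M i ** (M i ** B) = - B" if "i \<in> ?X" for i and B :: "complex^2^2"
    by (simp add: matrix_mul_assoc MM[OF that] neg)
  have "word_eval SL2C M r = \<one>\<^bsub>SL2C\<^esub>" if r: "r \<in> relators D" "r \<in> words ?X" for r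
  proof -
    from r(1) obtain c where "c < crossings D - 1" "r = wirtinger_relator D c" by blast
    then have c: "c < crossings D" "r = wirtinger_relator D c" by simp_all
    note ijk = over_arc_range[OF D c(1)] under_arc_in_range[OF D c(1)] under_arc_out_range[OF D c(1)]
    have k: "M (under_arc_out D c) = - (M (over_arc D c) ** M (under_arc_in D c) ** M (over_arc D c))"
      using ijk by (intro M(4) rep_relation c)
    have inv: "inv\<^bsub>SL2C\<^esub> M i = - M i" if "i \<in> ?X" for i
      using inv_SL2C M(1)[OF that] adjM[OF that] by simp
    show ?thesis
      unfolding c(2) wirtinger_relator_def Let_def
      by (simp add: S.word_eval_Cons inv[OF ijk(1)] inv[OF ijk(2)] k neg MM[OF ijk(1)] MM[OF ijk(2)]
          MMl[OF ijk(1)] MMl[OF ijk(2)] matrix_mul_assoc[symmetric])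
  qed
  moreover have "M \<in> ?X \<rightarrow> carrier SL2C" using M(1) by (simp add: Pi_iff)
  ultimately obtain h where "h \<in> hom (presented_group ?X (relators D)) SL2C"
    and hw: "\<And>w. w \<in> words ?X \<Longrightarrow> h (word_class ?X (relators D) w) = word_eval SL2C M w"
    using S.presented_group_universal[of M ?X "relators D"] by metis
  then have h: "h \<in> hom (knot_group D) SL2C" by (simp add: knot_group_def)
  have hm: "h (meridian D i) = M i" if "i \<in> ?X" for i
    using hw[of "[(i, False)]"] that M(1)[OF that] by (simp add: meridian_def)
  have "h \<in> trace_free_reps D"
    using h hm M(2) by (simp add: trace_free_reps_def del: atLeastAtMost_iff)
  then have "fst (\<lambda>(i, j) \<in> arc_pairs D. - trace (h (meridian D i \<otimes>\<^bsub>knot_group D\<^esub> meridian D j)),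
       \<lambda>(i, j, k) \<in> arc_triples D.
         - trace (h (meridian D i \<otimes>\<^bsub>knot_group D\<^esub> meridian D j \<otimes>\<^bsub>knot_group D\<^esub> meridian D k)))
      \<in> fst ` trace_free_slice D"
    unfolding trace_free_slice_def by (intro imageI) blast
  moreover have "(\<lambda>(i, j) \<in> arc_pairs D. - trace (h (meridian D i \<otimes>\<^bsub>knot_group D\<^esub> meridian D j))) =
    gram_coords (crossings D) a"
    unfolding gram_coords_def arc_pairs_def
  proof (rule restrict_ext, clarify)
    fix i j assume "1 \<le> i" "i < j" "j \<le> crossings D"
    then have ij: "i \<in> ?X" "j \<in> ?X" by simp_all
    have "h (meridian D i \<otimes>\<^bsub>knot_group D\<^esub> meridian D j) = M i ** M j"
      using hom_SL2C(3)[OF group_knot_group[OF D] h] meridian_carrier[OF D] ij hm by simp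
    then show "- trace (h (meridian D i \<otimes>\<^bsub>knot_group D\<^esub> meridian D j)) = gram a i j"
      using M(3)[OF ij] by (simp add: gram_def)
  qed
  ultimately show ?thesis by simp
qed

text \<open>Conjugation by the first meridian is the covering involution of the branched cover.\<close>

lemma twisted_rep:
  obtains \<rho>' where "\<rho>' \<in> hom (branched_cover_group D) SL2C"
    "\<And>l. set l \<subseteq> arcs D \<Longrightarrow> even (length l) \<Longrightarrow> \<rho>' (meridian_word D l) = alt_word a True l"
    "gram_coords (crossings D) (rep_matrices D \<rho>') = gram_coords (crossings D) a"
proof -
  define \<rho>' where "\<rho>' g = \<rho> (orbifold_meridian D 1 \<otimes>\<^bsub>orbifold_group D\<^esub> (g \<otimes>\<^bsub>orbifold_group D\<^esub> orbifold_meridian D 1))" for g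
  have word: "\<rho>' (meridian_word D l) = alt_word a True l" if "set l \<subseteq> arcs D" "even (length l)" for l
  proof -
    have "meridian_word D (1 # l @ [1]) =
      orbifold_meridian D 1 \<otimes>\<^bsub>orbifold_group D\<^esub> (meridian_word D l \<otimes>\<^bsub>orbifold_group D\<^esub> orbifold_meridian D 1)"
      using meridian_word_append[OF D that(1), of "[1]"] one_in_arcs[OF D] orbifold_meridian_carrier[OF D, of 1]
        group.is_monoid[OF group_orbifold_group[OF D]]
      by (simp add: meridian_word_Cons[OF D] meridian_word_Nil[OF D])
    then have "\<rho>' (meridian_word D l) = alt_word a False (1 # l @ [1])"
      using rep_word[of "1 # l @ [1]"] that one_in_arcs[OF D] by (simp add: \<rho>'_def del: alt_word.simps)
    then show ?thesis using alt_word_conj[OF that(2), of a 1] rep_matrices_one by (simp del: alt_word.simps)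
  qed
  have hom: "\<rho>' \<in> hom (branched_cover_group D) SL2C"
  proof (rule homI)
    fix x y assume "x \<in> carrier (branched_cover_group D)" "y \<in> carrier (branched_cover_group D)"
    then obtain v w where v: "set v \<subseteq> arcs D" "even (length v)" "x = meridian_word D v"
      and w: "set w \<subseteq> arcs D" "even (length w)" "y = meridian_word D w"
      unfolding carrier_branched_cover_group[OF D] by blast
    have "det (alt_word a True v) = 1" using v(1) det_rep_matrices by (intro det_alt_word) blast
    then show "\<rho>' x \<in> carrier SL2C" using word[OF v(1,2)] v(3) by simp
    have "\<rho>' (meridian_word D (v @ w)) = alt_word a True (v @ w)"
      using v w by (intro word) simp_all
    then show "\<rho>' (x \<otimes>\<^bsub>branched_cover_group D\<^esub> y) = \<rho>' x \<otimes>\<^bsub>SL2C\<^esub> \<rho>' y"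
      using word v w word_append[OF v(1) w(1)] by (simp add: alt_word_append)
  qed
  have mats: "rep_matrices D \<rho>' i = adj2 (a i)" if "i \<in> arcs D" for i
    using word[of "[1, i]"] that one_in_arcs[OF D] meridian_product_eq[OF D one_in_arcs[OF D] that]
    by (simp add: rep_matrices_def[of D \<rho>'] rep_matrices_one)
  have "gram_coords (crossings D) (rep_matrices D \<rho>') = gram_coords (crossings D) a"
    unfolding gram_coords_def
  proof (rule restrict_ext, clarify)
    fix i j assume "1 \<le> i" "i < j" "j \<le> crossings D"
    then have ij: "i \<in> arcs D" "j \<in> arcs D" by simp_all
    \<comment> \<open>The twist replaces every \<open>a i\<close> by its inverse, under which the
      polarized norm form is invariant.\<close>
    have "trace (a i ** adj2 (a j)) = trace (adj2 (a i) ** a j)"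
      by (simp add: trace_2 mult_2 adj2_nth algebra_simps)
    then show "gram (rep_matrices D \<rho>') i j = gram a i j"
      by (simp add: gram_def mats[OF ij(1)] mats[OF ij(2)])
  qed
  with hom word that show thesis by blast
qed

end

text \<open>Multiplying a trace-free representation on the meridians by the imaginary unit makes
  their squares trivial, and keeps determinant 1 on even words.\<close>

lemma branched_rep_of_trace_free:
  assumes "x \<in> fst ` trace_free_slice D"
  obtains \<rho> where "\<rho> \<in> hom (branched_cover_group D) SL2C" "gram_coords (crossings D) (rep_matrices D \<rho>) = x"
    "\<And>l. set l \<subseteq> arcs D \<Longrightarrow> even (length l) \<Longrightarrow>
      trace (alt_word (rep_matrices D \<rho>) False l) = trace (alt_word (rep_matrices D \<rho>) True l)"
proof -
  let ?X = "arcs D"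
  obtain h where h: "h \<in> trace_free_reps D"
    and x: "x = (\<lambda>(i, j) \<in> arc_pairs D. - trace (h (meridian D i \<otimes>\<^bsub>knot_group D\<^esub> meridian D j)))"
    using assms unfolding trace_free_slice_def by fastforce
  have hom: "h \<in> hom (knot_group D) SL2C" using h by (simp add: trace_free_reps_def)
  note h_simps = hom_SL2C[OF group_knot_group[OF D] hom]
  define M where "M i = h (meridian D i)" for i
  have M: "det (M i) = 1" "trace (M i) = 0" if "i \<in> ?X" for i
    using h h_simps(2) meridian_carrier[OF D that] that by (simp_all add: M_def trace_free_reps_def)
  have neg: "A ** (- B) = - (A ** B)" "(- A) ** B = - (A ** B)" for A B :: "complex^2^2"
    by (simp_all add: mat2_simps)
  have MM: "M i ** M i = - mat 1" if "i \<in> ?X" for i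
    using trace_free_square[OF M(2)[OF that]] M(1)[OF that] by simp
  have MMl: "M i ** (M i ** B) = - B" if "i \<in> ?X" for i and B :: "complex^2^2"
    by (simp add: matrix_mul_assoc MM[OF that] neg)
  define N where "N i = \<i> \<cdot> M i" for i
  have scale_scale: "c \<cdot> d \<cdot> A = (c * d) \<cdot> A" for c d A by (simp add: mat2_simps)
  have scale_neg: "c \<cdot> (- A) = (- c) \<cdot> A" for c A by (simp add: mat2_simps)
  note scale = scale2_mult_left scale2_mult_right scale_scale
  have NN: "N i ** N i = mat 1" if "i \<in> ?X" for i
    by (simp add: N_def scale MM[OF that])
  have detN: "det (N i) = -1" if "i \<in> ?X" for i
    using M[OF that] by (simp add: N_def det_scale2)
  have rel: "N (over_arc D c) ** N (under_arc_in D c) ** N (over_arc D c) = N (under_arc_out D c)"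
    if "c < crossings D" for c
  proof -
    define i j k where "i = over_arc D c" "j = under_arc_in D c" "k = under_arc_out D c"
    have ijk: "i \<in> ?X" "j \<in> ?X" "k \<in> ?X"
      using over_arc_range[OF D that] under_arc_in_range[OF D that] under_arc_out_range[OF D that]
      by (simp_all add: i_j_k_def)
    have push: "M p ** M q = M r ** M s"
      if "meridian D p \<otimes>\<^bsub>knot_group D\<^esub> meridian D q = meridian D r \<otimes>\<^bsub>knot_group D\<^esub> meridian D s"
        "p \<in> ?X" "q \<in> ?X" "r \<in> ?X" "s \<in> ?X" for p q r s
      using arg_cong[OF that(1), of h] h_simps(3) meridian_carrier[OF D] that(2-) by (simp add: M_def)
    have "M i ** M j ** M i = - M k"
      using wirtinger_relation[OF D that, folded i_j_k_def]
    proof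
      assume "meridian D i \<otimes>\<^bsub>knot_group D\<^esub> meridian D k = meridian D j \<otimes>\<^bsub>knot_group D\<^esub> meridian D i"
      then have "M i ** M k = M j ** M i" using push ijk by blast
      then have "M i ** M j ** M i = M i ** (M i ** M k)" by (simp add: matrix_mul_assoc[symmetric])
      then show ?thesis using MMl[OF ijk(1)] by simp
    next
      assume "meridian D k \<otimes>\<^bsub>knot_group D\<^esub> meridian D i = meridian D i \<otimes>\<^bsub>knot_group D\<^esub> meridian D j"
      then have "M k ** M i = M i ** M j" using push ijk by blast
      then have "M i ** M j ** M i = M k ** (M i ** M i)" by (simp add: matrix_mul_assoc)
      then show ?thesis using MM[OF ijk(1)] by (simp add: neg)
    qed
    then have "N i ** N j ** N i = N k" by (simp add: N_def scale scale_neg neg)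
    then show ?thesis by (simp add: i_j_k_def)
  qed
  \<comment> \<open>The matrices \<open>N i\<close> have determinant -1, so the representation of
    the orbifold group takes values in \<open>GL2C\<close>; on even words the determinant is 1
    again.\<close>
  obtain H where H: "H \<in> hom (orbifold_group D) GL2C"
    "\<And>l. set l \<subseteq> ?X \<Longrightarrow> H (meridian_word D l) = foldr (\<otimes>\<^bsub>GL2C\<^esub>) (map N l) \<one>\<^bsub>GL2C\<^esub>"
  proof (rule orbifold_universal[OF D group_GL2C, of N])
    show "N i \<in> carrier GL2C" "N i \<otimes>\<^bsub>GL2C\<^esub> N i = \<one>\<^bsub>GL2C\<^esub>" if "i \<in> ?X" for i
      using detN[OF that] NN[OF that] by simp_all
    show "N (over_arc D c) \<otimes>\<^bsub>GL2C\<^esub> N (under_arc_in D c) \<otimes>\<^bsub>GL2C\<^esub> N (over_arc D c) = N (under_arc_out D c)"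
      if "c < crossings D" for c using rel[OF that] by simp
  qed (assumption | rule that)+
  have detH: "det (H (meridian_word D l)) = (-1) ^ length l" if "set l \<subseteq> ?X" for l
  proof -
    have "det (foldr (**) (map N l) (mat 1)) = (-1) ^ length l"
      using that by (induction l) (simp_all add: det_mul detN del: atLeastAtMost_iff)
    then show ?thesis using H(2)[OF that] by simp
  qed
  have H\<pi>: "H \<in> hom (branched_cover_group D) SL2C"
  proof (rule homI)
    fix g g' assume "g \<in> carrier (branched_cover_group D)" "g' \<in> carrier (branched_cover_group D)"
    then obtain l l' where l: "set l \<subseteq> ?X" "even (length l)" "g = meridian_word D l"
      and l': "set l' \<subseteq> ?X" "even (length l')" "g' = meridian_word D l'"
      unfolding carrier_branched_cover_group[OF D] by blast
    then show "H g \<in> carrier SL2C" using detH by simp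
    show "H (g \<otimes>\<^bsub>branched_cover_group D\<^esub> g') = H g \<otimes>\<^bsub>SL2C\<^esub> H g'"
      using hom_mult[OF H(1), of g g'] l l' meridian_word_closed[OF D] mult_branched_cover_group[OF D] by simp
  qed
  let ?a = "rep_matrices D H"
  have a: "?a i = N 1 ** N i" if "i \<in> ?X" for i
    using rep_matrices_word[OF H\<pi> that] H(2)[of "[1, i]"] that one_in_arcs[OF D] by simp
  have adj_N: "adj2 (N i) = - N i" if "i \<in> ?X" for i
  proof -
    have "adj2 (c \<cdot> A) = c \<cdot> adj2 A" for c A by (simp add: mat2_simps algebra_simps)
    moreover have "adj2 (M i) = - M i" using M(2)[OF that] by (simp add: adj2_def) (simp add: mat2_simps)
    ultimately have "adj2 (N i) = \<i> \<cdot> (- M i)" by (simp only: N_def)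
    also have "\<dots> = - N i" by (simp add: N_def vec_eq_iff scale2_nth)
    finally show ?thesis .
  qed
  have adj_a: "adj2 (?a i) = N i ** N 1" if "i \<in> ?X" for i
    using adj_N[OF that] adj_N[OF one_in_arcs[OF D]] by (simp add: a[OF that] adj2_mult neg)
  have NNl: "N i ** (N i ** B) = B" if "i \<in> ?X" for i and B :: "complex^2^2"
    by (simp add: matrix_mul_assoc NN[OF that])
  have gram_eq: "gram_coords (crossings D) ?a = x"
    unfolding x gram_coords_def arc_pairs_def
  proof (rule restrict_ext, clarify)
    fix i j assume "1 \<le> i" "i < j" "j \<le> crossings D"
    then have ij: "i \<in> ?X" "j \<in> ?X" by simp_all
    have "adj2 (?a i) ** ?a j = N i ** N j"
      using NNl[OF one_in_arcs[OF D]] by (simp add: adj_a[OF ij(1)] a[OF ij(2)] matrix_mul_assoc[symmetric])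
    also have "\<dots> = (- 1) \<cdot> (M i ** M j)" by (simp add: N_def scale)
    finally have "gram ?a i j = - trace (M i ** M j)" by (simp add: gram_def trace_2)
    then show "gram ?a i j = - trace (h (meridian D i \<otimes>\<^bsub>knot_group D\<^esub> meridian D j))"
      using h_simps(3) meridian_carrier[OF D] ij by (simp add: M_def)
  qed
  \<comment> \<open>The representation extends to the odd element m_1 with value \<open>N 1\<close>,
    so the covering involution acts as conjugation by \<open>N 1\<close> and preserves
    traces.\<close>
  have conj: "alt_word ?a True l = N 1 ** (alt_word ?a False l ** N 1)" if "set l \<subseteq> ?X" "even (length l)" for l
    using that
  proof (induction l rule: induct_list012)
    case 1
    show ?case using NN[OF one_in_arcs[OF D]] by simp
  next
    case (3 i j l)
    then have ij: "i \<in> ?X" "j \<in> ?X" by simp_all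
    let ?W = "alt_word ?a False l"
    have IH: "alt_word ?a True l = N 1 ** (?W ** N 1)" using 3 by simp
    have "alt_word ?a True (i # j # l) = ?a i ** (adj2 (?a j) ** alt_word ?a True l)" by simp
    also have "\<dots> = N 1 ** (N i ** (N j ** (?W ** N 1)))"
      unfolding IH adj_a[OF ij(2)] unfolding a[OF ij(1)]
      using NNl[OF one_in_arcs[OF D]] by (simp add: matrix_mul_assoc[symmetric])
    finally have 1: "alt_word ?a True (i # j # l) = N 1 ** (N i ** (N j ** (?W ** N 1)))" .
    have "alt_word ?a False (i # j # l) = adj2 (?a i) ** (?a j ** ?W)" by simp
    also have "\<dots> = N i ** (N j ** ?W)"
      unfolding adj_a[OF ij(1)] unfolding a[OF ij(2)]
      using NNl[OF one_in_arcs[OF D]] by (simp add: matrix_mul_assoc[symmetric])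
    finally show ?case unfolding 1 by (simp add: matrix_mul_assoc[symmetric])
  qed simp
  have "trace (alt_word ?a False l) = trace (alt_word ?a True l)" if "set l \<subseteq> ?X" "even (length l)" for l
    using trace_mul_sym[of "N 1" "alt_word ?a False l ** N 1"] NN[OF one_in_arcs[OF D]]
    by (simp add: conj[OF that] matrix_mul_assoc[symmetric])
  with H\<pi> gram_eq that show thesis by blast
qed

text \<open>The square of the difference of the two traces is a polynomial in the Gram matrix, so it
  agrees with that of a representation obtained from a trace-free lift of the same point, where it
  is zero.\<close>

lemma involution_invariant:
  assumes ghost: "ghost_characters D = {}" and \<rho>: "\<rho> \<in> hom (branched_cover_group D) SL2C"
    and l: "set l \<subseteq> arcs D" "even (length l)"
  shows "trace (alt_word (rep_matrices D \<rho>) False l) = trace (alt_word (rep_matrices D \<rho>) True l)"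
proof -
  let ?a = "rep_matrices D \<rho>" and ?n = "crossings D"
  have "gram_coords ?n ?a \<in> fst ` trace_free_slice D"
    using ghost gram_coords_fundamental[OF \<rho>] unfolding ghost_characters_def by blast
  then obtain \<rho>' where \<rho>': "\<rho>' \<in> hom (branched_cover_group D) SL2C"
    "gram_coords ?n (rep_matrices D \<rho>') = gram_coords ?n ?a"
    "trace (alt_word (rep_matrices D \<rho>') False l) = trace (alt_word (rep_matrices D \<rho>') True l)"
    using branched_rep_of_trace_free l by metis
  let ?b = "rep_matrices D \<rho>'"
  have det: "\<forall>i\<in>{1..?n}. det (?a i) = 1" "\<forall>i\<in>{1..?n}. det (?b i) = 1"
    using det_rep_matrices[OF \<rho>] det_rep_matrices[OF \<rho>'(1)] by blast+
  have same: "alt_trace ?a k = alt_trace ?b k" if "set k \<subseteq> arcs D" "even (length k)" for k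
    using alt_trace_polynomial[OF that(2,1)] det \<rho>'(2) by metis
  have "alt_trace ?a l = alt_trace ?b l" "alt_trace ?a (l @ 1 # l @ [1]) = alt_trace ?b (l @ 1 # l @ [1])"
    "alt_trace ?a (l @ 1 # rev l @ [1]) = alt_trace ?b (l @ 1 # rev l @ [1])"
    using l one_in_arcs[OF D] by (intro same; simp)+
  then have "(trace (alt_word ?a False l) - trace (alt_word ?a True l))\<^sup>2 =
    (trace (alt_word ?b False l) - trace (alt_word ?b True l))\<^sup>2"
    using alt_word_trace_difference[OF l(2), of ?a 1] alt_word_trace_difference[OF l(2), of ?b 1]
      rep_matrices_one[OF \<rho>] rep_matrices_one[OF \<rho>'(1)] by simp
  then show ?thesis using \<rho>'(3) by simp
qed

text \<open>Invariance makes \<open>trace (\<rho> g)\<close> half of \<open>alt_trace\<close>, which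
  is polynomial in the Gram matrix. The polynomial depends only on \<open>g\<close>, which yields
  both the injectivity and the polynomial inverse of h*.\<close>

lemma trace_polynomial_in_gram:
  assumes ghost: "ghost_characters D = {}" and g: "g \<in> carrier (branched_cover_group D)"
  obtains p where "p \<in> polynomial_functions (arc_pairs D)"
    "\<And>\<rho>. \<rho> \<in> hom (branched_cover_group D) SL2C \<Longrightarrow> trace (\<rho> g) = p (gram_coords (crossings D) (rep_matrices D \<rho>))"
proof -
  obtain l where l: "set l \<subseteq> arcs D" "even (length l)" "g = meridian_word D l"
    using g unfolding carrier_branched_cover_group[OF D] by blast
  obtain p where p: "p \<in> polynomial_functions (arc_pairs D)"
    "\<And>a. \<forall>i\<in>{1..crossings D}. det (a i) = 1 \<Longrightarrow> alt_trace a l = p (gram_coords (crossings D) a)"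
    using alt_trace_polynomial[OF l(2,1)] unfolding arc_pairs_def by blast
  show thesis
  proof (rule that)
    show "(\<lambda>x. 1/2 * p x) \<in> polynomial_functions (arc_pairs D)"
      by (intro polynomial_functions.intros p)
    fix \<rho> assume \<rho>: "\<rho> \<in> hom (branched_cover_group D) SL2C"
    have "trace (\<rho> g) = 1/2 * alt_trace (rep_matrices D \<rho>) l"
      using rep_word[OF \<rho> l(1,2)] involution_invariant[OF ghost \<rho> l(1,2)] l(3) by (simp add: alt_trace_def)
    then show "trace (\<rho> g) = 1/2 * p (gram_coords (crossings D) (rep_matrices D \<rho>))"
      using p(2) det_rep_matrices[OF \<rho>] by metis
  qed
qed

end

theorem theorem4p10:
  fixes D :: knot_diagram
    and gs :: "nat word set set list"
  assumes "is_knot_diagram D"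
    and "set gs \<subseteq> carrier (branched_cover_group D)"
    and "generate (branched_cover_group D) (set gs) = carrier (branched_cover_group D)"
  shows "ng_conjecture D gs \<longleftrightarrow> ghost_characters D = {}"
proof -
  note D = assms(1)
  let ?\<pi> = "branched_cover_group D" and ?n = "crossings D"
  let ?T = "trace_coordinates ?\<pi> gs" and ?V = "character_variety ?\<pi> gs" and ?f = "h_star_coords D gs"
  have group: "group ?\<pi>" using D by (rule group_branched_cover_group)
  note inj = inj_on_trace_coordinates[OF group assms(2,3)]
  have V: "?V = (\<lambda>\<rho>. ?T (char_of ?\<pi> \<rho>)) ` hom ?\<pi> SL2C"
    by (simp add: character_variety_def characters_eq image_image)
  have f: "?f (?T (char_of ?\<pi> \<rho>)) = gram_coords ?n (rep_matrices D \<rho>)" if "\<rho> \<in> hom ?\<pi> SL2C" for \<rho>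
  proof -
    have "char_of ?\<pi> \<rho> \<in> characters ?\<pi>" using that by (simp add: characters_eq)
    then show ?thesis
      using inv_into_f_f[OF inj] h_star_char_of[OF D that] by (simp add: h_star_coords_def)
  qed
  show ?thesis
  proof
    assume "ng_conjecture D gs"
    then have bij: "bij_betw ?f ?V (fundamental_variety D)"
      by (simp add: ng_conjecture_def algebraic_isomorphism_def)
    have "x \<in> fst ` trace_free_slice D" if "x \<in> fundamental_variety D" for x
    proof -
      have "x \<in> ?f ` ?V" using that bij_betw_imp_surj_on[OF bij] by simp
      then obtain \<rho> where \<rho>: "\<rho> \<in> hom ?\<pi> SL2C" "x = gram_coords ?n (rep_matrices D \<rho>)"
        using f unfolding V by auto
      \<comment> \<open>A representation and its twist by the covering involution have the same Gram
        matrix, so injectivity of h* forces their characters to coincide.\<close>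
      obtain \<rho>' where \<rho>': "\<rho>' \<in> hom ?\<pi> SL2C"
        "\<And>l. set l \<subseteq> arcs D \<Longrightarrow> even (length l) \<Longrightarrow> \<rho>' (meridian_word D l) = alt_word (rep_matrices D \<rho>) True l"
        "gram_coords ?n (rep_matrices D \<rho>') = gram_coords ?n (rep_matrices D \<rho>)"
        by (rule twisted_rep[OF D \<rho>(1)]) (assumption | rule that)+
      have "?f (?T (char_of ?\<pi> \<rho>')) = ?f (?T (char_of ?\<pi> \<rho>))"
        using f \<rho>(1) \<rho>'(1,3) by simp
      then have "?T (char_of ?\<pi> \<rho>') = ?T (char_of ?\<pi> \<rho>)"
        using inj_onD[OF bij_betw_imp_inj_on[OF bij]] \<rho>(1) \<rho>'(1) unfolding V by blast
      then have char: "char_of ?\<pi> \<rho>' = char_of ?\<pi> \<rho>"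
        using inj_onD[OF inj] \<rho>(1) \<rho>'(1) unfolding characters_eq by blast
      have "trace (alt_word (rep_matrices D \<rho>) False l) = trace (alt_word (rep_matrices D \<rho>) True l)"
        if "set l \<subseteq> arcs D" "even (length l)" for l
        using fun_cong[OF char, of "meridian_word D l"] word_carrier[OF D that] rep_word[OF D \<rho>(1) that] \<rho>'(2)[OF that]
        by (simp add: char_of_def)
      from trace_free_lift_hom[OF D \<rho>(1) this] show ?thesis using \<rho>(2) by simp
    qed
    then show "ghost_characters D = {}" by (auto simp: ghost_characters_def)
  next
    assume ghost: "ghost_characters D = {}"
    have inj_f: "inj_on ?f ?V"
    proof (rule inj_onI)
      fix y y' assume "y \<in> ?V" "y' \<in> ?V" and eq: "?f y = ?f y'"
      then obtain \<rho> \<rho>' where \<rho>: "\<rho> \<in> hom ?\<pi> SL2C" "y = ?T (char_of ?\<pi> \<rho>)"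
        and \<rho>': "\<rho>' \<in> hom ?\<pi> SL2C" "y' = ?T (char_of ?\<pi> \<rho>')" unfolding V by blast
      have "gram_coords ?n (rep_matrices D \<rho>) = gram_coords ?n (rep_matrices D \<rho>')"
        using eq f \<rho> \<rho>' by simp
      then have "trace (\<rho> g) = trace (\<rho>' g)" if "g \<in> carrier ?\<pi>" for g
        using trace_polynomial_in_gram[OF D ghost that] \<rho>(1) \<rho>'(1) by metis
      then have "char_of ?\<pi> \<rho> = char_of ?\<pi> \<rho>'" unfolding char_of_def by (intro restrict_ext)
      then show "y = y'" using \<rho>(2) \<rho>'(2) by simp
    qed
    have image_f: "?f ` ?V = fundamental_variety D"
    proof (intro equalityI subsetI)
      fix x assume "x \<in> ?f ` ?V"
      then obtain \<rho> where "\<rho> \<in> hom ?\<pi> SL2C" "x = gram_coords ?n (rep_matrices D \<rho>)"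
        using f unfolding V by auto
      then show "x \<in> fundamental_variety D" using gram_coords_fundamental[OF D] by simp
    next
      \<comment> \<open>Surjectivity: a point that lifts to the trace-free slice is the Gram matrix
        of the branched cover representation made from the lift.\<close>
      fix x assume "x \<in> fundamental_variety D"
      then have "x \<in> fst ` trace_free_slice D" using ghost unfolding ghost_characters_def by blast
      then obtain \<rho> where "\<rho> \<in> hom ?\<pi> SL2C" "gram_coords ?n (rep_matrices D \<rho>) = x"
        using branched_rep_of_trace_free[OF D] by metis
      then show "x \<in> ?f ` ?V" using f unfolding V by force
    qed
    have "polynomial_map (trace_indices (length gs)) ?V (arc_pairs D) ?f"
      unfolding polynomial_map_def
    proof clarify
      fix i j assume ij: "(i, j) \<in> arc_pairs D"
      then have arcs: "i \<in> arcs D" "j \<in> arcs D" by (simp_all add: arc_pairs_def)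
      let ?g = "meridian_product D i j"
      have g: "?g \<in> carrier ?\<pi>"
        using meridian_product_eq[OF D arcs] word_carrier[OF D, of "[i, j]"] arcs by simp
      then have "?g \<in> generate ?\<pi> (set gs)" using assms(3) by simp
      then obtain p where p: "p \<in> polynomial_functions (trace_indices (length gs))"
        "\<And>\<rho>. \<rho> \<in> hom ?\<pi> SL2C \<Longrightarrow> trace (\<rho> ?g) = p (?T (char_of ?\<pi> \<rho>))"
        using character_polynomial[OF group assms(2)] by metis
      show "\<exists>p\<in>polynomial_functions (trace_indices (length gs)). \<forall>x\<in>?V. ?f x (i, j) = p x"
      proof (intro bexI[OF _ p(1)] ballI)
        fix y assume "y \<in> ?V"
        then obtain \<rho> where \<rho>: "\<rho> \<in> hom ?\<pi> SL2C" "y = ?T (char_of ?\<pi> \<rho>)" unfolding V by blast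
        have "?f y (i, j) = h_star D (char_of ?\<pi> \<rho>) (i, j)"
          using f \<rho> h_star_char_of[OF D] by simp
        also have "\<dots> = trace (\<rho> ?g)" using ij g by (simp add: h_star_def char_of_def)
        finally show "?f y (i, j) = p y" using p(2) \<rho> by simp
      qed
    qed
    moreover have "polynomial_map (arc_pairs D) (fundamental_variety D) (trace_indices (length gs)) (inv_into ?V ?f)"
      unfolding polynomial_map_def
    proof
      \<comment> \<open>A coordinate of the inverse map is the trace of one fixed product of
        generators, and hence polynomial in the Gram matrix.\<close>
      fix "is" assume "is": "is \<in> trace_indices (length gs)"
      define g where "g = foldr (mult ?\<pi>) (map ((!) gs) is) \<one>\<^bsub>?\<pi>\<^esub>"
      have "foldr (mult ?\<pi>) (map ((!) gs) js) \<one>\<^bsub>?\<pi>\<^esub> \<in> carrier ?\<pi>" if "set js \<subseteq> {..<length gs}" for js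
        using that
      proof (induction js)
        case (Cons j js)
        then have "gs ! j \<in> carrier ?\<pi>" using assms(2) by auto
        then show ?case using Cons monoid.m_closed[OF group.is_monoid[OF group]] by simp
      qed (use monoid.one_closed[OF group.is_monoid[OF group]] in simp)
      then have g: "g \<in> carrier ?\<pi>" using "is" by (simp add: g_def trace_indices_def)
      then obtain p where p: "p \<in> polynomial_functions (arc_pairs D)"
        "\<And>\<rho>. \<rho> \<in> hom ?\<pi> SL2C \<Longrightarrow> trace (\<rho> g) = p (gram_coords ?n (rep_matrices D \<rho>))"
        using trace_polynomial_in_gram[OF D ghost] by metis
      show "\<exists>p\<in>polynomial_functions (arc_pairs D). \<forall>x\<in>fundamental_variety D. inv_into ?V ?f x is = p x"
      proof (intro bexI[OF _ p(1)] ballI)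
        fix x assume "x \<in> fundamental_variety D"
        then have "x \<in> ?f ` ?V" using image_f by simp
        then obtain y where y: "y \<in> ?V" "x = ?f y" by blast
        then obtain \<rho> where \<rho>: "\<rho> \<in> hom ?\<pi> SL2C" "y = ?T (char_of ?\<pi> \<rho>)" unfolding V by blast
        have "inv_into ?V ?f x is = y is" using y inv_into_f_f[OF inj_f] by simp
        also have "\<dots> = trace (\<rho> g)"
          using "is" g by (simp add: \<rho>(2) trace_coordinates_def char_of_def g_def)
        also have "\<dots> = p x" using p(2)[OF \<rho>(1)] f[OF \<rho>(1)] y(2) \<rho>(2) by simp
        finally show "inv_into ?V ?f x is = p x" .
      qed
    qed
    ultimately show "ng_conjecture D gs"
      using inj_f image_f by (simp add: ng_conjecture_def algebraic_isomorphism_def bij_betw_def)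
  qed
qed

end
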